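(* Let $n\ge 2$. Let $\varphi\colon\mathfrak{Y}\to\mathfrak{Y}$ be a minimal Cantor action (a homeomorphism of a Cantor set $\mathfrak{Y}$ with all orbits dense, for example one of Denjoy type; it is not assumed to be Lipschitz), and let $h\colon\mathfrak{X}_n\to\mathfrak{Y}$ be a homeomorphism. Let $\widehat{\mathcal{G}}_{\mathfrak{X}_n}$ be the fusion pseudogroup on $\mathfrak{X}_n$ obtained by adjoining $h^{-1}\circ\varphi\circ h$ to $\mathcal{G}_{\mathfrak{X}_n}$, whose action is minimal, and let $\widehat{\mathfrak{M}}_n$ be the suspension matchbox manifold obtained from $\widehat{\mathcal{G}}_{\mathfrak{X}_n}$. Then the minimal matchbox manifold $\widehat{\mathfrak{M}}_n$ is not homeomorphic to an invariant subset of any $C^1$-foliation $\mathcal{F}_M$ of a manifold $M$.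
   Context: **Matchbox manifolds.** A foliated space of dimension $k$ is a compact metric space $\mathfrak{M}$ for which there is a separable metric space $\mathfrak{X}$ such that each $x\in\mathfrak{M}$ has an open neighborhood $U_x$, a compact subset $\mathfrak{X}_x\subset\mathfrak{X}$, and a homeomorphism $\varphi_x\colon\overline{U}_x\to[-1,1]^k\times\mathfrak{X}_x$ with $\varphi_x(x)=(0,w_x)$, $w_x\in\mathrm{int}(\mathfrak{X}_x)$, which extends to a foliated homeomorphism $\widehat U_x\to(-2,2)^k\times\mathfrak{X}_x$ with $\overline U_x\subset\widehat U_x$. The sets $\varphi_x^{-1}(V\times\{w\})$, with $V\subset(-1,1)^k$ open, form a basis for the fine topology, whose connected components are the leaves. The foliated space is smooth if the charts can be chosen so that the transition maps between plaques $\varphi_x^{-1}([-1,1]^k\times\{w\})$ are smooth and depend continuously on the transverse parameter in the $C^\infty$-topology. A matchbox manifold is a connected smooth foliated space for which $\mathfrak{X}$ is totally disconnected and each $\mathfrak{X}_x$ is a clopen subset of $\mathfrak{X}$. It is minimal if every leaf is dense. Its holonomy pseudogroup, acting on a transversal, is generated by the transverse changes of coordinates between overlapping foliation charts. **The space $\mathfrak{X}_n$.** Let $\mathcal{T}_n$ be the Cayley graph of the free group $\mathbb{F}_n$ on $n$ generators, a tree with a chosen basepoint $e$ (the identity), each edge having length $1$, with the path-length metric; $B(e,m)$ is the closed ball of radius $m$ about $e$. A subtree $T\subset\mathcal{T}_n$ has a dead end if some vertex of $T$ is contained in a unique edge of $T$. Let $X_n$ be the set of all connected subtrees $T\subset\mathcal{T}_n$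 which have no dead ends and satisfy $e\in T$, with the metric determined by $d(T,T')\le 2^{-m}\iff B(e,m)\cap T=B(e,m)\cap T'$. Let $\mathfrak{X}_n$ be the closure of $X_n$ in this metric; its points are subtrees of $\mathcal{T}_n$ containing $e$. The space $\mathfrak{X}_n$ is a Cantor set, the absence of isolated points coming from the no-dead-ends condition. **The pseudogroup $\mathcal{G}_{\mathfrak{X}_n}$.** This is the pseudogroup on $\mathfrak{X}_n$ defined by the translation action of $\mathbb{F}_n$ on $\mathcal{T}_n$: a word $\gamma\in\mathbb{F}_n$ acts on the pointed subtree $(T,e)$ if $\gamma\cdot e\in T$, sending it to $(\gamma^{-1}\cdot T,e)\in\mathfrak{X}_n$. **Suspension.** The suspension construction for pseudogroups (known from the literature on graph matchbox manifolds) produces, from a pseudogroup such as $\mathcal{G}_{\mathfrak{X}_n}$, a $2$-dimensional matchbox manifold whose holonomy pseudogroup is the given pseudogroup. $\widehat{\mathfrak{M}}_n$ is the matchbox manifold obtained by applying this construction to $\widehat{\mathcal{G}}_{\mathfrak{X}_n}$. **Invariant subsets.** An invariant subset of a foliation $\mathcal{F}_M$ of $M$ is a union of leaves of $\mathcal{F}_M$. *)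

theory Defs
  imports "HOL-Analysis.Analysis" "HOL-Algebra.Group"
begin

section \<open>Free groups, Cayley trees and the space of pointed subtrees\<close>

text \<open>A letter \<open>(i, True)\<close> is the \<open>i\<close>-th generator and \<open>(i, False)\<close> its inverse. Elements of the
  free group on \<open>n\<close> generators are reduced words in the letters with \<open>i < n\<close>.\<close>

type_synonym letter = "nat \<times> bool"

definition letter_inv :: "letter \<Rightarrow> letter" where
  "letter_inv a = (fst a, \<not> snd a)"

definition reduced_word :: "letter list \<Rightarrow> bool" where
  "reduced_word = successively (\<lambda>a b. b \<noteq> letter_inv a)"

fun push_letter :: "letter \<Rightarrow> letter list \<Rightarrow> letter list" where
  "push_letter a [] = [a]"
| "push_letter a (b # w) = (if b = letter_inv a then w else a # b # w)"

definition free_group :: "nat \<Rightarrow> letter list monoid" where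
  "free_group n =
     \<lparr>carrier = {w. reduced_word w \<and> fst ` set w \<subseteq> {..<n}},
      monoid.mult = (\<lambda>u v. foldr push_letter u v),
      one = []\<rparr>"

lemma letter_inv_simps [simp]:
  "letter_inv (letter_inv a) = a" "letter_inv a \<noteq> a" "a \<noteq> letter_inv a" "fst (letter_inv a) = fst a"
  by (auto simp: letter_inv_def prod_eq_iff)

lemma reduced_word_simps [simp]:
  "reduced_word []" "reduced_word [a]"
  "reduced_word (a # b # w) \<longleftrightarrow> b \<noteq> letter_inv a \<and> reduced_word (b # w)"
  by (simp_all add: reduced_word_def)

lemma reduced_word_tl: "reduced_word (a # w) \<Longrightarrow> reduced_word w"
  by (cases w) auto

lemma reduced_push: "reduced_word w \<Longrightarrow> reduced_word (push_letter a w)"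
  by (cases w) (auto dest: reduced_word_tl)

lemma push_inverse: "reduced_word w \<Longrightarrow> push_letter a (push_letter (letter_inv a) w) = w"
  by (cases w; cases "tl w") auto

lemma reduced_foldr: "reduced_word v \<Longrightarrow> reduced_word (foldr push_letter u v)"
  by (induction u) (auto simp: reduced_push)

lemma letters_push: "set (push_letter a w) \<subseteq> insert a (set w)"
  by (cases w) auto

lemma letters_foldr: "set (foldr push_letter u v) \<subseteq> set u \<union> set v"
  by (induction u) (use letters_push in fastforce)+

lemma foldr_push_letter:
  assumes "reduced_word w"
  shows "foldr push_letter (push_letter a v) w = push_letter a (foldr push_letter v w)"
  using push_inverse[OF reduced_foldr[OF assms]]
  by (cases v) auto

lemma foldr_push_assoc:
  "reduced_word w \<Longrightarrow>
   foldr push_letter (foldr push_letter u v) w = foldr push_letter u (foldr push_letter v w)"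
  by (induction u) (auto simp: foldr_push_letter)

lemma foldr_push_id: "reduced_word w \<Longrightarrow> foldr push_letter w [] = w"
proof (induction w)
  case (Cons a w)
  then show ?case by (cases w) (auto dest: reduced_word_tl)
qed auto

lemma foldr_push_inverse:
  "reduced_word w \<Longrightarrow> foldr push_letter (rev (map letter_inv u)) (foldr push_letter u w) = w"
proof (induction u)
  case (Cons a u)
  then show ?case
    using push_inverse[OF reduced_foldr, of w "letter_inv a" u] by simp
qed auto

lemma group_free_group: "group (free_group n)"
proof (rule groupI)
  fix x assume x: "x \<in> carrier (free_group n)"
  define y where "y = foldr push_letter (rev (map letter_inv x)) []"
  have "reduced_word y"
    by (simp add: y_def reduced_foldr)
  moreover have "fst ` set y \<subseteq> {..<n}"
  proof -
    have "set y \<subseteq> letter_inv ` set x"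
      using letters_foldr[of "rev (map letter_inv x)" "[]"] by (simp add: y_def)
    then have "fst ` set y \<subseteq> fst ` letter_inv ` set x"
      by (rule image_mono)
    also have "\<dots> = fst ` set x"
      by (simp add: image_image)
    also have "\<dots> \<subseteq> {..<n}"
      using x by (simp add: free_group_def)
    finally show ?thesis .
  qed
  moreover have "foldr push_letter y x = []"
  proof -
    have "foldr push_letter y x = foldr push_letter (rev (map letter_inv x)) x"
      using x by (simp add: y_def foldr_push_assoc free_group_def)
    also have "\<dots> = foldr push_letter (rev (map letter_inv x)) (foldr push_letter x [])"
      using x by (simp add: foldr_push_id free_group_def)
    finally show ?thesis by (simp add: foldr_push_inverse)
  qed
  ultimately show "\<exists>y\<in>carrier (free_group n). y \<otimes>\<^bsub>free_group n\<^esub> x = \<one>\<^bsub>free_group n\<^esub>"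
    by (auto simp: free_group_def)
next
  fix x y assume "x \<in> carrier (free_group n)" "y \<in> carrier (free_group n)"
  then show "x \<otimes>\<^bsub>free_group n\<^esub> y \<in> carrier (free_group n)"
    using letters_foldr[of x y] by (fastforce simp: free_group_def reduced_foldr)
qed (auto simp: free_group_def foldr_push_assoc)

text \<open>The Cayley tree is given by its symmetric adjacency relation on the vertex set
  \<open>carrier (free_group n)\<close>, on which the group acts from the left by automorphisms.\<close>

definition cayley_adj :: "nat \<Rightarrow> (letter list \<times> letter list) set" where
  "cayley_adj n =
     {(g, g \<otimes>\<^bsub>free_group n\<^esub> [a]) | g a. g \<in> carrier (free_group n) \<and> fst a < n}"

text \<open>The vertices of the closed ball of radius \<open>m\<close> about the identity, for the path metric.\<close>

definition tree_ball :: "nat \<Rightarrow> nat \<Rightarrow> letter list set" where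
  "tree_ball n m = {v. \<exists>k\<le>m. (\<one>\<^bsub>free_group n\<^esub>, v) \<in> cayley_adj n ^^ k}"

text \<open>A connected subgraph of a tree contains every edge between two of its vertices, so a
  subtree is represented by its set of vertices.\<close>

definition pointed_subtrees :: "nat \<Rightarrow> letter list set set" where
  "pointed_subtrees n =
     {T. T \<subseteq> carrier (free_group n) \<and> \<one>\<^bsub>free_group n\<^esub> \<in> T \<and>
         (\<forall>u\<in>T. \<forall>v\<in>T. (u, v) \<in> (cayley_adj n \<inter> T \<times> T)\<^sup>*)}"

definition has_dead_end :: "nat \<Rightarrow> letter list set \<Rightarrow> bool" where
  "has_dead_end n T \<longleftrightarrow> (\<exists>v\<in>T. \<exists>!u. u \<in> T \<and> (v, u) \<in> cayley_adj n)"

text \<open>For distinct trees the distance is \<open>2\<^sup>-\<^sup>m\<close> for the largest \<open>m\<close> such that they agree in the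
  ball of radius \<open>m\<close>; cf. \<open>tree_dist_le_iff\<close> below.\<close>

definition tree_dist :: "nat \<Rightarrow> letter list set \<Rightarrow> letter list set \<Rightarrow> real" where
  "tree_dist n T T' =
     (if T = T' then 0 else (1/2) ^ (GREATEST m. tree_ball n m \<inter> T = tree_ball n m \<inter> T'))"

lemma tree_ball_mono: "k \<le> m \<Longrightarrow> tree_ball n k \<subseteq> tree_ball n m"
  unfolding tree_ball_def by (blast intro: order_trans)

lemma tree_ball_reach:
  assumes "T \<in> pointed_subtrees n" "v \<in> T"
  shows "\<exists>m. v \<in> tree_ball n m"
proof -
  have "(\<one>\<^bsub>free_group n\<^esub>, v) \<in> (cayley_adj n)\<^sup>*"
    using assms rtrancl_mono[of "cayley_adj n \<inter> T \<times> T" "cayley_adj n"]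
    unfolding pointed_subtrees_def by blast
  then show ?thesis
    using rtrancl_imp_relpow by (fastforce simp: tree_ball_def)
qed

lemma tree_dist_le_iff:
  assumes T: "T \<in> pointed_subtrees n" "T' \<in> pointed_subtrees n"
  shows "tree_dist n T T' \<le> (1/2) ^ m \<longleftrightarrow> tree_ball n m \<inter> T = tree_ball n m \<inter> T'"
proof (cases "T = T'")
  case False
  let ?P = "\<lambda>m. tree_ball n m \<inter> T = tree_ball n m \<inter> T'"
  have down: "?P k" if "?P l" "k \<le> l" for k l
    using that tree_ball_mono[of k l n] by blast
  have "tree_ball n 0 = {\<one>\<^bsub>free_group n\<^esub>}"
    by (auto simp: tree_ball_def)
  then have P0: "?P 0"
    using T by (auto simp: pointed_subtrees_def)
  obtain l where l: "\<not> ?P l"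
    using False tree_ball_reach[OF T(1)] tree_ball_reach[OF T(2)] by blast
  have bound: "\<forall>k. ?P k \<longrightarrow> k \<le> l"
    using l down by (metis nat_le_linear)
  have "?P (Greatest ?P)"
    using GreatestI_nat[of ?P, OF P0] bound by blast
  moreover have "k \<le> Greatest ?P" if "?P k" for k
    using Greatest_le_nat[of ?P, OF that] bound by blast
  ultimately have "?P m \<longleftrightarrow> m \<le> Greatest ?P"
    using down by blast
  also have "\<dots> \<longleftrightarrow> (1/2::real) ^ Greatest ?P \<le> (1/2) ^ m"
    by (simp add: power_decreasing_iff)
  finally show ?thesis
    using False by (simp add: tree_dist_def)
qed (simp add: tree_dist_def)

lemma Metric_space_tree_dist: "Metric_space (pointed_subtrees n) (tree_dist n)"
proof
  fix T T' T'' assume T: "T \<in> pointed_subtrees n" "T' \<in> pointed_subtrees n" "T'' \<in> pointed_subtrees n"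
  show "tree_dist n T T'' \<le> tree_dist n T T' + tree_dist n T' T''"
  proof (cases "T = T' \<or> T' = T''")
    case False
    then obtain k l where k: "tree_dist n T T' = (1/2) ^ k" and l: "tree_dist n T' T'' = (1/2) ^ l"
      by (auto simp: tree_dist_def)
    then have "tree_ball n k \<inter> T = tree_ball n k \<inter> T'" "tree_ball n l \<inter> T' = tree_ball n l \<inter> T''"
      using tree_dist_le_iff[OF T(1,2), of k] tree_dist_le_iff[OF T(2,3), of l] by simp_all
    then have "tree_ball n (min k l) \<inter> T = tree_ball n (min k l) \<inter> T''"
      using tree_ball_mono[of "min k l" k n] tree_ball_mono[of "min k l" l n] by auto
    then have "tree_dist n T T'' \<le> (1/2) ^ min k l"
      using T by (simp add: tree_dist_le_iff)
    also have "\<dots> \<le> (1/2) ^ k + (1/2) ^ l"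
      by (simp add: min_def)
    finally show ?thesis
      by (simp add: k l)
  qed (auto simp: tree_dist_def)
next
  fix T T' :: "letter list set"
  show "tree_dist n T T' = tree_dist n T' T"
    unfolding tree_dist_def eq_commute[of T T'] eq_commute[of "_ \<inter> T" "_ \<inter> T'"] by (rule refl)
qed (simp_all add: tree_dist_def)

definition subtree_topology :: "nat \<Rightarrow> letter list set topology" where
  "subtree_topology n = Metric_space.mtopology (pointed_subtrees n) (tree_dist n)"

text \<open>The one-point tree has no edges, hence no dead ends in the literal sense, but it would be an
  isolated point; it is excluded so that the resulting space is a Cantor set.\<close>

definition trees_without_dead_ends :: "nat \<Rightarrow> letter list set set" where
  "trees_without_dead_ends n =
     {T \<in> pointed_subtrees n. \<not> has_dead_end n T \<and> T \<noteq> {\<one>\<^bsub>free_group n\<^esub>}}"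

definition tree_space :: "nat \<Rightarrow> letter list set topology" where
  "tree_space n = subtopology (subtree_topology n)
     (subtree_topology n closure_of trees_without_dead_ends n)"


section \<open>Pseudogroups\<close>

text \<open>A homeomorphism between an open subset of \<open>X\<close> and an open subset of \<open>Y\<close> is represented by
  its graph. Composition and inverse are then relational composition and converse, and the
  restriction of \<open>g\<close> to \<open>U\<close> is \<open>Id_on U O g\<close>.\<close>

definition local_homeos :: "'a topology \<Rightarrow> 'b topology \<Rightarrow> ('a \<times> 'b) set set" where
  "local_homeos X Y = {(\<lambda>x. (x, f x)) ` U | U V f. openin X U \<and> openin Y V \<and>
     homeomorphic_map (subtopology X U) (subtopology Y V) f}"

definition pseudogroup :: "'a topology \<Rightarrow> ('a \<times> 'a) set set \<Rightarrow> bool" where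
  "pseudogroup X P \<longleftrightarrow>
     P \<subseteq> local_homeos X X \<and>
     (\<forall>U. openin X U \<longrightarrow> Id_on U \<in> P) \<and>
     (\<forall>g\<in>P. g\<inverse> \<in> P) \<and>
     (\<forall>g\<in>P. \<forall>h\<in>P. g O h \<in> P) \<and>
     (\<forall>S\<subseteq>P. \<Union>S \<in> local_homeos X X \<longrightarrow> \<Union>S \<in> P)"

text \<open>The pseudogroup generated by a set of local homeomorphisms \<open>S\<close> is \<open>pseudogroup X hull S\<close>.\<close>

definition minimal_pseudogroup :: "'a topology \<Rightarrow> ('a \<times> 'a) set set \<Rightarrow> bool" where
  "minimal_pseudogroup X P \<longleftrightarrow>
     (\<forall>x\<in>topspace X. X closure_of {y. \<exists>g\<in>P. (x, y) \<in> g} = topspace X)"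

text \<open>Equivalence of pseudogroups in the sense of Haefliger. The holonomy pseudogroup of a
  foliated space depends on the chosen charts and is well-defined up to this equivalence.\<close>

definition pseudogroup_equivalent ::
    "'a topology \<Rightarrow> ('a \<times> 'a) set set \<Rightarrow> 'b topology \<Rightarrow> ('b \<times> 'b) set set \<Rightarrow> bool" where
  "pseudogroup_equivalent X P Y Q \<longleftrightarrow>
     (\<exists>\<Phi>\<subseteq>local_homeos X Y.
        (\<Union>f\<in>\<Phi>. Domain f) = topspace X \<and> (\<Union>f\<in>\<Phi>. Range f) = topspace Y \<and>
        (\<forall>f\<in>\<Phi>. \<forall>h\<in>\<Phi>. (\<forall>q\<in>Q. f O q O h\<inverse> \<in> P) \<and> (\<forall>p\<in>P. f\<inverse> O p O h \<in> Q)))"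

text \<open>The element \<open>\<gamma>\<close> acts on the trees \<open>T\<close> that contain the vertex \<open>\<gamma>\<close>.\<close>

definition tree_translation ::
    "nat \<Rightarrow> letter list \<Rightarrow> (letter list set \<times> letter list set) set" where
  "tree_translation n \<gamma> =
     {(T, (\<lambda>g. inv\<^bsub>free_group n\<^esub> \<gamma> \<otimes>\<^bsub>free_group n\<^esub> g) ` T) | T.
        T \<in> topspace (tree_space n) \<and> \<gamma> \<in> T}"

definition tree_pseudogroup :: "nat \<Rightarrow> (letter list set \<times> letter list set) set set" where
  "tree_pseudogroup n =
     pseudogroup (tree_space n) hull (tree_translation n ` carrier (free_group n))"

definition fusion_pseudogroup ::
    "nat \<Rightarrow> (letter list set \<Rightarrow> 'y) \<Rightarrow> ('y \<Rightarrow> 'y) \<Rightarrow> (letter list set \<times> letter list set) set set" where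
  "fusion_pseudogroup n h \<phi> =
     pseudogroup (tree_space n) hull
       (insert {(T, inv_into (topspace (tree_space n)) h (\<phi> (h T))) | T. T \<in> topspace (tree_space n)}
          (tree_pseudogroup n))"


section \<open>Minimal Cantor actions\<close>

definition totally_disconnected_space :: "'a topology \<Rightarrow> bool" where
  "totally_disconnected_space X \<longleftrightarrow> (\<forall>C. connectedin X C \<longrightarrow> (\<exists>a. C \<subseteq> {a}))"

definition cantor_space :: "'a topology \<Rightarrow> bool" where
  "cantor_space X \<longleftrightarrow> topspace X \<noteq> {} \<and> compact_space X \<and> metrizable_space X \<and>
     totally_disconnected_space X \<and> X derived_set_of topspace X = topspace X"

text \<open>The second disjunct collects the backward orbit of \<open>y\<close>.\<close>

definition minimal_cantor_action :: "'a topology \<Rightarrow> ('a \<Rightarrow> 'a) \<Rightarrow> bool" where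
  "minimal_cantor_action Y \<phi> \<longleftrightarrow> cantor_space Y \<and> homeomorphic_map Y Y \<phi> \<and>
     (\<forall>y\<in>topspace Y.
        Y closure_of {z \<in> topspace Y. \<exists>k. (\<phi> ^^ k) y = z \<or> (\<phi> ^^ k) z = y} = topspace Y)"


section \<open>Leaves, matchbox manifolds and their holonomy\<close>

text \<open>A chart is a pair of a domain \<open>U\<close> and a map \<open>\<phi>\<close> into the product of a Euclidean space and a
  transverse space. The plaques are the sets on which the transverse coordinate is constant.\<close>

definition fine_topology :: "('a set \<times> ('a \<Rightarrow> 'e::topological_space \<times> 't)) set \<Rightarrow> 'a topology" where
  "fine_topology F = topology_generated_by
     {{z \<in> U. fst (\<phi> z) \<in> V \<and> snd (\<phi> z) = w} | U \<phi> V w. (U, \<phi>) \<in> F \<and> open V}"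

definition leaves :: "('a set \<times> ('a \<Rightarrow> 'e::topological_space \<times> 't)) set \<Rightarrow> 'a set set" where
  "leaves F = connected_components_of (fine_topology F)"

text \<open>A family of charts indexed by the points \<open>x\<close> of the space: \<open>chart x\<close> is the extended chart
  on \<open>hat_nbhd x\<close>, with transverse space \<open>transv x\<close>.\<close>

record ('a, 'e, 't) chart_family =
  hat_nbhd :: "'a \<Rightarrow> 'a set"
  transv :: "'a \<Rightarrow> 't set"
  chart :: "'a \<Rightarrow> 'a \<Rightarrow> 'e \<times> 't"

definition chart_nbhd :: "('a, 'e::euclidean_space, 't) chart_family \<Rightarrow> 'a \<Rightarrow> 'a set" where
  "chart_nbhd A x = {z \<in> hat_nbhd A x. fst (chart A x z) \<in> box (- One) One}"

definition foliation_charts ::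
    "'a topology \<Rightarrow> ('a, 'e::euclidean_space, 't) chart_family \<Rightarrow> ('a set \<times> ('a \<Rightarrow> 'e \<times> 't)) set" where
  "foliation_charts M A = {(chart_nbhd A x, chart A x) | x. x \<in> topspace M}"

text \<open>\<open>f\<close> and its leafwise derivatives up to order \<open>m\<close> are continuous on \<open>D\<close>, jointly in the
  leafwise and the transverse variable. For all \<open>m\<close> together this says that \<open>f (\<cdot>, w)\<close> is smooth
  and depends continuously on \<open>w\<close> in the topology of uniform convergence of all derivatives on
  compact sets.\<close>

primrec leafwise_C ::
    "nat \<Rightarrow> 't topology \<Rightarrow> ('e::euclidean_space \<times> 't) set \<Rightarrow> ('e \<times> 't \<Rightarrow> 'e) \<Rightarrow> bool" where
  "leafwise_C 0 X D f \<longleftrightarrow>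
     continuous_map (subtopology (prod_topology euclidean X) D) euclidean f"
| "leafwise_C (Suc m) X D f \<longleftrightarrow>
     continuous_map (subtopology (prod_topology euclidean X) D) euclidean f \<and>
     (\<exists>f'. (\<forall>(v, w)\<in>D. ((\<lambda>u. f (u, w)) has_derivative f' (v, w)) (at v)) \<and>
           (\<forall>b\<in>Basis. leafwise_C m X D (\<lambda>z. f' z b)))"

definition matchbox_manifold ::
    "'a topology \<Rightarrow> 't topology \<Rightarrow> ('a, 'e::euclidean_space, 't) chart_family \<Rightarrow> bool" where
  "matchbox_manifold M X A \<longleftrightarrow>
     compact_space M \<and> metrizable_space M \<and> connected_space M \<and>
     separable_space X \<and> metrizable_space X \<and> totally_disconnected_space X \<and>
     (\<forall>x\<in>topspace M.
        openin X (transv A x) \<and> closedin X (transv A x) \<and> compactin X (transv A x) \<and>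
        openin M (hat_nbhd A x) \<and> x \<in> hat_nbhd A x \<and>
        homeomorphic_map (subtopology M (hat_nbhd A x))
          (prod_topology (top_of_set (box (-2 *\<^sub>R One) (2 *\<^sub>R One))) (subtopology X (transv A x)))
          (chart A x) \<and>
        fst (chart A x x) = 0) \<and>
     (\<forall>x\<in>topspace M. \<forall>y\<in>topspace M. \<forall>m.
        leafwise_C m X (chart A x ` (chart_nbhd A x \<inter> chart_nbhd A y))
          (fst \<circ> chart A y \<circ> inv_into (hat_nbhd A x) (chart A x)))"

definition minimal_matchbox ::
    "'a topology \<Rightarrow> ('a, 'e::euclidean_space, 't) chart_family \<Rightarrow> bool" where
  "minimal_matchbox M A \<longleftrightarrow>
     (\<forall>L\<in>leaves (foliation_charts M A). M closure_of L = topspace M)"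

text \<open>The transversal is the disjoint union of the transverse spaces of the charts. They have to be
  kept disjoint: the sets \<open>transv A x\<close> may overlap as subsets of \<open>X\<close> without the corresponding
  plaques having anything to do with each other.\<close>

definition full_transversal ::
    "'a topology \<Rightarrow> 't topology \<Rightarrow> ('a, 'e, 't) chart_family \<Rightarrow> ('a \<times> 't) topology" where
  "full_transversal M X A = sum_topology (\<lambda>x. subtopology X (transv A x)) (topspace M)"

text \<open>A transverse change of coordinates relates the transverse coordinates, in two charts, of the
  points of an open subset \<open>Z\<close> of the overlap; \<open>Z\<close> has to be small enough for this relation to be
  a local homeomorphism.\<close>

definition transverse_changes ::
    "'a topology \<Rightarrow> 't topology \<Rightarrow> ('a, 'e::euclidean_space, 't) chart_family \<Rightarrow>
     (('a \<times> 't) \<times> ('a \<times> 't)) set set" where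
  "transverse_changes M X A =
     {g \<in> local_homeos (full_transversal M X A) (full_transversal M X A).
        \<exists>x\<in>topspace M. \<exists>y\<in>topspace M. \<exists>Z. openin M Z \<and> Z \<subseteq> chart_nbhd A x \<inter> chart_nbhd A y \<and>
          g = (\<lambda>z. ((x, snd (chart A x z)), (y, snd (chart A y z)))) ` Z}"

definition holonomy_pseudogroup ::
    "'a topology \<Rightarrow> 't topology \<Rightarrow> ('a, 'e::euclidean_space, 't) chart_family \<Rightarrow>
     (('a \<times> 't) \<times> ('a \<times> 't)) set set" where
  "holonomy_pseudogroup M X A =
     pseudogroup (full_transversal M X A) hull transverse_changes M X A"

text \<open>\<open>M\<close> with the charts \<open>A\<close> is a suspension of the pseudogroup \<open>P\<close> on \<open>Y\<close>: a 2-dimensional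
  matchbox manifold whose holonomy pseudogroup is \<open>P\<close>.\<close>

definition suspension_matchbox ::
    "'b topology \<Rightarrow> ('b \<times> 'b) set set \<Rightarrow>
     'a topology \<Rightarrow> 't topology \<Rightarrow> ('a, real^2, 't) chart_family \<Rightarrow> bool" where
  "suspension_matchbox Y P M X A \<longleftrightarrow>
     matchbox_manifold M X A \<and>
     pseudogroup_equivalent Y P (full_transversal M X A) (holonomy_pseudogroup M X A)"


section \<open>Foliations of class C1\<close>

definition C1_on :: "'a::real_normed_vector set \<Rightarrow> ('a \<Rightarrow> 'b::real_normed_vector) \<Rightarrow> bool" where
  "C1_on S f \<longleftrightarrow>
     (\<exists>f'. (\<forall>x\<in>S. (f has_derivative blinfun_apply (f' x)) (at x)) \<and> continuous_on S f')"

text \<open>A foliation of dimension \<open>DIM('e)\<close> and codimension \<open>DIM('f)\<close>, given by a foliated atlas. The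
  atlas also determines the differentiable structure of the manifold \<open>N\<close>. The last condition says
  that a change of coordinates is locally of the form \<open>(u, v) \<mapsto> (\<alpha> (u, v), \<beta> v)\<close>.\<close>

definition C1_foliation ::
    "'m topology \<Rightarrow> ('m set \<times> ('m \<Rightarrow> 'e::euclidean_space \<times> 'f::euclidean_space)) set \<Rightarrow> bool" where
  "C1_foliation N F \<longleftrightarrow>
     Hausdorff_space N \<and> second_countable N \<and> (\<Union>(U, \<phi>)\<in>F. U) = topspace N \<and>
     (\<forall>(U, \<phi>)\<in>F. openin N U \<and>
        homeomorphic_map (subtopology N U) (top_of_set (box (- One) One \<times> box (- One) One)) \<phi>) \<and>
     (\<forall>(U, \<phi>)\<in>F. \<forall>(V, \<psi>)\<in>F.
        C1_on (\<phi> ` (U \<inter> V)) (\<psi> \<circ> inv_into U \<phi>) \<and>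
        (\<forall>z\<in>U \<inter> V. \<exists>Z. openin N Z \<and> z \<in> Z \<and> Z \<subseteq> U \<inter> V \<and>
           (\<forall>z1\<in>Z. \<forall>z2\<in>Z. snd (\<phi> z1) = snd (\<phi> z2) \<longrightarrow> snd (\<psi> z1) = snd (\<psi> z2))))"

definition invariant_subset ::
    "('m set \<times> ('m \<Rightarrow> 'e::topological_space \<times> 'f)) set \<Rightarrow> 'm set \<Rightarrow> bool" where
  "invariant_subset F S \<longleftrightarrow> (\<exists>\<L>\<subseteq>leaves F. S = \<Union>\<L>)"

end

theory Submission
  imports Defs
begin

text \<open>Suppose that the matchbox manifold is embedded as an invariant subset of a foliation of class
  C1. Locally the embedding carries plaques to plaques, so sliding along plaques gives transverse
  coordinates with values in a Euclidean space in which every holonomy map, hence every tree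
  translation, is locally Lipschitz; by compactness one Lipschitz constant \<open>C\<close> serves for all
  generators. Two trees that first differ at level \<open>m\<close> are moved by some word of length about \<open>m\<close>
  to trees that differ near the base point, so their coordinates are at distance at least a
  constant times \<open>C\<close> to the power \<open>-m\<close>. A bounded set of a Euclidean space contains only
  exponentially many points that far apart, whereas there are doubly exponentially many trees to be
  separated. The adjoined homeomorphism plays no role in this; it only makes the action minimal.\<close>

section \<open>Pointed subtrees\<close>

text \<open>The double exponential arises because the free semigroup on two generators has
  \<open>2 ^ j\<close> words of length \<open>j\<close>, and a branch may be kept or cut
  independently at each of them. Two obstacles shape the rest. The embedding is merely a
  homeomorphism onto the invariant set. That plaques of \<open>F\<close> pull back into plaques is
  forced by the totally disconnected transversal, but the opposite direction needs either equal leaf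
  dimensions or that leaves go to leaves, when countability of the plaques of a leaf takes over.
  Moreover charts, holonomy and equivalence of pseudogroups are all local, so no global coordinate
  on the tree space is given. One is assembled from local choices that depend only on a ball of
  fixed radius in the tree; it is only locally injective, which suffices because all compared trees
  agree on that ball. Lipschitz bounds come from holding the leaf coordinate fixed in a change of
  charts: its transverse part is then C1, hence Lipschitz near each point.\<close>

abbreviation trees :: "nat \<Rightarrow> letter list set set" where "trees \<equiv> trees_without_dead_ends"

section \<open>Reduced words, prefixes and the Cayley graph\<close>

lemma carrier_free_group:
  "w \<in> carrier (free_group n) \<longleftrightarrow> reduced_word w \<and> fst ` set w \<subseteq> {..<n}"
  by (simp add: free_group_def)

lemma one_free_group [simp]: "\<one>\<^bsub>free_group n\<^esub> = []"
  by (simp add: free_group_def)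

lemma mult_free_group: "u \<otimes>\<^bsub>free_group n\<^esub> v = foldr push_letter u v"
  by (simp add: free_group_def)

lemma reduced_word_snoc:
  "reduced_word (w @ [a]) \<longleftrightarrow> reduced_word w \<and> (w = [] \<or> a \<noteq> letter_inv (last w))"
  by (auto simp: reduced_word_def successively_append_iff)

lemma carrier_snocD: "w @ [a] \<in> carrier (free_group n) \<Longrightarrow> w \<in> carrier (free_group n)"
  by (auto simp: carrier_free_group reduced_word_snoc)

text \<open>Products are computed by pushing letters at the front, whereas an edge of the Cayley
  graph multiplies by a letter on the right. A reduced \<open>g\<close> has no internal
  cancellation, so the new letter can meet only the last one.\<close>

lemma foldr_push_letter_singleton:
  "reduced_word g \<Longrightarrow>
   foldr push_letter g [a] = (if g \<noteq> [] \<and> a = letter_inv (last g) then butlast g else g @ [a])"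
proof (induction g)
  case (Cons b g)
  then have IH: "foldr push_letter g [a] =
      (if g \<noteq> [] \<and> a = letter_inv (last g) then butlast g else g @ [a])"
    using reduced_word_tl by blast
  show ?case
  proof (cases g)
    case (Cons c g')
    then show ?thesis
      using IH Cons.prems by (cases g') auto
  qed (auto simp: IH)
qed simp

text \<open>Right multiplication by a letter either appends it or cancels the last letter, so the
  Cayley graph is the prefix tree of reduced words. From here on edges are handled through words and
  their prefixes.\<close>

lemma cayley_adj_iff:
  "(g, h) \<in> cayley_adj n \<longleftrightarrow>
     g \<in> carrier (free_group n) \<and> h \<in> carrier (free_group n) \<and>
     ((\<exists>a. h = g @ [a]) \<or> (\<exists>a. g = h @ [a]))" (is "?L \<longleftrightarrow> ?R")
proof
  assume ?L
  then obtain a where g: "g \<in> carrier (free_group n)" and a: "fst a < n"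
    and h: "h = foldr push_letter g [a]"
    by (auto simp: cayley_adj_def mult_free_group)
  show ?R
  proof (cases "g \<noteq> [] \<and> a = letter_inv (last g)")
    case True
    then have "g = h @ [last g]"
      using g by (simp add: h foldr_push_letter_singleton carrier_free_group)
    then show ?thesis
      using g carrier_snocD by metis
  next
    case False
    moreover have "reduced_word g"
      using g by (simp add: carrier_free_group)
    ultimately have "h = g @ [a]"
      unfolding h by (subst foldr_push_letter_singleton) auto
    then show ?thesis
      using False g a by (auto simp: carrier_free_group reduced_word_snoc)
  qed
next
  assume R: ?R
  then consider a where "h = g @ [a]" | a where "g = h @ [a]" by blast
  then show ?L
  proof cases
    case 1
    then have "fst a < n" "g = [] \<or> a \<noteq> letter_inv (last g)" "reduced_word g"
      using R by (auto simp: carrier_free_group reduced_word_snoc)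
    then have "h = foldr push_letter g [a]" "fst a < n"
      unfolding 1 by (auto simp only: foldr_push_letter_singleton if_not_P de_Morgan_conj not_not)
    then show ?thesis
      using R unfolding cayley_adj_def mult_free_group by blast
  next
    case 2
    then have "h = foldr push_letter g [letter_inv a]" "fst (letter_inv a) < n"
      using R by (auto simp: foldr_push_letter_singleton foldr_push_id carrier_free_group)
    then show ?thesis
      using R unfolding cayley_adj_def mult_free_group by blast
  qed
qed

lemma cayley_adj_sym: "(g, h) \<in> cayley_adj n \<Longrightarrow> (h, g) \<in> cayley_adj n"
  by (auto simp: cayley_adj_iff)

lemma tree_ball_eq: "tree_ball n m = {v \<in> carrier (free_group n). length v \<le> m}"
proof -
  have "v \<in> carrier (free_group n) \<and> length v \<le> k" if "([], v) \<in> cayley_adj n ^^ k" for k v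
    using that
  proof (induction k arbitrary: v)
    case 0
    then show ?case by (simp add: carrier_free_group)
  next
    case (Suc k)
    then obtain u where "([], u) \<in> cayley_adj n ^^ k" "(u, v) \<in> cayley_adj n"
      by auto
    then show ?case
      using Suc.IH[of u] by (auto simp: cayley_adj_iff)
  qed
  moreover have "([], v) \<in> cayley_adj n ^^ length v" if "v \<in> carrier (free_group n)" for v
    using that
  proof (induction v rule: rev_induct)
    case (snoc a v)
    then have "(v, v @ [a]) \<in> cayley_adj n"
      using carrier_snocD by (auto simp: cayley_adj_iff)
    then show ?case
      using snoc carrier_snocD by auto
  qed simp
  ultimately show ?thesis
    unfolding tree_ball_def one_free_group by fastforce
qed

text \<open>In the prefix tree the simple path from \<open>[]\<close> to a word runs through all its
  prefixes, so connectedness together with the base point amounts to closure under deleting the last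
  letter.\<close>

lemma pointed_subtrees_iff:
  "T \<in> pointed_subtrees n \<longleftrightarrow>
     T \<subseteq> carrier (free_group n) \<and> [] \<in> T \<and> (\<forall>v a. v @ [a] \<in> T \<longrightarrow> v \<in> T)" (is "?L \<longleftrightarrow> ?R")
proof
  assume L: ?L
  have "\<forall>v w. y = v @ w \<longrightarrow> v \<in> T" if "([], y) \<in> (cayley_adj n \<inter> T \<times> T)\<^sup>*" for y
    using that
  proof (induction rule: rtrancl_induct)
    case base
    then show ?case using L by (simp add: pointed_subtrees_def)
  next
    case (step y z)
    then have z: "z \<in> T" and *: "(\<exists>a. z = y @ [a]) \<or> (\<exists>a. y = z @ [a])"
      by (auto simp: cayley_adj_iff)
    show ?case
    proof (intro allI impI)
      fix v w assume vw: "z = v @ w"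
      show "v \<in> T"
      proof (cases "w = []")
        case False
        then have w: "w = butlast w @ [last w]" by simp
        \<comment> \<open>A proper prefix of \<open>z\<close> is a prefix of \<open>y\<close>, both
          when \<open>z\<close> is a child of \<open>y\<close> and when it is the parent.\<close>
        have "\<exists>w'. y = v @ w'"
          using * vw w by (metis append.assoc butlast_append butlast_snoc False)
        then show ?thesis using step.IH by blast
      qed (use z vw in simp)
    qed
  qed
  then show ?R
    using L unfolding pointed_subtrees_def one_free_group mem_Collect_eq by metis
next
  assume R: ?R
  have *: "([], v) \<in> (cayley_adj n \<inter> T \<times> T)\<^sup>*" if "v \<in> T" for v
    using that
  proof (induction v rule: rev_induct)
    case (snoc a v)
    then have "v \<in> T" using R by metis
    moreover have "(v, v @ [a]) \<in> cayley_adj n"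
      unfolding cayley_adj_iff using R[THEN conjunct1] snoc.prems \<open>v \<in> T\<close> by blast
    ultimately have "(v, v @ [a]) \<in> cayley_adj n \<inter> T \<times> T"
      using snoc.prems by simp
    then show ?case
      using snoc.IH[OF \<open>v \<in> T\<close>] by (rule rtrancl_into_rtrancl[rotated])
  qed simp
  have "sym ((cayley_adj n \<inter> T \<times> T)\<^sup>*)"
    by (rule sym_rtrancl) (auto intro!: symI dest: cayley_adj_sym)
  then have "(u, v) \<in> (cayley_adj n \<inter> T \<times> T)\<^sup>*" if "u \<in> T" "v \<in> T" for u v
    using that * by (meson rtrancl_trans symD)
  then show ?L
    using R by (auto simp: pointed_subtrees_def)
qed

section \<open>Agreement up to a level and the topology of the tree space\<close>

text \<open>By \<open>tree_dist_le_iff\<close> this is distance at most \<open>(1/2) ^ m\<close>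
  between pointed subtrees. The metric is an ultrametric, so these are nested equivalence relations;
  after \<open>subtree_closure\<close> they replace it.\<close>

definition tree_agree :: "nat \<Rightarrow> nat \<Rightarrow> letter list set \<Rightarrow> letter list set \<Rightarrow> bool" where
  "tree_agree n m S T \<longleftrightarrow> tree_ball n m \<inter> S = tree_ball n m \<inter> T"

lemma tree_agree_refl [simp]: "tree_agree n m T T"
  by (simp add: tree_agree_def)

lemma tree_agree_sym: "tree_agree n m S T \<Longrightarrow> tree_agree n m T S"
  by (simp add: tree_agree_def)

lemma tree_agree_trans: "tree_agree n m S T \<Longrightarrow> tree_agree n m T R \<Longrightarrow> tree_agree n m S R"
  by (simp add: tree_agree_def)

lemma tree_agree_mono: "tree_agree n m S T \<Longrightarrow> k \<le> m \<Longrightarrow> tree_agree n k S T"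
  unfolding tree_agree_def using tree_ball_mono[of k m n] by blast

lemma tree_agreeD:
  assumes "tree_agree n m S T" "v \<in> S" "S \<in> pointed_subtrees n" "length v \<le> m"
  shows "v \<in> T"
  using assms by (auto simp: tree_agree_def tree_ball_eq pointed_subtrees_iff)

lemma tree_agreeI:
  assumes "S \<in> pointed_subtrees n" "T \<in> pointed_subtrees n"
    and "\<And>v. v \<in> carrier (free_group n) \<Longrightarrow> length v \<le> m \<Longrightarrow> v \<in> S \<longleftrightarrow> v \<in> T"
  shows "tree_agree n m S T"
  using assms by (auto simp: tree_agree_def tree_ball_eq)

text \<open>A dead end at \<open>v\<close> is decided by the neighbours of \<open>v\<close>, which
  are at most one letter longer. It is therefore seen in a finite ball, and absence of dead ends
  passes to limits.\<close>

lemma has_dead_end_agree: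
  assumes "S \<in> pointed_subtrees n" "T \<in> pointed_subtrees n" "tree_agree n (Suc (length v)) S T"
    and "v \<in> S" "\<exists>!u. u \<in> S \<and> (v, u) \<in> cayley_adj n"
  shows "has_dead_end n T"
proof -
  have "u \<in> S \<longleftrightarrow> u \<in> T" if "length u \<le> Suc (length v)" for u
    using that tree_agreeD[OF assms(3)] tree_agreeD[OF tree_agree_sym[OF assms(3)]] assms(1,2) by blast
  moreover have "length u \<le> Suc (length v)" if "(v, u) \<in> cayley_adj n" for u
    using that by (auto simp: cayley_adj_iff)
  ultimately have "v \<in> T" "\<exists>!u. u \<in> T \<and> (v, u) \<in> cayley_adj n"
    using assms(4,5) by (force, metis)
  then show ?thesis by (auto simp: has_dead_end_def)
qed

lemma subtree_closure:
  "subtree_topology n closure_of S =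
     {T \<in> pointed_subtrees n. \<forall>m. \<exists>T'\<in>S. T' \<in> pointed_subtrees n \<and> tree_agree n m T T'}"
proof -
  interpret Metric_space "pointed_subtrees n" "tree_dist n" by (rule Metric_space_tree_dist)
  have "(\<forall>r>0. \<exists>T'\<in>S. T' \<in> mball T r) \<longleftrightarrow>
      (\<forall>m. \<exists>T'\<in>S. T' \<in> pointed_subtrees n \<and> tree_agree n m T T')"
    if T: "T \<in> pointed_subtrees n" for T
  proof safe
    fix m assume "\<forall>r>0. \<exists>T'\<in>S. T' \<in> mball T r"
    then obtain T' where "T' \<in> S" "T' \<in> mball T ((1/2) ^ m)"
      by (meson half_gt_zero_iff zero_less_one zero_less_power)
    then show "\<exists>T'\<in>S. T' \<in> pointed_subtrees n \<and> tree_agree n m T T'"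
      using tree_dist_le_iff[OF T, of T' m] by (auto simp: tree_agree_def in_mball less_imp_le)
  next
    fix r :: real assume *: "\<forall>m. \<exists>T'\<in>S. T' \<in> pointed_subtrees n \<and> tree_agree n m T T'" and "r > 0"
    obtain m where m: "(1/2) ^ m < r"
      using \<open>r > 0\<close> real_arch_pow_inv[of r "1/2"] by auto
    obtain T' where T': "T' \<in> S" "T' \<in> pointed_subtrees n" "tree_agree n m T T'"
      using * by blast
    then have "tree_dist n T T' \<le> (1/2) ^ m"
      using tree_dist_le_iff[OF T] by (simp add: tree_agree_def)
    then show "\<exists>T'\<in>S. T' \<in> mball T r"
      using T' T m by (auto simp: in_mball)
  qed
  then show ?thesis
    unfolding subtree_topology_def metric_closure_of by blast
qed

lemma topspace_subtree_topology: "topspace (subtree_topology n) = pointed_subtrees n"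
proof -
  interpret Metric_space "pointed_subtrees n" "tree_dist n" by (rule Metric_space_tree_dist)
  show ?thesis by (simp add: subtree_topology_def)
qed

text \<open>The closure in the definition of the space adds no point: a dead end of a limit tree
  would already occur in an approximating tree, and the one-point tree is told apart from all others
  in the ball of radius 1.\<close>

lemma topspace_tree_space: "topspace (tree_space n) = trees n"
proof -
  have "T \<in> trees n"
    if "T \<in> subtree_topology n closure_of trees n" for T
  proof -
    have T: "T \<in> pointed_subtrees n"
      and ap: "\<And>m. \<exists>T'\<in>trees n. tree_agree n m T T'"
      using that by (auto simp: subtree_closure)
    have "\<not> has_dead_end n T"
    proof
      assume "has_dead_end n T"
      then obtain v where v: "v \<in> T" "\<exists>!u. u \<in> T \<and> (v, u) \<in> cayley_adj n"
        by (auto simp: has_dead_end_def)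
      obtain T' where T': "T' \<in> trees n" "tree_agree n (Suc (length v)) T T'"
        using ap by blast
      then have "has_dead_end n T'"
        using has_dead_end_agree[OF T _ _ v] by (auto simp: trees_without_dead_ends_def)
      then show False using T' by (simp add: trees_without_dead_ends_def)
    qed
    moreover have "T \<noteq> {[]}"
    proof
      assume Te: "T = {[]}"
      obtain T' where T': "T' \<in> trees n" "tree_agree n 1 T T'"
        using ap by blast
      then have T'p: "T' \<in> pointed_subtrees n" "T' \<noteq> {[]}"
        by (auto simp: trees_without_dead_ends_def)
      have "v = []" if "v \<in> T'" for v
        using that
      proof (induction v rule: rev_induct)
        case (snoc a v)
        then have "v = []" using T'p unfolding pointed_subtrees_iff by metis
        then have "[a] \<in> T"
          using tree_agreeD[OF tree_agree_sym[OF T'(2)] snoc.prems T'p(1)] snoc.prems by simp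
        then show ?case using Te by simp
      qed simp
      then show False using T'p by (auto simp: pointed_subtrees_iff)
    qed
    ultimately show ?thesis using T by (simp add: trees_without_dead_ends_def)
  qed
  moreover have "trees n \<subseteq> subtree_topology n closure_of trees n"
    by (rule closure_of_subset)
      (auto simp: topspace_subtree_topology trees_without_dead_ends_def)
  moreover have "subtree_topology n closure_of trees n \<subseteq> pointed_subtrees n"
    using closure_of_subset_topspace[of "subtree_topology n"] by (simp add: topspace_subtree_topology)
  ultimately show ?thesis
    unfolding tree_space_def by (auto simp: topspace_subtree_topology)
qed

lemma trees_pointed: "T \<in> trees n \<Longrightarrow> T \<in> pointed_subtrees n"
  by (simp add: trees_without_dead_ends_def)

lemma openin_tree_space:
  "openin (tree_space n) U \<longleftrightarrow>
     U \<subseteq> trees n \<and>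
     (\<forall>T\<in>U. \<exists>m. \<forall>T'\<in>trees n. tree_agree n m T T' \<longrightarrow> T' \<in> U)"
proof -
  have "openin (tree_space n) U \<longleftrightarrow> U \<subseteq> trees n \<and>
     closedin (tree_space n) (trees n - U)"
    by (metis openin_closedin_eq topspace_tree_space)
  also have "closedin (tree_space n) (trees n - U) \<longleftrightarrow>
      tree_space n closure_of (trees n - U) \<subseteq> trees n - U"
    by (metis Diff_subset closedin_subset closure_of_eq closure_of_subset subset_antisym
        order_refl topspace_tree_space)
  also have "tree_space n closure_of (trees n - U) =
      trees n \<inter>
      subtree_topology n closure_of (trees n - U)"
  proof -
    have "subtree_topology n closure_of trees n = trees n"
      using topspace_tree_space[of n] closure_of_subset_topspace[of "subtree_topology n"]
      unfolding tree_space_def by (metis topspace_subtopology_subset)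
    then show ?thesis
      unfolding tree_space_def closure_of_subtopology by (simp add: Int_absorb1 Diff_subset)
  qed
  finally have *: "openin (tree_space n) U \<longleftrightarrow> U \<subseteq> trees n \<and>
      trees n \<inter>
      subtree_topology n closure_of (trees n - U) \<subseteq> trees n - U" .
  have "T \<in> subtree_topology n closure_of (trees n - U) \<longleftrightarrow>
      (\<forall>m. \<exists>T'\<in>trees n - U. tree_agree n m T T')"
    if "T \<in> trees n" for T
    using that trees_pointed unfolding subtree_closure by blast
  then have "trees n \<inter>
      subtree_topology n closure_of (trees n - U) =
      {T \<in> trees n. \<forall>m. \<exists>T'\<in>trees n - U. tree_agree n m T T'}"
    by blast
  then show ?thesis
    unfolding * by (simp add: subset_iff) blast
qed

lemma openin_tree_cylinder:
  "openin (tree_space n) {T' \<in> trees n. tree_agree n m T T'}"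
  unfolding openin_tree_space by (auto intro: tree_agree_trans)


section \<open>Moving the base point along one letter\<close>

definition tree_shift :: "letter \<Rightarrow> letter list set \<Rightarrow> letter list set" where
  "tree_shift a T = push_letter (letter_inv a) ` T"

lemma push_letter_carrier:
  "fst a < n \<Longrightarrow> w \<in> carrier (free_group n) \<Longrightarrow> push_letter a w \<in> carrier (free_group n)"
  using letters_push[of a w] by (fastforce simp: carrier_free_group reduced_push)

lemma push_letter_adj:
  assumes "fst a < n" "(v, u) \<in> cayley_adj n"
  shows "(push_letter a v, push_letter a u) \<in> cayley_adj n"
proof -
  obtain b where "v \<in> carrier (free_group n)" "fst b < n" "u = foldr push_letter v [b]"
    using assms(2) by (auto simp: cayley_adj_def mult_free_group)
  moreover from this have "push_letter a u = foldr push_letter (push_letter a v) [b]"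
    by (simp add: foldr_push_letter)
  ultimately show ?thesis
    using push_letter_carrier[OF assms(1)] unfolding cayley_adj_def mult_free_group by blast
qed

text \<open>Pushing \<open>a\<close> undoes pushing its inverse, but only on reduced words:
  \<open>push_letter a\<close> also sends the unreduced word \<open>letter_inv a # a # w\<close> to
  \<open>a # w\<close>, so reducedness of \<open>v\<close> has to be part of the criterion.\<close>

lemma mem_tree_shift:
  assumes "T \<subseteq> carrier (free_group n)"
  shows "v \<in> tree_shift a T \<longleftrightarrow> reduced_word v \<and> push_letter a v \<in> T"
proof
  assume "v \<in> tree_shift a T"
  then obtain w where "w \<in> T" "v = push_letter (letter_inv a) w"
    by (auto simp: tree_shift_def)
  moreover have "reduced_word w"
    using assms \<open>w \<in> T\<close> by (auto simp: carrier_free_group)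
  ultimately show "reduced_word v \<and> push_letter a v \<in> T"
    by (simp add: push_inverse reduced_push)
next
  assume "reduced_word v \<and> push_letter a v \<in> T"
  then show "v \<in> tree_shift a T"
    unfolding tree_shift_def using push_inverse[of v "letter_inv a"] by (metis image_eqI letter_inv_simps(1))
qed

lemma tree_translation_letter:
  assumes "fst a < n"
  shows "tree_translation n [a] =
    {(T, tree_shift a T) | T. T \<in> trees n \<and> [a] \<in> T}"
proof -
  have "inv\<^bsub>free_group n\<^esub> [a] = [letter_inv a]"
    using assms by (intro group.inv_equality[OF group_free_group])
      (auto simp: mult_free_group carrier_free_group)
  then show ?thesis
    by (simp add: tree_translation_def topspace_tree_space mult_free_group tree_shift_def)
qed

lemma subtree_letter:
  assumes "T \<in> pointed_subtrees n" "a # v \<in> T"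
  shows "[a] \<in> T" "fst a < n"
proof -
  show "[a] \<in> T"
    using assms(2)
  proof (induction v rule: rev_induct)
    case (snoc b v)
    then have "(a # v) @ [b] \<in> T" by simp
    then show ?case using snoc.IH assms(1) unfolding pointed_subtrees_iff by metis
  qed
  then show "fst a < n"
    using assms(1) by (auto simp: pointed_subtrees_iff carrier_free_group)
qed

text \<open>Left translation is an automorphism of the Cayley graph, so a dead end of the shifted
  tree at \<open>v\<close> would be a dead end of \<open>T\<close> at
  \<open>push_letter a v\<close>. The vertex \<open>[a]\<close> of \<open>T\<close> becomes the new
  base point.\<close>

lemma tree_shift_closed:
  assumes T: "T \<in> trees n" and a: "[a] \<in> T"
  shows "tree_shift a T \<in> trees n"
proof -
  have Tp: "T \<in> pointed_subtrees n" using T by (rule trees_pointed)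
  then have TC: "T \<subseteq> carrier (free_group n)" and e: "[] \<in> T"
    and pref: "\<And>v b. v @ [b] \<in> T \<Longrightarrow> v \<in> T"
    by (auto simp: pointed_subtrees_iff)
  have an: "fst a < n" using subtree_letter[OF Tp a] by simp
  note mem = mem_tree_shift[OF TC]
  have SC: "tree_shift a T \<subseteq> carrier (free_group n)"
    unfolding tree_shift_def using TC push_letter_carrier[of "letter_inv a" n] an by auto
  have "v \<in> tree_shift a T" if vb: "v @ [b] \<in> tree_shift a T" for v b
  proof (cases v)
    case Nil
    then show ?thesis using a by (simp add: mem)
  next
    case (Cons c w)
    then have "push_letter a (v @ [b]) = push_letter a v @ [b]" by simp
    then have "push_letter a v @ [b] \<in> T" "reduced_word v"
      using vb by (simp_all add: mem reduced_word_snoc)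
    then show ?thesis using pref by (simp add: mem)
  qed
  moreover have "[] \<in> tree_shift a T" using a by (simp add: mem)
  ultimately have P: "tree_shift a T \<in> pointed_subtrees n"
    using SC unfolding pointed_subtrees_iff by blast
  have "\<not> has_dead_end n (tree_shift a T)"
  proof
    assume "has_dead_end n (tree_shift a T)"
    then obtain v u where v: "v \<in> tree_shift a T" and u: "u \<in> tree_shift a T" "(v, u) \<in> cayley_adj n"
      and uniq: "\<And>u'. u' \<in> tree_shift a T \<Longrightarrow> (v, u') \<in> cayley_adj n \<Longrightarrow> u' = u"
      unfolding has_dead_end_def by metis
    have "y = push_letter a u" if y: "y \<in> T" "(push_letter a v, y) \<in> cayley_adj n" for y
    proof -
      have "(push_letter (letter_inv a) (push_letter a v), push_letter (letter_inv a) y) \<in> cayley_adj n"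
        using push_letter_adj[OF _ y(2), of "letter_inv a"] an by simp
      moreover have "push_letter (letter_inv a) (push_letter a v) = v"
        using push_inverse[of v "letter_inv a"] v by (simp add: mem)
      ultimately have "push_letter (letter_inv a) y = u"
        using uniq[of "push_letter (letter_inv a) y"] y(1) by (auto simp: tree_shift_def)
      then show ?thesis
        using push_inverse[of y a] y(1) TC by (auto simp: carrier_free_group)
    qed
    moreover have "push_letter a u \<in> T" "(push_letter a v, push_letter a u) \<in> cayley_adj n"
      using u push_letter_adj[OF an] by (auto simp: mem)
    ultimately have "\<exists>!y. y \<in> T \<and> (push_letter a v, y) \<in> cayley_adj n" by blast
    moreover have "push_letter a v \<in> T" using v by (simp add: mem)
    ultimately show False
      using T by (auto simp: trees_without_dead_ends_def has_dead_end_def)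
  qed
  \<comment> \<open>The old base point is now the vertex \<open>[letter_inv a]\<close>; this keeps
    the shifted tree from being the one-point tree.\<close>
  moreover have "[letter_inv a] \<in> tree_shift a T"
    using e by (simp add: mem)
  ultimately show ?thesis
    using P by (auto simp: trees_without_dead_ends_def)
qed

lemma length_push_letter: "length (push_letter a v) \<le> Suc (length v)"
  by (cases v) auto

text \<open>One level is lost because membership of a word of length \<open>m\<close> is tested in
  the original tree on a word of length up to \<open>m + 1\<close>.\<close>

lemma tree_shift_agree:
  assumes "tree_agree n (Suc m) S T" "S \<in> trees n" "T \<in> trees n"
    and "[a] \<in> S"
  shows "tree_agree n m (tree_shift a S) (tree_shift a T)"
proof (rule tree_agreeI)
  note p = assms(2,3)[THEN trees_pointed]
  have "[a] \<in> T" using tree_agreeD[OF assms(1,4) p(1)] by simp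
  then show "tree_shift a S \<in> pointed_subtrees n" "tree_shift a T \<in> pointed_subtrees n"
    using assms tree_shift_closed trees_pointed by blast+
  have C: "S \<subseteq> carrier (free_group n)" "T \<subseteq> carrier (free_group n)"
    using p by (auto simp: pointed_subtrees_iff)
  fix v assume "v \<in> carrier (free_group n)" "length v \<le> m"
  then have "length (push_letter a v) \<le> Suc m"
    using length_push_letter[of a v] by simp
  then show "v \<in> tree_shift a S \<longleftrightarrow> v \<in> tree_shift a T"
    unfolding mem_tree_shift[OF C(1)] mem_tree_shift[OF C(2)]
    using tree_agreeD[OF assms(1) _ p(1)] tree_agreeD[OF tree_agree_sym[OF assms(1)] _ p(2)] by blast
qed

text \<open>A word on which the trees differ has length exactly \<open>m + 2\<close>. Shifting by
  its first letter shortens it by one, so the level at which the trees part drops by exactly one.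
  That letter lies in both trees since they agree at least up to level 1.\<close>

lemma tree_shift_separates:
  assumes "tree_agree n (Suc m) S T" "\<not> tree_agree n (Suc (Suc m)) S T"
    and S: "S \<in> trees n" and T: "T \<in> trees n"
  obtains a where "fst a < n" "[a] \<in> S" "[a] \<in> T"
    "tree_agree n m (tree_shift a S) (tree_shift a T)"
    "\<not> tree_agree n (Suc m) (tree_shift a S) (tree_shift a T)"
proof -
  note found = that
  \<comment> \<open>The distinguishing word may lie in either tree, so the argument is stated for
    both orders of the pair.\<close>
  have *: thesis
    if v: "v \<in> S'" "v \<notin> T'" "length v \<le> Suc (Suc m)" and ST: "{S', T'} = {S, T}"
      and ag: "tree_agree n (Suc m) S' T'" for v S' T'
  proof -
    have K: "S' \<in> trees n" "T' \<in> trees n"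
      using S T ST by auto
    note p = K[THEN trees_pointed]
    have C: "S' \<subseteq> carrier (free_group n)" "T' \<subseteq> carrier (free_group n)"
      using p by (auto simp: pointed_subtrees_iff)
    have "\<not> length v \<le> Suc m"
      using tree_agreeD[OF ag v(1) p(1)] v(2) by blast
    then obtain a w where aw: "v = a # w" "length w = Suc m"
      using v(3) by (cases v) auto
    have a: "[a] \<in> S'" "fst a < n" using subtree_letter[OF p(1)] v(1) aw by auto
    then have a': "[a] \<in> T'" using tree_agreeD[OF ag _ p(1)] by simp
    have sh: "tree_agree n m (tree_shift a S') (tree_shift a T')"
      using tree_shift_agree[OF ag K a(1)] .
    have r: "reduced_word v" using v(1) C by (auto simp: carrier_free_group)
    then have "push_letter a w = v"
      using aw by (cases w) auto
    then have "w \<in> tree_shift a S'" "w \<notin> tree_shift a T'"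
      using v r reduced_word_tl aw unfolding mem_tree_shift[OF C(1)] mem_tree_shift[OF C(2)] by auto
    then have "\<not> tree_agree n (Suc m) (tree_shift a S') (tree_shift a T')"
      using tree_agreeD[of n "Suc m" "tree_shift a S'" "tree_shift a T'" w]
        tree_shift_closed[OF K(1) a(1)] trees_pointed aw by auto
    then show thesis
      using found[of a] a a' sh ST tree_agree_sym by (auto simp: doubleton_eq_iff)
  qed
  obtain v where v: "v \<in> carrier (free_group n)" "length v \<le> Suc (Suc m)" "v \<in> S \<longleftrightarrow> v \<notin> T"
    using assms(2) tree_agreeI[OF S[THEN trees_pointed] T[THEN trees_pointed]] by blast
  show thesis
  proof (cases "v \<in> S")
    case True
    then show ?thesis using *[of v S T] v assms(1) by blast
  next
    case False
    then show ?thesis using *[of v T S] v tree_agree_sym[OF assms(1)] by blast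
  qed
qed

section \<open>A doubly exponential supply of trees\<close>

definition positive_words :: "nat \<Rightarrow> letter list set" where
  "positive_words m = {v. set v \<subseteq> {(0, True), (1, True)} \<and> length v = m}"

text \<open>The full Cayley tree with the branch through generator 0 cut off behind every word of
  \<open>V\<close>. For \<open>V\<close> among the positive words of one length, any such
  \<open>V\<close> can be read off one level further out.\<close>

definition pruned_tree :: "nat \<Rightarrow> letter list set \<Rightarrow> letter list set" where
  "pruned_tree n V = {w \<in> carrier (free_group n). \<forall>v\<in>V. \<forall>u. w \<noteq> v @ (0, True) # u}"

lemma finite_positive_words: "finite (positive_words m)"
  unfolding positive_words_def by (rule finite_lists_length_eq) simp

lemma card_positive_words: "card (positive_words m) = 2 ^ m"
  unfolding positive_words_def by (subst card_lists_length_eq) (auto simp: numeral_2_eq_2)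

lemma positive_word_carrier:
  assumes "n \<ge> 2" "set v \<subseteq> {(0, True), (1, True)}"
  shows "v \<in> carrier (free_group n)"
proof -
  have "reduced_word v"
    using assms(2)
  proof (induction v)
    case (Cons a v)
    then show ?case by (cases v) (auto simp: letter_inv_def)
  qed simp
  moreover have "fst ` set v \<subseteq> {..<n}" using assms by auto
  ultimately show ?thesis by (simp add: carrier_free_group)
qed

lemma pruned_tree_pointed: "pruned_tree n V \<in> pointed_subtrees n"
proof -
  have "v \<in> pruned_tree n V" if "v @ [a] \<in> pruned_tree n V" for v a
  proof -
    have "v \<noteq> v' @ (0, True) # u" if "v' \<in> V" for v' u
    proof
      assume "v = v' @ (0, True) # u"
      then have "v @ [a] = v' @ (0, True) # (u @ [a])" by simp
      then show False
        using \<open>v @ [a] \<in> pruned_tree n V\<close> that unfolding pruned_tree_def by blast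
    qed
    then show ?thesis
      using that carrier_snocD unfolding pruned_tree_def by blast
  qed
  then have "\<forall>v a. v @ [a] \<in> pruned_tree n V \<longrightarrow> v \<in> pruned_tree n V" by blast
  moreover have "[] \<in> pruned_tree n V" by (simp add: pruned_tree_def carrier_free_group)
  moreover have "pruned_tree n V \<subseteq> carrier (free_group n)" by (auto simp: pruned_tree_def)
  ultimately show ?thesis
    unfolding pointed_subtrees_iff by blast
qed

text \<open>After any word one can continue with the generator 1 or with its inverse, and neither
  continuation is ever removed; hence pruning creates no dead ends.\<close>

lemma pruned_tree_no_dead_end:
  assumes "n \<ge> 2" "V \<subseteq> positive_words m" "m \<ge> 1"
  shows "pruned_tree n V \<in> trees n"
proof -
  have ext: "\<exists>s. w @ [(1, s)] \<in> pruned_tree n V" if w: "w \<in> pruned_tree n V" for w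
  proof -
    define s where "s = (if w \<noteq> [] \<and> (1, True) = letter_inv (last w) then False else True)"
    have "(1, s) \<noteq> letter_inv (last w)" if "w \<noteq> []"
      using that unfolding s_def letter_inv_def by (cases "last w") auto
    moreover have "w @ [(1, s)] \<noteq> v @ (0, True) # u" if "v \<in> V" for v u
    proof
      assume *: "w @ [(1, s)] = v @ (0, True) # u"
      then have "u \<noteq> []" by auto
      then have "w = v @ (0, True) # butlast u"
        using * by (metis butlast_append butlast.simps(2) butlast_snoc list.discI)
      then show False using w that by (auto simp: pruned_tree_def)
    qed
    ultimately have "w @ [(1, s)] \<in> pruned_tree n V"
      using w assms(1) unfolding pruned_tree_def carrier_free_group
      by (auto simp: reduced_word_snoc)
    then show ?thesis ..
  qed
  have two: "\<exists>u u'. u \<noteq> u' \<and> u \<in> pruned_tree n V \<and> u' \<in> pruned_tree n V \<and>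
      (w, u) \<in> cayley_adj n \<and> (w, u') \<in> cayley_adj n" if w: "w \<in> pruned_tree n V" for w
  proof (cases w rule: rev_cases)
    case Nil
    \<comment> \<open>As \<open>m \<ge> 1\<close>, the empty word is not in \<open>V\<close>, so the
      root keeps its child through generator 0.\<close>
    have "[(i, True)] \<in> pruned_tree n V" if "i < n" for i
      using that assms(2,3) by (auto simp: pruned_tree_def carrier_free_group positive_words_def
        append_eq_Cons_conv Cons_eq_append_conv)
    then have "[(0, True)] \<in> pruned_tree n V" "[(1, True)] \<in> pruned_tree n V" using assms(1) by auto
    then show ?thesis
      using Nil w by (intro exI[of _ "[(0, True)]"] exI[of _ "[(1, True)]"])
        (auto simp: cayley_adj_iff pruned_tree_def)
  next
    case (snoc w' b)
    obtain s where s: "w @ [(1, s)] \<in> pruned_tree n V" using ext[OF w] ..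
    have w': "w' \<in> pruned_tree n V"
      using w pruned_tree_pointed[of n V] unfolding snoc pointed_subtrees_iff by metis
    have "w' \<noteq> w @ [(1, s)]" using snoc by simp
    moreover have "(w, w') \<in> cayley_adj n" "(w, w @ [(1, s)]) \<in> cayley_adj n"
      using w w' s snoc unfolding cayley_adj_iff pruned_tree_def by blast+
    ultimately show ?thesis using w' s by blast
  qed
  have "\<not> has_dead_end n (pruned_tree n V)"
    unfolding has_dead_end_def using two by metis
  moreover have "pruned_tree n V \<noteq> {[]}"
    using ext[of "[]"] by auto
  ultimately show ?thesis
    using pruned_tree_pointed by (auto simp: trees_without_dead_ends_def)
qed

text \<open>Every word that is cut off passes beyond a word of length \<open>m\<close>, so nothing
  disappears from the ball of radius \<open>m\<close>.\<close>

lemma pruned_tree_agree: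
  assumes "V \<subseteq> positive_words m" "W \<subseteq> positive_words m"
  shows "tree_agree n m (pruned_tree n V) (pruned_tree n W)"
proof -
  have "v \<in> pruned_tree n U" if "v \<in> carrier (free_group n)" "length v \<le> m" "U \<subseteq> positive_words m"
    for v U
    using that by (auto simp: pruned_tree_def positive_words_def)
  then show ?thesis
    using assms pruned_tree_pointed by (intro tree_agreeI) blast+
qed

text \<open>The vertex \<open>v @ [(0, True)]\<close> is missing precisely when \<open>v\<close>
  belongs to the pruning set: all words of the set have the same length, so a cut at another word
  cannot remove it.\<close>

lemma pruned_tree_separated:
  assumes "n \<ge> 2" "V \<subseteq> positive_words m" "W \<subseteq> positive_words m" "V \<noteq> W"
  shows "\<not> tree_agree n (Suc m) (pruned_tree n V) (pruned_tree n W)"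
proof
  assume ag: "tree_agree n (Suc m) (pruned_tree n V) (pruned_tree n W)"
  have "v @ [(0, True)] \<in> pruned_tree n U \<longleftrightarrow> v \<notin> U"
    if "v \<in> positive_words m" "U \<subseteq> positive_words m" for v U
  proof -
    have "v @ [(0, True)] \<in> carrier (free_group n)"
      using that(1) by (intro positive_word_carrier[OF assms(1)]) (auto simp: positive_words_def)
    moreover have "v' = v" if "v @ [(0, True)] = v' @ (0, True) # u" "v' \<in> U" for v' u
    proof -
      have "length v' = length v"
        using that \<open>v \<in> positive_words m\<close> \<open>U \<subseteq> positive_words m\<close>
        by (auto simp: positive_words_def)
      then show ?thesis using that(1) by simp
    qed
    ultimately show ?thesis by (auto simp: pruned_tree_def)
  qed
  moreover have "v @ [(0, True)] \<in> pruned_tree n V \<longleftrightarrow> v @ [(0, True)] \<in> pruned_tree n W"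
    if "v \<in> positive_words m" for v
  proof -
    have "length (v @ [(0, True)]) \<le> Suc m" using that by (simp add: positive_words_def)
    then show ?thesis
      using tree_agreeD[OF ag] tree_agreeD[OF tree_agree_sym[OF ag]] pruned_tree_pointed by blast
  qed
  moreover obtain v where "v \<in> positive_words m" "v \<in> V \<longleftrightarrow> v \<notin> W"
    using assms by blast
  ultimately show False using assms(2,3) by metis
qed


section \<open>Expansion against Lipschitz coordinates\<close>

text \<open>Pigeonhole on a cubical grid: two points in one cell would be closer than
  \<open>\<delta>\<close>, so the points number at most as many as the cells that meet the ball of
  radius \<open>R\<close>.\<close>

lemma card_separated_le:
  fixes S :: "'f::euclidean_space set"
  assumes "\<delta> > 0" "R \<ge> 0" and R: "\<And>x. x \<in> S \<Longrightarrow> norm x \<le> R"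
    and sep: "\<And>x y. x \<in> S \<Longrightarrow> y \<in> S \<Longrightarrow> x \<noteq> y \<Longrightarrow> \<delta> \<le> norm (x - y)"
  shows "real (card S) \<le> (2 * R * DIM('f) / \<delta> + 2) ^ DIM('f)"
proof -
  \<comment> \<open>With this mesh, points of one cell are at l1-distance less than
    \<open>DIM('f) * e = \<delta>\<close>, and the l1-norm bounds the norm.\<close>
  define e where "e = \<delta> / DIM('f)"
  have e: "e > 0" using assms(1) by (simp add: e_def)
  define g where "g = (\<lambda>x::'f. \<lambda>b\<in>Basis. \<lfloor>(x \<bullet> b) / e\<rfloor>)"
  have "inj_on g S"
  proof (rule inj_onI, rule ccontr)
    fix x y assume xy: "x \<in> S" "y \<in> S" "g x = g y" "x \<noteq> y"
    have "\<bar>(x - y) \<bullet> b\<bar> < e" if "b \<in> Basis" for b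
    proof -
      have "\<lfloor>(x \<bullet> b) / e\<rfloor> = \<lfloor>(y \<bullet> b) / e\<rfloor>"
        using fun_cong[OF xy(3), of b] that by (simp add: g_def)
      then have "\<bar>(x \<bullet> b) / e - (y \<bullet> b) / e\<bar> < 1" by linarith
      then show ?thesis
        using e by (simp add: diff_divide_distrib[symmetric] inner_diff_left abs_divide)
    qed
    then have "(\<Sum>b\<in>Basis. \<bar>(x - y) \<bullet> b\<bar>) < (\<Sum>b\<in>(Basis::'f set). e)"
      by (intro sum_strict_mono) auto
    then have "norm (x - y) < \<delta>"
      using norm_le_l1[of "x - y"] by (simp add: e_def)
    then show False using sep[OF xy(1,2,4)] by simp
  qed
  moreover have "g ` S \<subseteq> Basis \<rightarrow>\<^sub>E {\<lfloor>- R / e\<rfloor>..\<lfloor>R / e\<rfloor>}"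
  proof
    fix y assume "y \<in> g ` S"
    then obtain x where x: "x \<in> S" "y = g x" by blast
    have "- R \<le> x \<bullet> b \<and> x \<bullet> b \<le> R" if "b \<in> Basis" for b
      using Basis_le_norm[OF that, of x] R[OF x(1)] by linarith
    then have "- R / e \<le> (x \<bullet> b) / e \<and> (x \<bullet> b) / e \<le> R / e" if "b \<in> Basis" for b
      using that e divide_right_mono[of "- R" "x \<bullet> b" e] divide_right_mono[of "x \<bullet> b" R e] by auto
    then show "y \<in> Basis \<rightarrow>\<^sub>E {\<lfloor>- R / e\<rfloor>..\<lfloor>R / e\<rfloor>}"
      by (auto simp: x(2) g_def intro!: floor_mono)
  qed
  ultimately have "card S \<le> card ((Basis::'f set) \<rightarrow>\<^sub>E {\<lfloor>- R / e\<rfloor>..\<lfloor>R / e\<rfloor>})"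
    by (metis card_image card_mono finite_Basis finite_PiE finite_atLeastAtMost_int)
  also have "\<dots> = card {\<lfloor>- R / e\<rfloor>..\<lfloor>R / e\<rfloor>} ^ DIM('f)"
    by (simp add: card_PiE)
  finally have "real (card S) \<le> real (card {\<lfloor>- R / e\<rfloor>..\<lfloor>R / e\<rfloor>}) ^ DIM('f)"
    by (metis of_nat_le_iff of_nat_power)
  also have "\<dots> \<le> (2 * R / e + 2) ^ DIM('f)"
  proof (intro power_mono)
    have "0 \<le> R / e" using \<open>R \<ge> 0\<close> e by simp
    then have "real (card {\<lfloor>- R / e\<rfloor>..\<lfloor>R / e\<rfloor>}) \<le> real_of_int (\<lfloor>R / e\<rfloor> - \<lfloor>- (R / e)\<rfloor> + 1)"
      by (simp del: of_int_diff of_int_add) linarith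
    also have "\<dots> \<le> 2 * R / e + 2" by simp linarith
    finally show "real (card {\<lfloor>- R / e\<rfloor>..\<lfloor>R / e\<rfloor>}) \<le> 2 * R / e + 2" .
  qed simp
  also have "2 * R / e = 2 * R * DIM('f) / \<delta>"
    by (simp add: e_def)
  finally show ?thesis .
qed

text \<open>The left side is bounded by 2 to a power that is linear in \<open>j\<close>; the
  exponent on the right is itself exponential in \<open>j\<close>.\<close>

lemma double_exponential_dominates:
  fixes a c :: real
  assumes "a \<ge> 0" "c \<ge> 0"
  shows "\<exists>j::nat. (a * c ^ j + 2) ^ d < 2 ^ (2 ^ j)"
proof -
  obtain B where B: "a + 2 \<le> real B" "c \<le> real B" "1 \<le> B"
  proof -
    obtain B where "max (a + 2) (max c 1) \<le> real B" using real_arch_simple by blast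
    then show ?thesis using that[of B] by simp
  qed
  define N where "N = B * d"
  \<comment> \<open>With \<open>B\<close> bounding \<open>a + 2\<close> and \<open>c\<close>, the
    left side is at most \<open>2 ^ (N * (j + 1))\<close>. For \<open>j = 4 * N\<close> this
    exponent \<open>4 * N^2 + N\<close> is below \<open>(2 * N + 1)^2\<close>, which is at most
    \<open>2 ^ (4 * N) = 2 ^ j\<close>.\<close>
  define j where "j = 4 * N"
  have pow: "real B \<le> 2 ^ B"
    by (metis less_imp_le less_exp of_nat_le_iff of_nat_numeral of_nat_power)
  have "a * c ^ j \<le> a * real B ^ j"
    using assms B by (intro mult_left_mono power_mono) auto
  moreover have "2 \<le> 2 * real B ^ j" using B by simp
  ultimately have "a * c ^ j + 2 \<le> (a + 2) * real B ^ j"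
    by (simp add: algebra_simps)
  also have "\<dots> \<le> real B * real B ^ j"
    using B by (intro mult_right_mono) auto
  also have "\<dots> = real B ^ Suc j" by simp
  also have "\<dots> \<le> (2 ^ B) ^ Suc j"
    using pow by (intro power_mono) auto
  finally have "(a * c ^ j + 2) ^ d \<le> ((2 ^ B) ^ Suc j) ^ d"
    using assms by (intro power_mono) auto
  also have "\<dots> = 2 ^ (N * Suc j)"
    by (simp add: power_mult[symmetric] power_add[symmetric] N_def algebra_simps)
  also have "\<dots> < (2::real) ^ (2 ^ j)"
  proof (intro power_strict_increasing)
    have "N * Suc j < (2 * N + 1) ^ 2"
      by (simp add: j_def power2_eq_square algebra_simps)
    also have "\<dots> \<le> (2 ^ (2 * N)) ^ 2"
      using less_exp[of "2 * N"] by (intro power_mono) (simp_all only: Suc_eq_plus1[symmetric] Suc_le_eq)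
    also have "\<dots> = 2 ^ j" by (simp add: j_def power_mult[symmetric])
    finally show "N * Suc j < 2 ^ j" .
  qed simp
  finally show ?thesis ..
qed

section \<open>Uniformity by compactness and the counting argument\<close>

text \<open>A Lebesgue number argument with cylinders in place of balls. The property is asserted at
  the centre \<open>T0\<close> of a cylinder containing \<open>T\<close>, not at \<open>T\<close>,
  because \<open>Q\<close> is arbitrary and need not pass between neighbouring trees.\<close>

lemma tree_space_uniform_level:
  assumes "compact_space (tree_space n)"
    and "\<And>T. T \<in> trees n \<Longrightarrow> \<exists>k. Q T k"
  obtains m where "\<And>T. T \<in> trees n \<Longrightarrow>
    \<exists>T0\<in>trees n. \<exists>k\<le>m. Q T0 k \<and> tree_agree n k T0 T"
proof -
  let ?K = "trees n"
  obtain l where l: "\<And>T. T \<in> ?K \<Longrightarrow> Q T (l T)"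
    using assms(2) by metis
  define C where "C = (\<lambda>T. {T' \<in> ?K. tree_agree n (l T) T T'})"
  have "\<exists>\<F>. finite \<F> \<and> \<F> \<subseteq> C ` ?K \<and> ?K \<subseteq> \<Union>\<F>"
  proof -
    have "\<forall>U\<in>C ` ?K. openin (tree_space n) U"
      by (auto simp: C_def openin_tree_cylinder)
    moreover have "?K \<subseteq> \<Union>(C ` ?K)"
      by (auto simp: C_def)
    ultimately show ?thesis
      using assms(1) unfolding compact_space_alt topspace_tree_space by blast
  qed
  then obtain F where F: "finite F" "F \<subseteq> ?K" "?K \<subseteq> \<Union>(C ` F)"
    by (metis finite_subset_image)
  have "\<exists>T0\<in>?K. \<exists>k\<le>(\<Sum>T\<in>F. l T). Q T0 k \<and> tree_agree n k T0 T" if "T \<in> ?K" for T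
  proof -
    obtain T0 where "T0 \<in> F" "T \<in> C T0" using F(3) \<open>T \<in> ?K\<close> by auto
    moreover from this have "l T0 \<le> (\<Sum>T\<in>F. l T)"
      using F(1) by (intro member_le_sum) auto
    ultimately show ?thesis
      using F(2) l by (intro bexI[of _ T0] exI[of _ "l T0"]) (auto simp: C_def)
  qed
  then show thesis by (rule that)
qed

text \<open>The contradiction, freed from foliations: \<open>\<kappa>\<close> stands for a
  transverse coordinate. Injectivity and the Lipschitz bound are assumed only near each tree, since
  that is all that local charts can deliver.\<close>

lemma no_lipschitz_coordinate:
  fixes \<kappa> :: "letter list set \<Rightarrow> 'f::euclidean_space"
  assumes n: "n \<ge> 2" and compact: "compact_space (tree_space n)"
    and cont: "continuous_map (tree_space n) euclidean \<kappa>"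
    and inj: "\<And>T0. T0 \<in> trees n \<Longrightarrow> \<exists>m. \<forall>S\<in>trees n.
      \<forall>T\<in>trees n. tree_agree n m T0 S \<longrightarrow> tree_agree n m T0 T \<longrightarrow> \<kappa> S = \<kappa> T \<longrightarrow> S = T"
    and lip: "\<And>T0 a. T0 \<in> trees n \<Longrightarrow> [a] \<in> T0 \<Longrightarrow>
      \<exists>m C. \<forall>S\<in>trees n. \<forall>T\<in>trees n.
        tree_agree n m T0 S \<longrightarrow> tree_agree n m T0 T \<longrightarrow>
        norm (\<kappa> (tree_shift a S) - \<kappa> (tree_shift a T)) \<le> C * norm (\<kappa> S - \<kappa> T)"
  shows False
proof -
  let ?K = "trees n"
  define I where "I T0 m \<longleftrightarrow> (\<forall>S\<in>?K. \<forall>T\<in>?K. tree_agree n m T0 S \<longrightarrow> tree_agree n m T0 T \<longrightarrow>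
    \<kappa> S = \<kappa> T \<longrightarrow> S = T)" for T0 m
  \<comment> \<open>The level \<open>m\<close> doubles as the Lipschitz constant. The condition then
    holds for all large \<open>m\<close>, and a single number has to be made uniform.\<close>
  define L where "L a T0 m \<longleftrightarrow> ([a] \<in> T0 \<longrightarrow> (\<forall>S\<in>?K. \<forall>T\<in>?K. tree_agree n m T0 S \<longrightarrow> tree_agree n m T0 T \<longrightarrow>
    norm (\<kappa> (tree_shift a S) - \<kappa> (tree_shift a T)) \<le> real m * norm (\<kappa> S - \<kappa> T)))" for a T0 m
  \<comment> \<open>The bound \<open>1 \<le> k\<close> ensures that a tree in the cylinder of
    \<open>T0\<close> contains \<open>[a]\<close> only if \<open>T0\<close> does, which activates
    \<open>L\<close>.\<close>
  have "\<exists>k. 1 \<le> k \<and> I T0 k \<and> (\<forall>a\<in>{..<n} \<times> UNIV. L a T0 k)" if T0: "T0 \<in> ?K" for T0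
  proof -
    have "\<forall>\<^sub>F k in sequentially. L a T0 k" for a
    proof (cases "[a] \<in> T0")
      case True
      then obtain m C where mC: "\<forall>S\<in>?K. \<forall>T\<in>?K. tree_agree n m T0 S \<longrightarrow> tree_agree n m T0 T \<longrightarrow>
          norm (\<kappa> (tree_shift a S) - \<kappa> (tree_shift a T)) \<le> C * norm (\<kappa> S - \<kappa> T)"
        using lip[OF T0] by blast
      have "L a T0 k" if k: "max m (nat \<lceil>C\<rceil>) \<le> k" for k
        unfolding L_def
      proof (intro impI ballI)
        fix S T assume "S \<in> ?K" "T \<in> ?K" "tree_agree n k T0 S" "tree_agree n k T0 T"
        then have "norm (\<kappa> (tree_shift a S) - \<kappa> (tree_shift a T)) \<le> C * norm (\<kappa> S - \<kappa> T)"
          using mC k tree_agree_mono by (meson max.boundedE)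
        also have "\<dots> \<le> real k * norm (\<kappa> S - \<kappa> T)"
          using k by (intro mult_right_mono norm_ge_zero) linarith
        finally show "norm (\<kappa> (tree_shift a S) - \<kappa> (tree_shift a T)) \<le> real k * norm (\<kappa> S - \<kappa> T)" .
      qed
      then show ?thesis unfolding eventually_sequentially by blast
    qed (simp add: L_def)
    then have "\<forall>\<^sub>F k in sequentially. \<forall>a\<in>{..<n} \<times> (UNIV::bool set). L a T0 k"
      by (intro eventually_ball_finite) auto
    moreover have "\<forall>\<^sub>F k in sequentially. I T0 k"
      using inj[OF T0] tree_agree_mono unfolding I_def eventually_sequentially by meson
    moreover have "\<forall>\<^sub>F k in sequentially. 1 \<le> k" by (rule eventually_ge_at_top)
    ultimately have "\<forall>\<^sub>F k in sequentially. 1 \<le> k \<and> I T0 k \<and> (\<forall>a\<in>{..<n} \<times> UNIV. L a T0 k)"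
      by eventually_elim blast
    then show ?thesis unfolding eventually_sequentially by blast
  qed
  then obtain m where m: "\<And>T. T \<in> ?K \<Longrightarrow> \<exists>T0\<in>?K. \<exists>k\<le>m.
      (1 \<le> k \<and> I T0 k \<and> (\<forall>a\<in>{..<n} \<times> UNIV. L a T0 k)) \<and> tree_agree n k T0 T"
    using tree_space_uniform_level[OF compact,
        of "\<lambda>T0 k. 1 \<le> k \<and> I T0 k \<and> (\<forall>a\<in>{..<n} \<times> UNIV. L a T0 k)"] by metis
  have inj': "S = T" if "S \<in> ?K" "T \<in> ?K" "tree_agree n m S T" "\<kappa> S = \<kappa> T" for S T
  proof -
    obtain T0 k where "k \<le> m" "I T0 k" "tree_agree n k T0 S" using m[OF \<open>S \<in> ?K\<close>] by blast
    moreover from this have "tree_agree n k T0 T"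
      using that tree_agree_mono tree_agree_trans by blast
    ultimately show ?thesis using that unfolding I_def by blast
  qed
  have lip': "norm (\<kappa> (tree_shift a S) - \<kappa> (tree_shift a T)) \<le> real m * norm (\<kappa> S - \<kappa> T)"
    if "S \<in> ?K" "T \<in> ?K" "tree_agree n m S T" "[a] \<in> S" for S T a
  proof -
    obtain T0 k where k: "k \<le> m" "1 \<le> k" "T0 \<in> ?K" "\<forall>a\<in>{..<n} \<times> UNIV. L a T0 k" "tree_agree n k T0 S"
      using m[OF \<open>S \<in> ?K\<close>] by blast
    moreover from this have "tree_agree n k T0 T"
      using that tree_agree_mono tree_agree_trans by blast
    moreover have "fst a < n"
      using subtree_letter[of S n a "[]"] that trees_pointed by blast
    then have "a \<in> {..<n} \<times> UNIV" by (cases a) auto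
    then have "L a T0 k" using k by blast
    moreover have "[a] \<in> T0"
      using tree_agreeD[OF tree_agree_sym[OF k(5)] that(4)] that k(2) trees_pointed by simp
    ultimately have "norm (\<kappa> (tree_shift a S) - \<kappa> (tree_shift a T)) \<le> real k * norm (\<kappa> S - \<kappa> T)"
      using that unfolding L_def by blast
    also have "\<dots> \<le> real m * norm (\<kappa> S - \<kappa> T)"
      using k by (intro mult_right_mono) auto
    finally show ?thesis .
  qed
  \<comment> \<open>Start of the induction on levels: a lower bound for pairs that part just after
    level \<open>m\<close>. Written as a reciprocal, the bound again shares one index with the size
    of the neighbourhood.\<close>
  define E where "E T0 k \<longleftrightarrow> (\<forall>S\<in>?K. tree_agree n k T0 S \<longrightarrow> (\<forall>T\<in>?K. tree_agree n m S T \<longrightarrow>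
    \<not> tree_agree n (Suc m) S T \<longrightarrow> 1 / real (Suc k) \<le> norm (\<kappa> S - \<kappa> T)))" for T0 k
  have "\<exists>k. E T0 k" if T0: "T0 \<in> ?K" for T0
  proof -
    \<comment> \<open>The trees that part from \<open>T0\<close> just after level \<open>m\<close>
      form a compact set, and by \<open>inj'\<close> its image misses \<open>\<kappa> T0\<close>.
      This leaves a gap; every \<open>S\<close> near \<open>T0\<close> has its partners in the same
      set, and half of the gap survives.\<close>
    define D where "D = {T \<in> ?K. tree_agree n m T0 T \<and> \<not> tree_agree n (Suc m) T0 T}"
    have "openin (tree_space n) (?K - D)"
      unfolding openin_tree_space
    proof (intro conjI ballI exI impI)
      fix T T' assume "T \<in> ?K - D" "T' \<in> ?K" "tree_agree n (Suc m) T T'"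
      moreover from this have "tree_agree n m T T'" using tree_agree_mono by simp
      ultimately show "T' \<in> ?K - D"
        unfolding D_def using tree_agree_trans tree_agree_sym by blast
    qed blast
    then have "closedin (tree_space n) D"
      unfolding closedin_def topspace_tree_space by (auto simp: D_def)
    then have "compactin euclidean (\<kappa> ` D)"
      using closedin_compact_space[OF compact] image_compactin[OF _ cont] by blast
    then have "closed (\<kappa> ` D)" by (simp add: compact_imp_closed)
    moreover have "\<kappa> T0 \<notin> \<kappa> ` D"
    proof
      assume "\<kappa> T0 \<in> \<kappa> ` D"
      then obtain T where "T \<in> D" "\<kappa> T0 = \<kappa> T" by blast
      then show False using inj'[OF T0, of T] by (auto simp: D_def)
    qed
    ultimately obtain d where d: "d > 0" "\<And>y. y \<in> \<kappa> ` D \<Longrightarrow> d \<le> dist (\<kappa> T0) y"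
      using separate_point_closed by metis
    have "openin (tree_space n) {S \<in> topspace (tree_space n). \<kappa> S \<in> ball (\<kappa> T0) (d / 2)}"
      using cont by (rule openin_continuous_map_preimage) simp
    then obtain k0 where k0: "\<And>S. S \<in> ?K \<Longrightarrow> tree_agree n k0 T0 S \<Longrightarrow> dist (\<kappa> T0) (\<kappa> S) < d / 2"
      using T0 d(1) unfolding openin_tree_space topspace_tree_space by fastforce
    obtain k1 where k1: "1 / real (Suc k1) < d / 2"
      using d(1) reals_Archimedean[of "d / 2"] by (auto simp: inverse_eq_divide)
    have "E T0 (max (Suc m) (max k0 k1))" (is "E T0 ?k")
      unfolding E_def
    proof (intro ballI impI)
      fix S T assume *: "S \<in> ?K" "tree_agree n ?k T0 S" "T \<in> ?K" "tree_agree n m S T"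
        "\<not> tree_agree n (Suc m) S T"
      have "tree_agree n (Suc m) T0 S" "tree_agree n m T0 S" "tree_agree n k0 T0 S"
        using *(2) by (auto elim: tree_agree_mono)
      then have "T \<in> D" "dist (\<kappa> T0) (\<kappa> S) < d / 2"
        using * tree_agree_trans tree_agree_sym k0 unfolding D_def by blast+
      then have "d / 2 \<le> dist (\<kappa> S) (\<kappa> T)"
        using d(2)[of "\<kappa> T"] dist_triangle[of "\<kappa> T0" "\<kappa> T" "\<kappa> S"] by fastforce
      moreover have "1 / real (Suc ?k) \<le> 1 / real (Suc k1)"
        by (intro divide_left_mono) auto
      ultimately show "1 / real (Suc ?k) \<le> norm (\<kappa> S - \<kappa> T)"
        using k1 by (simp add: dist_norm)
    qed
    then show ?thesis ..
  qed
  then obtain m' where m': "\<And>T. T \<in> ?K \<Longrightarrow> \<exists>T0\<in>?K. \<exists>k\<le>m'. E T0 k \<and> tree_agree n k T0 T"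
    using tree_space_uniform_level[OF compact, of E] by metis
  define e where "e = 1 / real (Suc m')"
  have "e > 0" by (simp add: e_def)
  have base: "e \<le> norm (\<kappa> S - \<kappa> T)"
    if "S \<in> ?K" "T \<in> ?K" "tree_agree n m S T" "\<not> tree_agree n (Suc m) S T" for S T
  proof -
    obtain T0 k where k: "k \<le> m'" "E T0 k" "tree_agree n k T0 S" using m'[OF \<open>S \<in> ?K\<close>] by blast
    then have "1 / real (Suc k) \<le> norm (\<kappa> S - \<kappa> T)" using that unfolding E_def by blast
    moreover have "e \<le> 1 / real (Suc k)"
      unfolding e_def using k(1) by (intro divide_left_mono) auto
    ultimately show ?thesis by simp
  qed
  \<comment> \<open>Each step of the induction spends one shift: the level of separation drops by
    one, and distances grow by a factor of at most \<open>m\<close>.\<close>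
  have sep: "e \<le> real m ^ j * norm (\<kappa> S - \<kappa> T)"
    if "S \<in> ?K" "T \<in> ?K" "tree_agree n (m + j) S T" "\<not> tree_agree n (Suc (m + j)) S T" for j S T
    using that
  proof (induction j arbitrary: S T)
    case (Suc j)
    obtain a where a: "fst a < n" "[a] \<in> S" "[a] \<in> T"
      "tree_agree n (m + j) (tree_shift a S) (tree_shift a T)"
      "\<not> tree_agree n (Suc (m + j)) (tree_shift a S) (tree_shift a T)"
      using tree_shift_separates[of n "m + j" S T] Suc.prems by auto
    have "e \<le> real m ^ j * norm (\<kappa> (tree_shift a S) - \<kappa> (tree_shift a T))"
      using Suc.IH a tree_shift_closed Suc.prems by blast
    also have "\<dots> \<le> real m ^ j * (real m * norm (\<kappa> S - \<kappa> T))"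
      using lip'[of S T a] a Suc.prems tree_agree_mono[of n "m + Suc j" S T m]
      by (intro mult_left_mono) auto
    finally show ?case by (simp add: mult_ac)
  qed (use base in simp)
  have "compactin euclidean (\<kappa> ` ?K)"
    using image_compactin[OF _ cont] compact unfolding compact_space_def topspace_tree_space by blast
  then have "bounded (\<kappa> ` ?K)" by (simp add: compact_imp_bounded)
  then obtain R where R: "R > 0" "\<And>T. T \<in> ?K \<Longrightarrow> norm (\<kappa> T) \<le> R"
    unfolding bounded_pos by auto
  have "?K \<noteq> {}" using pruned_tree_no_dead_end[OF n, of "{}" 1] by auto
  then have m1: "m \<ge> 1" using m by force
  obtain j where j: "(2 * R * DIM('f) / e * real m ^ j + 2) ^ DIM('f) < 2 ^ (2 ^ j)"
    using double_exponential_dominates[of "2 * R * DIM('f) / e" "real m" "DIM('f)"] R(1) \<open>e > 0\<close> by auto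
  \<comment> \<open>Pruning at words of length \<open>m + j\<close> makes any two of the trees part
    just after level \<open>m + j\<close>, as \<open>sep\<close> demands. There are
    \<open>2 ^ (2 ^ (m + j))\<close> subsets, while \<open>j\<close> enters the packing bound only
    through \<open>real m ^ j\<close>.\<close>
  define W where "W = Pow (positive_words (m + j))"
  have W: "V \<in> W \<Longrightarrow> pruned_tree n V \<in> ?K" for V
    using pruned_tree_no_dead_end[OF n] m1 unfolding W_def by auto
  have \<delta>: "e / real m ^ j > 0" using \<open>e > 0\<close> m1 by simp
  have Wsep: "e / real m ^ j \<le> norm (\<kappa> (pruned_tree n V) - \<kappa> (pruned_tree n V'))"
    if "V \<in> W" "V' \<in> W" "V \<noteq> V'" for V V'
    using sep[OF W W pruned_tree_agree pruned_tree_separated[OF n]] that m1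
    unfolding W_def by (simp add: pos_divide_le_eq mult.commute)
  have "inj_on (\<lambda>V. \<kappa> (pruned_tree n V)) W"
    using Wsep \<delta> by (intro inj_onI) (metis diff_self norm_zero not_less)
  then have "card ((\<lambda>V. \<kappa> (pruned_tree n V)) ` W) = 2 ^ (2 ^ (m + j))"
    by (simp add: card_image W_def card_Pow finite_positive_words card_positive_words)
  moreover have "real (card ((\<lambda>V. \<kappa> (pruned_tree n V)) ` W)) \<le>
      (2 * R * DIM('f) / (e / real m ^ j) + 2) ^ DIM('f)"
    using \<delta> R W Wsep by (intro card_separated_le) auto
  moreover have "2 * R * DIM('f) / (e / real m ^ j) = 2 * R * DIM('f) / e * real m ^ j" by simp
  ultimately have "2 ^ (2 ^ (m + j)) \<le> (2 * R * DIM('f) / e * real m ^ j + 2) ^ DIM('f)"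
    by simp
  moreover have "(2::real) ^ (2 ^ j) \<le> 2 ^ (2 ^ (m + j))"
    by (intro power_increasing) auto
  ultimately show False using j by linarith
qed


section \<open>Local homeomorphisms and pseudogroups\<close>

lemma local_homeosI:
  assumes "openin X U" "openin Y V" "homeomorphic_map (subtopology X U) (subtopology Y V) f"
    and "g = (\<lambda>x. (x, f x)) ` U"
  shows "g \<in> local_homeos X Y"
  using assms unfolding local_homeos_def by blast

lemma local_homeosE:
  assumes "g \<in> local_homeos X Y"
  obtains U V f where "openin X U" "openin Y V" "homeomorphic_map (subtopology X U) (subtopology Y V) f"
    "g = (\<lambda>x. (x, f x)) ` U" "f ` U = V" "inj_on f U"
proof -
  obtain U V f where *: "openin X U" "openin Y V" "homeomorphic_map (subtopology X U) (subtopology Y V) f"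
    "g = (\<lambda>x. (x, f x)) ` U"
    using assms unfolding local_homeos_def by blast
  moreover have "topspace (subtopology X U) = U" "topspace (subtopology Y V) = V"
    using *(1,2) by (auto dest: openin_subset)
  ultimately show thesis
    using that homeomorphic_imp_surjective_map[OF *(3)] homeomorphic_imp_injective_map[OF *(3)] by metis
qed

lemma local_homeos_functional:
  "g \<in> local_homeos X Y \<Longrightarrow> (x, y) \<in> g \<Longrightarrow> (x, z) \<in> g \<Longrightarrow> y = z"
  by (auto elim!: local_homeosE)

lemma local_homeos_injective:
  "g \<in> local_homeos X Y \<Longrightarrow> (x, z) \<in> g \<Longrightarrow> (y, z) \<in> g \<Longrightarrow> x = y"
  by (auto elim!: local_homeosE dest: inj_onD)

lemma local_homeos_topspace:
  "g \<in> local_homeos X Y \<Longrightarrow> (x, y) \<in> g \<Longrightarrow> x \<in> topspace X \<and> y \<in> topspace Y"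
  by (auto elim!: local_homeosE dest!: openin_subset)

lemma local_homeos_preimage:
  assumes "g \<in> local_homeos X Y" "openin Y W"
  shows "openin X {x. \<exists>y\<in>W. (x, y) \<in> g}"
proof -
  obtain U V f where *: "openin X U" "openin Y V" "homeomorphic_map (subtopology X U) (subtopology Y V) f"
    "g = (\<lambda>x. (x, f x)) ` U" "f ` U = V" "inj_on f U"
    using assms(1) by (rule local_homeosE)
  have "continuous_map (subtopology X U) Y f"
    using homeomorphic_imp_continuous_map[OF *(3)] continuous_map_in_subtopology by blast
  then have "openin (subtopology X U) {x \<in> topspace (subtopology X U). f x \<in> W}"
    using assms(2) openin_continuous_map_preimage by blast
  moreover have "{x \<in> topspace (subtopology X U). f x \<in> W} = {x. \<exists>y\<in>W. (x, y) \<in> g}"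
    using openin_subset[OF *(1)] by (auto simp: *(4))
  ultimately show ?thesis using *(1) openin_trans_full by metis
qed

lemma local_homeos_Domain:
  assumes "g \<in> local_homeos X Y"
  shows "openin X (Domain g)"
proof -
  have "Domain g = {x. \<exists>y\<in>topspace Y. (x, y) \<in> g}"
    using local_homeos_topspace[OF assms] by auto
  then show ?thesis using local_homeos_preimage[OF assms openin_topspace] by simp
qed

lemma local_homeos_converse:
  assumes "g \<in> local_homeos X Y"
  shows "g\<inverse> \<in> local_homeos Y X"
proof -
  obtain U V f where *: "openin X U" "openin Y V" "homeomorphic_map (subtopology X U) (subtopology Y V) f"
    "g = (\<lambda>x. (x, f x)) ` U" "f ` U = V" "inj_on f U"
    using assms by (rule local_homeosE)
  obtain k where k: "homeomorphic_maps (subtopology X U) (subtopology Y V) f k"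
    using *(3) unfolding homeomorphic_map_maps ..
  then have "homeomorphic_map (subtopology Y V) (subtopology X U) k"
    using homeomorphic_maps_sym unfolding homeomorphic_map_maps by blast
  moreover have kf: "k (f x) = x" if "x \<in> U" for x
    using k that openin_subset[OF *(1)] unfolding homeomorphic_maps_def by auto
  moreover have "g\<inverse> = (\<lambda>y. (y, k y)) ` V"
    using *(5) kf by (auto simp: *(4) image_iff) 
  ultimately show ?thesis using local_homeosI[OF *(2,1)] by blast
qed

lemma local_homeos_comp:
  assumes "g \<in> local_homeos X Y" "h \<in> local_homeos Y Z"
  shows "g O h \<in> local_homeos X Z"
proof -
  obtain U V f where *: "openin X U" "openin Y V" "homeomorphic_map (subtopology X U) (subtopology Y V) f"
    "g = (\<lambda>x. (x, f x)) ` U" "f ` U = V" "inj_on f U"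
    using assms(1) by (rule local_homeosE)
  obtain U' V' f' where **: "openin Y U'" "openin Z V'"
    "homeomorphic_map (subtopology Y U') (subtopology Z V') f'"
    "h = (\<lambda>x. (x, f' x)) ` U'" "f' ` U' = V'" "inj_on f' U'"
    using assms(2) by (rule local_homeosE)
  define A where "A = {x \<in> U. f x \<in> U'}"
  define C where "C = f' ` (V \<inter> U')"
  have "A = {x. \<exists>y\<in>U'. (x, y) \<in> g}" by (auto simp: A_def *(4))
  then have oA: "openin X A" using local_homeos_preimage[OF assms(1) **(1)] by simp
  have "C = {z. \<exists>y\<in>V. (z, y) \<in> h\<inverse>}" by (auto simp: C_def **(4))
  then have oC: "openin Z C"
    using local_homeos_preimage[OF local_homeos_converse[OF assms(2)] *(2)] by simp
  have fA: "f ` A = V \<inter> U'" using *(5) by (auto simp: A_def)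
  have "homeomorphic_map (subtopology (subtopology X U) A) (subtopology (subtopology Y V) (V \<inter> U')) f"
    using *(3) by (rule homeomorphic_map_subtopologies)
      (use *(5) openin_subset[OF *(1)] openin_subset[OF *(2)] in \<open>auto simp: A_def\<close>)
  then have h1: "homeomorphic_map (subtopology X A) (subtopology Y (V \<inter> U')) f"
    by (simp add: subtopology_subtopology A_def Collect_conj_eq Int_absorb1 Int_assoc[symmetric])
  have "homeomorphic_map (subtopology (subtopology Y U') (V \<inter> U')) (subtopology (subtopology Z V') C) f'"
    using **(3) by (rule homeomorphic_map_subtopologies)
      (use **(5,6) openin_subset[OF **(1)] openin_subset[OF **(2)] in \<open>auto simp: C_def dest: inj_onD\<close>)
  moreover have "U' \<inter> (V \<inter> U') = V \<inter> U'" "V' \<inter> C = C" using **(5) by (auto simp: C_def)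
  ultimately have h2: "homeomorphic_map (subtopology Y (V \<inter> U')) (subtopology Z C) f'"
    by (simp add: subtopology_subtopology)
  have "g O h = (\<lambda>x. (x, (f' \<circ> f) x)) ` A"
    unfolding *(4) **(4) A_def relcomp_unfold by auto
  then show ?thesis
    using local_homeosI[OF oA oC homeomorphic_map_compose[OF h1 h2]] by simp
qed

lemma local_homeos_Id_on:
  assumes "openin X U"
  shows "Id_on U \<in> local_homeos X X"
proof -
  have "homeomorphic_map (subtopology X U) (subtopology X U) id" by (rule homeomorphic_map_id[THEN iffD2]) simp
  moreover have "Id_on U = (\<lambda>x. (x, id x)) ` U" by auto
  ultimately show ?thesis using local_homeosI[OF assms assms] by blast
qed

lemma pseudogroup_hull_comp:
  assumes "g \<in> pseudogroup X hull S" "h \<in> pseudogroup X hull S"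
  shows "g O h \<in> pseudogroup X hull S"
  using assms unfolding hull_def pseudogroup_def by blast

lemma pseudogroup_hull_converse:
  assumes "g \<in> pseudogroup X hull S"
  shows "g\<inverse> \<in> pseudogroup X hull S"
  using assms unfolding hull_def pseudogroup_def by blast

lemma pseudogroup_hull_Id_on:
  assumes "openin X U"
  shows "Id_on U \<in> pseudogroup X hull S"
  using assms unfolding hull_def pseudogroup_def by blast

text \<open>Combined with minimality of the hull: an equivalence relation respected by generators is
  respected by the whole pseudogroup they generate.\<close>

lemma pseudogroup_within_equivalence:
  assumes "equiv (topspace X) R"
  shows "pseudogroup X {g \<in> local_homeos X X. g \<subseteq> R}"
  unfolding pseudogroup_def
proof (intro conjI ballI allI impI)
  have r: "(x, x) \<in> R" if "x \<in> topspace X" for x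
    using assms that by (auto simp: equiv_def refl_on_def)
  fix U assume "openin X U"
  then show "Id_on U \<in> {g \<in> local_homeos X X. g \<subseteq> R}"
    using r local_homeos_Id_on openin_subset by fastforce
next
  fix g assume "g \<in> {g \<in> local_homeos X X. g \<subseteq> R}"
  then show "g\<inverse> \<in> {g \<in> local_homeos X X. g \<subseteq> R}"
    using assms local_homeos_converse by (auto simp: equiv_def sym_def)
next
  fix g h assume "g \<in> {g \<in> local_homeos X X. g \<subseteq> R}" "h \<in> {g \<in> local_homeos X X. g \<subseteq> R}"
  then show "g O h \<in> {g \<in> local_homeos X X. g \<subseteq> R}"
    using local_homeos_comp[of g X X h X] relcomp_mono[of g R h R] trans_O_subset[of R] equivE[OF assms]
    by auto
qed auto

lemma pseudogroup_equivalentE: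
  assumes "pseudogroup_equivalent X P Y Q"
  obtains \<Phi> where "\<Phi> \<subseteq> local_homeos X Y"
    "\<And>x. x \<in> topspace X \<Longrightarrow> \<exists>f\<in>\<Phi>. \<exists>y. (x, y) \<in> f" "\<And>y. y \<in> topspace Y \<Longrightarrow> \<exists>f\<in>\<Phi>. \<exists>x. (x, y) \<in> f"
    "\<And>f h p. f \<in> \<Phi> \<Longrightarrow> h \<in> \<Phi> \<Longrightarrow> p \<in> P \<Longrightarrow> f\<inverse> O p O h \<in> Q"
proof -
  obtain \<Phi> where *: "\<Phi> \<subseteq> local_homeos X Y \<and> (\<Union>f\<in>\<Phi>. Domain f) = topspace X \<and>
      (\<Union>f\<in>\<Phi>. Range f) = topspace Y \<and>
      (\<forall>f\<in>\<Phi>. \<forall>h\<in>\<Phi>. (\<forall>q\<in>Q. f O q O h\<inverse> \<in> P) \<and> (\<forall>p\<in>P. f\<inverse> O p O h \<in> Q))"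
    using assms unfolding pseudogroup_equivalent_def ..
  show thesis
  proof (rule that[of \<Phi>])
    show "\<exists>f\<in>\<Phi>. \<exists>y. (x, y) \<in> f" if "x \<in> topspace X" for x
    proof -
      have "x \<in> (\<Union>f\<in>\<Phi>. Domain f)" using * that by simp
      then show ?thesis by auto
    qed
    show "\<exists>f\<in>\<Phi>. \<exists>x. (x, y) \<in> f" if "y \<in> topspace Y" for y
    proof -
      have "y \<in> (\<Union>f\<in>\<Phi>. Range f)" using * that by simp
      then show ?thesis by auto
    qed
  qed (use * in auto)
qed

lemma closure_of_meets:
  "x \<in> X closure_of S \<Longrightarrow> openin X U \<Longrightarrow> x \<in> U \<Longrightarrow> \<exists>y. y \<in> S \<and> y \<in> U"
  by (simp add: in_closure_of)

text \<open>The point \<open>y\<close> is pulled back along some \<open>f\<close> and the open set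
  along some \<open>h\<close>. Density in \<open>X\<close> gives \<open>p\<close> joining the two,
  and its conjugate \<open>f\<inverse> O p O h\<close> lies in \<open>Q\<close>.\<close>

lemma minimal_pseudogroup_equivalent:
  assumes "pseudogroup_equivalent X P Y Q" "minimal_pseudogroup X P"
    and "y \<in> topspace Y" "openin Y V" "V \<noteq> {}"
  obtains g z where "g \<in> Q" "z \<in> V" "(y, z) \<in> g"
proof -
  obtain \<Phi> where \<Phi>: "\<Phi> \<subseteq> local_homeos X Y"
    and range: "\<And>v. v \<in> topspace Y \<Longrightarrow> \<exists>f\<in>\<Phi>. \<exists>x. (x, v) \<in> f"
    and PQ: "\<And>f h p. f \<in> \<Phi> \<Longrightarrow> h \<in> \<Phi> \<Longrightarrow> p \<in> P \<Longrightarrow> f\<inverse> O p O h \<in> Q"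
    by (rule pseudogroup_equivalentE[OF assms(1)]) blast
  obtain f x where f: "f \<in> \<Phi>" "(x, y) \<in> f" using range assms(3) by blast
  obtain v where "v \<in> V" "v \<in> topspace Y" using assms(5) openin_subset[OF assms(4)] by blast
  then obtain h w where h: "h \<in> \<Phi>" "(w, v) \<in> h" using range by blast
  have "openin X {x. \<exists>y\<in>V. (x, y) \<in> h}"
    using local_homeos_preimage[OF _ assms(4)] h(1) \<Phi> by blast
  moreover have "w \<in> X closure_of {z. \<exists>g\<in>P. (x, z) \<in> g}"
  proof -
    have "f \<in> local_homeos X Y" "h \<in> local_homeos X Y" using f h \<Phi> by auto
    then have "x \<in> topspace X" "w \<in> topspace X"
      using local_homeos_topspace f(2) h(2) by metis+
    then show ?thesis using assms(2) unfolding minimal_pseudogroup_def by simp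
  qed
  ultimately obtain w' p v' where "p \<in> P" "(x, w') \<in> p" "v' \<in> V" "(w', v') \<in> h"
  proof -
    assume *: "openin X {x. \<exists>y\<in>V. (x, y) \<in> h}" "w \<in> X closure_of {z. \<exists>g\<in>P. (x, z) \<in> g}"
      "\<And>p w' v'. p \<in> P \<Longrightarrow> (x, w') \<in> p \<Longrightarrow> v' \<in> V \<Longrightarrow> (w', v') \<in> h \<Longrightarrow> thesis"
    have "w \<in> {x. \<exists>y\<in>V. (x, y) \<in> h}" using h(2) \<open>v \<in> V\<close> by auto
    then have "\<exists>w'. w' \<in> {z. \<exists>g\<in>P. (x, z) \<in> g} \<and> w' \<in> {x. \<exists>y\<in>V. (x, y) \<in> h}"
      by (rule closure_of_meets[OF *(2,1)])
    then show thesis using *(3) by (elim exE conjE CollectE bexE)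
  qed
  then have "(y, v') \<in> f\<inverse> O p O h" using f(2) by auto
  then show thesis
    using that PQ[OF f(1) h(1) \<open>p \<in> P\<close>] \<open>v' \<in> V\<close> by blast
qed


section \<open>Foliated atlases and their leaves\<close>

text \<open>The common part of matchbox manifolds and foliations that the leaf arguments use. The
  transverse type carries no topology, and plaques are given only as continuous images of connected
  open Euclidean sets; openness is what later yields countability.\<close>

locale foliated_atlas =
  fixes N :: "'m topology" and F :: "('m set \<times> ('m \<Rightarrow> 'e::euclidean_space \<times> 't)) set"
  assumes chart_open: "(U, \<phi>) \<in> F \<Longrightarrow> openin N U"
    and chart_cover: "z \<in> topspace N \<Longrightarrow> \<exists>U \<phi>. (U, \<phi>) \<in> F \<and> z \<in> U"
    and chart_fst: "(U, \<phi>) \<in> F \<Longrightarrow> continuous_map (subtopology N U) euclidean (\<lambda>z. fst (\<phi> z))"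
    and plaque_param: "(U, \<phi>) \<in> F \<Longrightarrow> z \<in> U \<Longrightarrow>
      \<exists>B \<gamma>. open (B::'e set) \<and> connected B \<and> continuous_map (top_of_set B) N \<gamma> \<and>
        \<gamma> ` B = {z' \<in> U. snd (\<phi> z') = snd (\<phi> z)}"
    and compat: "(U, \<phi>) \<in> F \<Longrightarrow> (V, \<psi>) \<in> F \<Longrightarrow> z \<in> U \<Longrightarrow> z \<in> V \<Longrightarrow>
      \<exists>Z. openin N Z \<and> z \<in> Z \<and> Z \<subseteq> U \<inter> V \<and>
        (\<forall>z1\<in>Z. \<forall>z2\<in>Z. snd (\<phi> z1) = snd (\<phi> z2) \<longrightarrow> snd (\<psi> z1) = snd (\<psi> z2))"
begin

lemma fine_open:
  "(U, \<phi>) \<in> F \<Longrightarrow> open V \<Longrightarrow> openin (fine_topology F) {z \<in> U. fst (\<phi> z) \<in> V \<and> snd (\<phi> z) = w}"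
  unfolding fine_topology_def by (rule topology_generated_by_Basis) blast

lemma fine_open_plaque:
  assumes "(U, \<phi>) \<in> F"
  shows "openin (fine_topology F) {z \<in> U. snd (\<phi> z) = w}"
  using fine_open[OF assms open_UNIV] by simp

lemma topspace_fine: "topspace (fine_topology F) = topspace N"
proof
  show "topspace (fine_topology F) \<subseteq> topspace N"
    unfolding fine_topology_def topology_generated_by_topspace
    using chart_open openin_subset by fast
  show "topspace N \<subseteq> topspace (fine_topology F)"
  proof
    fix z assume "z \<in> topspace N"
    then obtain U \<phi> where "(U, \<phi>) \<in> F" "z \<in> U" using chart_cover by blast
    then show "z \<in> topspace (fine_topology F)"
      using openin_subset[OF fine_open_plaque[of U \<phi> "snd (\<phi> z)"]] by blast
  qed
qed

text \<open>By \<open>compat\<close> the transverse coordinate of a second chart is locally constant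
  along a plaque of the first, so prescribing its value is an open condition there. This is what
  makes plaque parametrisations continuous into the fine topology.\<close>

lemma plaque_preimage_open:
  assumes "(U, \<phi>) \<in> F" "(V, \<psi>) \<in> F" "continuous_map X N \<gamma>"
    and "\<And>u. u \<in> topspace X \<Longrightarrow> \<gamma> u \<in> U \<and> snd (\<phi> (\<gamma> u)) = w" "open W"
  shows "openin X {u \<in> topspace X. \<gamma> u \<in> V \<and> fst (\<psi> (\<gamma> u)) \<in> W \<and> snd (\<psi> (\<gamma> u)) = w'}"
    (is "openin X ?S")
proof (subst openin_subopen, intro ballI)
  fix u assume u: "u \<in> ?S"
  then have "\<gamma> u \<in> U" "\<gamma> u \<in> V" using assms(4) by auto
  then obtain Z where Z: "openin N Z" "\<gamma> u \<in> Z" "Z \<subseteq> U \<inter> V"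
    "\<And>z1 z2. z1 \<in> Z \<Longrightarrow> z2 \<in> Z \<Longrightarrow> snd (\<phi> z1) = snd (\<phi> z2) \<Longrightarrow> snd (\<psi> z1) = snd (\<psi> z2)"
    using compat[OF assms(1,2)] by metis
  have "openin (subtopology N V) {z \<in> topspace (subtopology N V). fst (\<psi> z) \<in> W}"
    using chart_fst[OF assms(2)] by (rule openin_continuous_map_preimage) (use assms(5) in simp)
  then have "openin N {z \<in> topspace (subtopology N V). fst (\<psi> z) \<in> W}"
    using chart_open[OF assms(2)] openin_trans_full by blast
  moreover have "{z \<in> topspace (subtopology N V). fst (\<psi> z) \<in> W} = {z \<in> V. fst (\<psi> z) \<in> W}"
    using openin_subset[OF chart_open[OF assms(2)]] by auto
  ultimately have "openin N (Z \<inter> {z \<in> V. fst (\<psi> z) \<in> W})"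
    using Z(1) by auto
  then have "openin X {u \<in> topspace X. \<gamma> u \<in> Z \<inter> {z \<in> V. fst (\<psi> z) \<in> W}}" (is "openin X ?T")
    using assms(3) openin_continuous_map_preimage by blast
  moreover have "u \<in> ?T" using u Z(2) by auto
  moreover have "?T \<subseteq> ?S"
  proof
    fix u' assume u': "u' \<in> ?T"
    then have "snd (\<psi> (\<gamma> u')) = snd (\<psi> (\<gamma> u))"
      using Z(2) u assms(4)[of u] assms(4)[of u'] by (intro Z(4)) auto
    then show "u' \<in> ?S" using u' u by auto
  qed
  ultimately show "\<exists>T. openin X T \<and> u \<in> T \<and> T \<subseteq> ?S" by blast
qed

lemma plaque_fine_continuous:
  assumes "(U, \<phi>) \<in> F" "continuous_map X N \<gamma>"
    and "\<And>u. u \<in> topspace X \<Longrightarrow> \<gamma> u \<in> U \<and> snd (\<phi> (\<gamma> u)) = w"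
  shows "continuous_map X (fine_topology F) \<gamma>"
  unfolding fine_topology_def
proof (rule continuous_on_generated_topo)
  fix G assume "G \<in> {{z \<in> V. fst (\<psi> z) \<in> W \<and> snd (\<psi> z) = w'} | V \<psi> W w'. (V, \<psi>) \<in> F \<and> open W}"
  then obtain V \<psi> W w' where G: "G = {z \<in> V. fst (\<psi> z) \<in> W \<and> snd (\<psi> z) = w'}" "(V, \<psi>) \<in> F" "open W"
    by blast
  have "\<gamma> -` G \<inter> topspace X = {u \<in> topspace X. \<gamma> u \<in> V \<and> fst (\<psi> (\<gamma> u)) \<in> W \<and> snd (\<psi> (\<gamma> u)) = w'}"
    by (auto simp: G(1))
  then show "openin X (\<gamma> -` G \<inter> topspace X)"
    using plaque_preimage_open[OF assms(1) G(2) assms(2,3) G(3)] by simp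
next
  have "\<gamma> u \<in> topspace (fine_topology F)" if "u \<in> topspace X" for u
    using assms(3)[OF that] topspace_fine chart_open[OF assms(1)] openin_subset by blast
  then show "\<gamma> ` topspace X \<subseteq> \<Union>{{z \<in> V. fst (\<psi> z) \<in> W \<and> snd (\<psi> z) = w'} | V \<psi> W w'. (V, \<psi>) \<in> F \<and> open W}"
    unfolding fine_topology_def topology_generated_by_topspace by blast
qed

lemma plaque_connected:
  assumes "(U, \<phi>) \<in> F"
  shows "connectedin (fine_topology F) {z \<in> U. snd (\<phi> z) = w}"
proof (cases "{z \<in> U. snd (\<phi> z) = w} = {}")
  case False
  then obtain z where "z \<in> U" "snd (\<phi> z) = w" by blast
  then obtain B \<gamma> where "open (B::'e set)" "connected B" and c: "continuous_map (top_of_set B) N \<gamma>"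
    and im: "\<gamma> ` B = {z' \<in> U. snd (\<phi> z') = w}"
    using plaque_param[OF assms] by metis
  then have "continuous_map (top_of_set B) (fine_topology F) \<gamma>"
    by (intro plaque_fine_continuous[OF assms, of _ _ w]) auto
  then have "connectedin (fine_topology F) (\<gamma> ` B)"
    using connectedin_continuous_map_image \<open>connected B\<close>
    by (metis connectedin_topspace connected_space_subtopology connectedin_iff_connected topspace_euclidean_subtopology)
  then show ?thesis by (simp add: im)
next
  case True
  then show ?thesis by (simp only: connectedin_empty)
qed

lemma leaf_plaque:
  assumes "L \<in> leaves F" "(U, \<phi>) \<in> F" "z \<in> L" "z \<in> U" "z' \<in> U" "snd (\<phi> z') = snd (\<phi> z)"
  shows "z' \<in> L"
proof -
  have "{y \<in> U. snd (\<phi> y) = snd (\<phi> z)} \<subseteq> L"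
    using assms(1,3,4) plaque_connected[OF assms(2)] unfolding leaves_def
    by (intro connected_components_of_maximal) (auto simp: disjnt_iff)
  then show ?thesis using assms(5,6) by blast
qed

lemma invariant_subset_plaque:
  assumes "invariant_subset F S" "(U, \<phi>) \<in> F" "z \<in> S" "z \<in> U" "z' \<in> U" "snd (\<phi> z') = snd (\<phi> z)"
  shows "z' \<in> S"
  using assms leaf_plaque unfolding invariant_subset_def by blast

text \<open>The plaques of \<open>\<psi>\<close> cut the parameter domain of one plaque of
  \<open>\<phi>\<close> into disjoint open sets, and a Euclidean space holds only countably many
  nonempty ones.\<close>

lemma countable_plaques_meeting_plaque:
  assumes "(U, \<phi>) \<in> F" "(V, \<psi>) \<in> F"
  shows "countable {snd (\<psi> z) | z. z \<in> U \<and> z \<in> V \<and> snd (\<phi> z) = v}" (is "countable ?W")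
proof (cases "\<exists>z. z \<in> U \<and> snd (\<phi> z) = v")
  case True
  then obtain B \<gamma> where "open (B::'e set)" "connected B" and c: "continuous_map (top_of_set B) N \<gamma>"
    and im: "\<gamma> ` B = {z' \<in> U. snd (\<phi> z') = v}"
    using plaque_param[OF assms(1)] by metis
  define Lv where "Lv = (\<lambda>w. {u \<in> B. \<gamma> u \<in> V \<and> snd (\<psi> (\<gamma> u)) = w})"
  have "openin (top_of_set B) (Lv w)" for w
    using plaque_preimage_open[OF assms c, of v UNIV w] im by (auto simp: Lv_def)
  then have op: "open (Lv w)" for w
    using \<open>open B\<close> openin_open_trans by blast
  have ne: "Lv w \<noteq> {}" if "w \<in> ?W" for w
  proof -
    obtain z where z: "z \<in> U" "z \<in> V" "snd (\<phi> z) = v" "w = snd (\<psi> z)" using \<open>w \<in> ?W\<close> by blast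
    then have "z \<in> \<gamma> ` B" by (simp add: im)
    then show ?thesis using z by (auto simp: Lv_def)
  qed
  have "countable (Lv ` ?W)"
    by (rule countable_disjoint_open_subsets) (use op in \<open>auto simp: pairwise_def disjnt_iff Lv_def\<close>)
  moreover have "inj_on Lv ?W"
  proof (rule inj_onI)
    fix w w' assume "w \<in> ?W" "w' \<in> ?W" "Lv w = Lv w'"
    then obtain u where "u \<in> Lv w" "u \<in> Lv w'" using ne[OF \<open>w \<in> ?W\<close>] by blast
    then show "w = w'" unfolding Lv_def by blast
  qed
  ultimately show ?thesis using countable_image_inj_on by blast
next
  case False
  then have "?W = {}" by blast
  then show ?thesis by (simp only: countable_empty)
qed

text \<open>Countably many charts cover \<open>N\<close>, and chains of overlapping plaques from a
  given one reach only countably many plaques. Their union is clopen in the fine topology, so it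
  contains the connected leaf.\<close>

lemma countable_plaques_in_leaf:
  assumes "second_countable N" "L \<in> leaves F" "(U, \<phi>) \<in> F"
  shows "countable ((\<lambda>z. snd (\<phi> z)) ` (L \<inter> U))"
proof (cases "L \<inter> U = {}")
  case False
  then obtain z0 where z0: "z0 \<in> L" "z0 \<in> U" by blast
  have "Lindelof_space N" using assms(1) by (rule second_countable_imp_Lindelof_space)
  moreover have "\<forall>V\<in>fst ` F. openin N V" using chart_open by auto
  moreover have "\<Union>(fst ` F) = topspace N"
  proof
    show "\<Union>(fst ` F) \<subseteq> topspace N"
      using openin_subset[OF chart_open] by (fastforce dest: subsetD)
    show "topspace N \<subseteq> \<Union>(fst ` F)"
    proof
      fix z assume "z \<in> topspace N"
      then obtain U \<phi> where "(U, \<phi>) \<in> F" "z \<in> U" using chart_cover by blast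
      then show "z \<in> \<Union>(fst ` F)" by force
    qed
  qed
  ultimately obtain \<V> where V: "countable \<V>" "\<V> \<subseteq> fst ` F" "\<Union>\<V> = topspace N"
    unfolding Lindelof_space_def by metis
  then obtain F0 where F0: "countable F0" "F0 \<subseteq> F" "\<V> = fst ` F0"
    using countable_subset_image by metis
  \<comment> \<open>A countable subcover need not contain the chart in which plaques are to be
    counted.\<close>
  define F1 where "F1 = insert (U, \<phi>) F0"
  have F1: "countable F1" "F1 \<subseteq> F" "(U, \<phi>) \<in> F1" using F0 assms(3) by (auto simp: F1_def)
  have cover: "\<exists>j\<in>F1. z \<in> fst j" if "z \<in> topspace N" for z
    using that V(3) F0(3) by (auto simp: F1_def)
  define P :: "('m set \<times> ('m \<Rightarrow> 'e \<times> 't)) \<times> 't \<Rightarrow> 'm set" where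
    "P = (\<lambda>(i, v). {z \<in> fst i. snd (snd i z) = v})"
  define rel where "rel = {(p, q). fst p \<in> F1 \<and> fst q \<in> F1 \<and> P p \<inter> P q \<noteq> {}}"
  \<comment> \<open>A plaque is labelled by its chart and its transverse value; these are the labels
    reachable from the plaque of \<open>z0\<close> through overlaps.\<close>
  define R where "R = rel\<^sup>* `` {((U, \<phi>), snd (\<phi> z0))}"
  have cimg: "countable (rel `` {p})" for p
  proof (cases "fst p \<in> F1")
    case True
    have "rel `` {p} \<subseteq> (\<Union>j\<in>F1. Pair j ` {snd (snd j z) | z. z \<in> fst (fst p) \<and> z \<in> fst j \<and> snd (snd (fst p) z) = snd p})"
    proof
      fix q assume "q \<in> rel `` {p}"
      then obtain z where "fst q \<in> F1" "z \<in> P p" "z \<in> P q" by (auto simp: rel_def)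
      then show "q \<in> (\<Union>j\<in>F1. Pair j ` {snd (snd j z) | z. z \<in> fst (fst p) \<and> z \<in> fst j \<and> snd (snd (fst p) z) = snd p})"
        by (intro UN_I[of "fst q"] image_eqI[of _ _ "snd q"] CollectI exI[of _ z])
          (auto simp: P_def case_prod_unfold)
    qed
    moreover have "countable (\<Union>j\<in>F1. Pair j ` {snd (snd j z) | z. z \<in> fst (fst p) \<and> z \<in> fst j \<and> snd (snd (fst p) z) = snd p})"
    proof (intro countable_UN[OF F1(1)] countable_image)
      fix j assume "j \<in> F1"
      then show "countable {snd (snd j z) | z. z \<in> fst (fst p) \<and> z \<in> fst j \<and> snd (snd (fst p) z) = snd p}"
        using True F1(2) by (intro countable_plaques_meeting_plaque) auto
    qed
    ultimately show ?thesis by (rule countable_subset)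
  next
    case False
    then have "rel `` {p} = {}" by (auto simp: rel_def)
    then show ?thesis by simp
  qed
  have cR: "countable R"
    unfolding R_def
  proof (rule countable_rtrancl)
    show "countable (rel `` Y)" if "countable Y" for Y
      using cimg that by (rule countable_Image)
  qed simp
  have R0: "((U, \<phi>), snd (\<phi> z0)) \<in> R" by (auto simp: R_def)
  have Rstep: "q \<in> R" if "p \<in> R" "(p, q) \<in> rel" for p q
    using that unfolding R_def by (auto intro: rtrancl_into_rtrancl)
  have RF: "fst p \<in> F1" if "p \<in> R" for p
  proof -
    have "(((U, \<phi>), snd (\<phi> z0)), p) \<in> rel\<^sup>*" using that by (simp add: R_def)
    then show ?thesis
      by (induction rule: rtrancl_induct) (use F1(3) in \<open>simp_all add: rel_def\<close>)
  qed
  define E where "E = (\<Union>p\<in>R. P p)"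
  have Pq: "q \<in> R" if "z \<in> E" "z \<in> P q" "fst q \<in> F1" for z q
  proof -
    obtain p where "p \<in> R" "z \<in> P p" using \<open>z \<in> E\<close> unfolding E_def by blast
    then have "(p, q) \<in> rel" using that RF by (auto simp: rel_def)
    then show ?thesis using Rstep \<open>p \<in> R\<close> by blast
  qed
  have Popen: "openin (fine_topology F) (P q)" if "fst q \<in> F1" for q
    using fine_open_plaque[of "fst (fst q)" "snd (fst q)" "snd q"] that F1(2)
    by (auto simp: P_def case_prod_unfold)
  have "openin (fine_topology F) E"
    unfolding E_def using Popen RF by blast
  \<comment> \<open>A plaque of a chart in \<open>F1\<close> that met \<open>E\<close> would overlap
    a reachable plaque and be reachable itself. Hence such plaques lie inside \<open>E\<close> or
    are disjoint from it.\<close>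
  moreover have "openin (fine_topology F) (topspace N - E)"
  proof (subst openin_subopen, intro ballI)
    fix z assume z: "z \<in> topspace N - E"
    then obtain j where j: "j \<in> F1" "z \<in> fst j" using cover by blast
    let ?q = "(j, snd (snd j z))"
    have zq: "z \<in> P ?q" using j by (simp add: P_def)
    then have "?q \<notin> R" using z by (auto simp: E_def)
    then have "P ?q \<inter> E = {}" using Pq[of _ ?q] j(1) by auto
    moreover have "P ?q \<subseteq> topspace N"
      using openin_subset[OF Popen[of ?q]] j(1) topspace_fine by simp
    ultimately show "\<exists>T. openin (fine_topology F) T \<and> z \<in> T \<and> T \<subseteq> topspace N - E"
      using Popen[of ?q] j(1) zq by auto
  qed
  ultimately have "closedin (fine_topology F) E" "openin (fine_topology F) E"
    unfolding closedin_def topspace_fine[symmetric] using openin_subset by auto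
  moreover have "connectedin (fine_topology F) L"
    using assms(2) unfolding leaves_def by (rule connectedin_connected_components_of)
  moreover have "z0 \<in> P ((U, \<phi>), snd (\<phi> z0))"
    using z0 by (simp add: P_def)
  then have "z0 \<in> L \<inter> E"
    using z0 R0 unfolding E_def by blast
  ultimately have "L \<subseteq> E"
    using connectedin_clopen_cases by (metis IntE disjnt_iff)
  have "(\<lambda>z. snd (\<phi> z)) ` (L \<inter> U) \<subseteq> snd ` R"
  proof
    fix v assume "v \<in> (\<lambda>z. snd (\<phi> z)) ` (L \<inter> U)"
    then obtain z where "z \<in> L" "z \<in> U" "v = snd (\<phi> z)" by blast
    then have "((U, \<phi>), v) \<in> R"
      using \<open>L \<subseteq> E\<close> F1(3) by (intro Pq[of z]) (auto simp: P_def)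
    then show "v \<in> snd ` R" by force
  qed
  then show ?thesis by (rule countable_subset[OF _ countable_image[OF cR]])
qed simp

end


section \<open>Matchbox manifolds\<close>

lemma homeomorphic_map_inv_into:
  assumes "homeomorphic_map X Y f"
  shows "continuous_map Y X (inv_into (topspace X) f)"
proof -
  obtain g where g: "homeomorphic_maps X Y f g"
    using assms unfolding homeomorphic_map_maps ..
  have "g y = inv_into (topspace X) f y" if "y \<in> topspace Y" for y
  proof -
    have "g y \<in> topspace X" "f (g y) = y"
      using g that unfolding homeomorphic_maps_def by (auto simp: continuous_map_def)
    then show ?thesis
      using homeomorphic_imp_injective_map[OF assms] inv_into_f_f by metis
  qed
  moreover have "continuous_map Y X g" using g by (simp add: homeomorphic_maps_def)
  ultimately show ?thesis by (rule continuous_map_eq[rotated])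
qed

lemma continuous_map_totally_disconnected:
  assumes "connected_space S" "continuous_map S X f" "totally_disconnected_space X"
    and "s \<in> topspace S" "t \<in> topspace S"
  shows "f s = f t"
proof -
  have "connectedin X (f ` topspace S)"
    using assms(1,2) connectedin_continuous_map_image connectedin_topspace by blast
  then obtain a where "f ` topspace S \<subseteq> {a}"
    using assms(3) unfolding totally_disconnected_space_def by blast
  then show ?thesis using assms(4,5) by blast
qed

definition chart_point :: "('a, 'e, 't) chart_family \<Rightarrow> 'a \<Rightarrow> 'e \<times> 't \<Rightarrow> 'a" where
  "chart_point A x = inv_into (hat_nbhd A x) (chart A x)"

locale matchbox =
  fixes M :: "'a topology" and X :: "'t topology" and A :: "('a, 'e::euclidean_space, 't) chart_family"
  assumes matchbox: "matchbox_manifold M X A"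
begin

abbreviation big_box :: "'e set" where "big_box \<equiv> box (- 2 *\<^sub>R One) (2 *\<^sub>R One)"
abbreviation unit_box :: "'e set" where "unit_box \<equiv> box (- One) One"

lemma unit_box_subset: "unit_box \<subseteq> big_box"
  by (auto simp: mem_box) (smt (verit, best))+

lemma zero_in_unit_box: "0 \<in> unit_box"
  by (simp add: mem_box)

lemma connected_unit_box: "connected unit_box"
  by (intro convex_connected convex_box)

lemma transv_disconnected: "totally_disconnected_space X"
  using matchbox by (simp add: matchbox_manifold_def)

context
  fixes x assumes x: "x \<in> topspace M"
begin

lemma transv_open: "openin X (transv A x)"
  and hat_open: "openin M (hat_nbhd A x)"
  and hat_mem: "x \<in> hat_nbhd A x"
  and chart_homeo: "homeomorphic_map (subtopology M (hat_nbhd A x))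
          (prod_topology (top_of_set big_box) (subtopology X (transv A x))) (chart A x)"
  and chart_center: "fst (chart A x x) = 0"
  using matchbox x unfolding matchbox_manifold_def by auto

lemma transv_subset: "transv A x \<subseteq> topspace X"
  using transv_open by (rule openin_subset)

lemma topspace_hat: "topspace (subtopology M (hat_nbhd A x)) = hat_nbhd A x"
  using openin_subset[OF hat_open] by auto

lemma topspace_product: "topspace (prod_topology (top_of_set big_box) (subtopology X (transv A x))) = big_box \<times> transv A x"
  using transv_subset by auto

lemma chart_inj: "inj_on (chart A x) (hat_nbhd A x)"
  using homeomorphic_imp_injective_map[OF chart_homeo] unfolding topspace_hat .

lemma chart_image: "chart A x ` hat_nbhd A x = big_box \<times> transv A x"
  using homeomorphic_imp_surjective_map[OF chart_homeo] unfolding topspace_hat topspace_product .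

lemma chart_point_mem:
  assumes "u \<in> big_box" "w \<in> transv A x"
  shows "chart_point A x (u, w) \<in> hat_nbhd A x" "chart A x (chart_point A x (u, w)) = (u, w)"
  using assms chart_image unfolding chart_point_def
  by (auto intro!: inv_into_into f_inv_into_f)

lemma chart_mem:
  assumes "z \<in> hat_nbhd A x"
  shows "fst (chart A x z) \<in> big_box" "snd (chart A x z) \<in> transv A x"
  using imageI[OF assms, of "chart A x"] unfolding chart_image by (auto simp: mem_Times_iff)

lemma chart_point_chart: "z \<in> hat_nbhd A x \<Longrightarrow> chart_point A x (chart A x z) = z"
  unfolding chart_point_def using chart_inj by (rule inv_into_f_f)

lemma chart_point_continuous:
  "continuous_map (prod_topology (top_of_set big_box) (subtopology X (transv A x))) M (chart_point A x)"
  using homeomorphic_map_inv_into[OF chart_homeo] unfolding topspace_hat chart_point_def[symmetric]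
  by (simp add: continuous_map_in_subtopology)

lemma chart_continuous:
  "continuous_map (subtopology M (hat_nbhd A x)) euclidean (\<lambda>z. fst (chart A x z))"
  "continuous_map (subtopology M (hat_nbhd A x)) X (\<lambda>z. snd (chart A x z))"
proof -
  have *: "continuous_map (subtopology M (hat_nbhd A x))
      (prod_topology (top_of_set big_box) (subtopology X (transv A x))) (chart A x)"
    using chart_homeo homeomorphic_imp_continuous_map by blast
  show "continuous_map (subtopology M (hat_nbhd A x)) euclidean (\<lambda>z. fst (chart A x z))"
    using continuous_map_fst_of[OF *] by (simp add: continuous_map_in_subtopology o_def)
  show "continuous_map (subtopology M (hat_nbhd A x)) X (\<lambda>z. snd (chart A x z))"
    using continuous_map_snd_of[OF *] by (simp add: continuous_map_in_subtopology o_def)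
qed

lemma chart_nbhd_subset: "chart_nbhd A x \<subseteq> hat_nbhd A x"
  by (auto simp: chart_nbhd_def)

lemma chart_nbhd_open: "openin M (chart_nbhd A x)"
proof -
  have "openin (subtopology M (hat_nbhd A x))
      {z \<in> topspace (subtopology M (hat_nbhd A x)). fst (chart A x z) \<in> unit_box}"
    using chart_continuous(1) by (rule openin_continuous_map_preimage) (simp add: open_box)
  then show ?thesis
    unfolding topspace_hat chart_nbhd_def using hat_open openin_trans_full by blast
qed

lemma center_mem: "x \<in> chart_nbhd A x"
  using hat_mem chart_center zero_in_unit_box by (simp add: chart_nbhd_def)

lemma center_eq: "chart_point A x (0, snd (chart A x x)) = x"
  using chart_point_chart[OF hat_mem] chart_center by (metis prod.collapse)

lemma chart_point_nbhd:
  "u \<in> unit_box \<Longrightarrow> w \<in> transv A x \<Longrightarrow> chart_point A x (u, w) \<in> chart_nbhd A x"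
  using chart_point_mem unit_box_subset by (auto simp: chart_nbhd_def)

lemma plaque_continuous:
  assumes "w \<in> transv A x" "C \<subseteq> big_box"
  shows "continuous_map (top_of_set C) M (\<lambda>u. chart_point A x (u, w))"
proof -
  have "continuous_map (top_of_set C)
      (prod_topology (top_of_set big_box) (subtopology X (transv A x))) (\<lambda>u. (u, w))"
    using assms transv_subset by (auto simp: continuous_map_pairwise o_def continuous_map_in_subtopology)
  then show ?thesis
    using continuous_map_compose[OF _ chart_point_continuous] by (simp add: o_def)
qed

lemma chart_point_local:
  assumes "u \<in> big_box" "w \<in> transv A x" "openin M W" "chart_point A x (u, w) \<in> W"
  obtains r O' where "r > 0" "ball u r \<subseteq> big_box" "openin X O'" "w \<in> O'" "O' \<subseteq> transv A x"
    "\<And>u' w'. u' \<in> ball u r \<Longrightarrow> w' \<in> O' \<Longrightarrow> chart_point A x (u', w') \<in> W"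
proof -
  let ?T = "prod_topology (top_of_set big_box) (subtopology X (transv A x))"
  have "openin ?T {p \<in> topspace ?T. chart_point A x p \<in> W}"
    using chart_point_continuous assms(3) by (rule openin_continuous_map_preimage)
  moreover have "(u, w) \<in> {p \<in> topspace ?T. chart_point A x p \<in> W}"
    using assms unfolding topspace_product by simp
  ultimately have "\<exists>B O'. openin (top_of_set big_box) B \<and> openin (subtopology X (transv A x)) O' \<and>
      u \<in> B \<and> w \<in> O' \<and> B \<times> O' \<subseteq> {p \<in> topspace ?T. chart_point A x p \<in> W}"
    by (rule openin_prod_topology_alt[THEN iffD1, rule_format])
  then obtain B O' where BO: "openin (top_of_set big_box) B" "openin (subtopology X (transv A x)) O'"
    "u \<in> B" "w \<in> O'" "B \<times> O' \<subseteq> {p \<in> topspace ?T. chart_point A x p \<in> W}"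
    by blast
  have "open B" using BO(1) by (metis open_box openin_open_trans openin_open_eq)
  then obtain r where "r > 0" "ball u r \<subseteq> B" using BO(3) open_contains_ball by blast
  moreover have "B \<subseteq> big_box" using BO(1) openin_imp_subset by blast
  moreover have "openin X O'" "O' \<subseteq> transv A x"
    using openin_trans_full[OF BO(2) transv_open] openin_imp_subset[OF BO(2)] by auto
  ultimately show thesis
    using that[of r O'] BO(4,5) by blast
qed

text \<open>A connected set has a one-point image in the totally disconnected \<open>X\<close>. That
  chart changes respect plaques is not a clause of \<open>matchbox_manifold\<close>; it follows from
  this.\<close>

lemma transv_constant:
  assumes "connected_space S" "continuous_map S M \<gamma>" "\<And>s. s \<in> topspace S \<Longrightarrow> \<gamma> s \<in> hat_nbhd A x"
    and "s \<in> topspace S" "t \<in> topspace S"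
  shows "snd (chart A x (\<gamma> s)) = snd (chart A x (\<gamma> t))"
proof -
  have "continuous_map S (subtopology M (hat_nbhd A x)) \<gamma>"
    using assms(2,3) by (auto simp: continuous_map_in_subtopology)
  then have "continuous_map S X ((\<lambda>z. snd (chart A x z)) \<circ> \<gamma>)"
    using chart_continuous(2) by (rule continuous_map_compose)
  then have "((\<lambda>z. snd (chart A x z)) \<circ> \<gamma>) s = ((\<lambda>z. snd (chart A x z)) \<circ> \<gamma>) t"
    by (rule continuous_map_totally_disconnected[OF assms(1) _ transv_disconnected assms(4,5)])
  then show ?thesis by simp
qed

end

sublocale foliated_atlas M "foliation_charts M A"
proof
  fix U \<phi> assume "(U, \<phi>) \<in> foliation_charts M A"
  then obtain x where x: "x \<in> topspace M" "U = chart_nbhd A x" "\<phi> = chart A x"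
    by (auto simp: foliation_charts_def)
  show "openin M U" using chart_nbhd_open x by simp
  show "continuous_map (subtopology M U) euclidean (\<lambda>z. fst (\<phi> z))"
    unfolding x(2,3) using continuous_map_from_subtopology_mono[OF chart_continuous(1)] chart_nbhd_subset x by blast
  show "\<exists>B \<gamma>. open (B::'e set) \<and> connected B \<and> continuous_map (top_of_set B) M \<gamma> \<and>
        \<gamma> ` B = {z' \<in> U. snd (\<phi> z') = snd (\<phi> z)}" if "z \<in> U" for z
  proof (intro exI conjI)
    have w: "snd (\<phi> z) \<in> transv A x"
      using that chart_mem[OF x(1)] chart_nbhd_subset[OF x(1)] x by blast
    show "continuous_map (top_of_set unit_box) M (\<lambda>u. chart_point A x (u, snd (\<phi> z)))"
      using plaque_continuous[OF x(1) w unit_box_subset] .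
    show "(\<lambda>u. chart_point A x (u, snd (\<phi> z))) ` unit_box = {z' \<in> U. snd (\<phi> z') = snd (\<phi> z)}"
    proof safe
      fix u assume "u \<in> unit_box"
      then show "chart_point A x (u, snd (\<phi> z)) \<in> U" "snd (\<phi> (chart_point A x (u, snd (\<phi> z)))) = snd (\<phi> z)"
        using chart_point_nbhd[OF x(1) _ w] chart_point_mem[OF x(1) _ w] unit_box_subset x by auto
    next
      fix z' assume z': "z' \<in> U" "snd (\<phi> z') = snd (\<phi> z)"
      then have "z' \<in> hat_nbhd A x" using chart_nbhd_subset[OF x(1)] x by blast
      then have "chart_point A x (chart A x z') = z'" by (rule chart_point_chart[OF x(1)])
      then have "z' = chart_point A x (fst (\<phi> z'), snd (\<phi> z))"
        using z'(2) unfolding x(3) by (metis prod.collapse)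
      moreover have "fst (\<phi> z') \<in> unit_box" using z' x by (simp add: chart_nbhd_def)
      ultimately show "z' \<in> (\<lambda>u. chart_point A x (u, snd (\<phi> z))) ` unit_box" by blast
    qed
  qed (use connected_unit_box in auto)
next
  fix z assume "z \<in> topspace M"
  then show "\<exists>U \<phi>. (U, \<phi>) \<in> foliation_charts M A \<and> z \<in> U"
    using center_mem by (auto simp: foliation_charts_def)
next
  fix U \<phi> V \<psi> z
  assume "(U, \<phi>) \<in> foliation_charts M A" "(V, \<psi>) \<in> foliation_charts M A" and z: "z \<in> U" "z \<in> V"
  then obtain x y where x: "x \<in> topspace M" "U = chart_nbhd A x" "\<phi> = chart A x"
    and y: "y \<in> topspace M" "V = chart_nbhd A y" "\<psi> = chart A y"
    by (auto simp: foliation_charts_def)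
  have zh: "z \<in> hat_nbhd A x" using z x chart_nbhd_subset by blast
  define u w where "u = fst (chart A x z)" and "w = snd (chart A x z)"
  have uw: "u \<in> big_box" "w \<in> transv A x" "chart_point A x (u, w) = z"
    using chart_mem[OF x(1) zh] chart_point_chart[OF x(1) zh] by (auto simp: u_def w_def)
  have "openin M (U \<inter> V)" using chart_nbhd_open x y by auto
  then obtain r O' where r: "r > 0" "ball u r \<subseteq> big_box" "openin X O'" "w \<in> O'" "O' \<subseteq> transv A x"
    "\<And>u' w'. u' \<in> ball u r \<Longrightarrow> w' \<in> O' \<Longrightarrow> chart_point A x (u', w') \<in> U \<inter> V"
    using chart_point_local[OF x(1) uw(1,2), of "U \<inter> V"] uw(3) z by auto
  \<comment> \<open>A product neighbourhood in the chart at \<open>x\<close>: its plaques are balls,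
    hence connected, and they lie in the chart at \<open>y\<close>, so
    \<open>transv_constant\<close> applies to each.\<close>
  define Z where "Z = {z' \<in> hat_nbhd A x. fst (chart A x z') \<in> ball u r} \<inter> {z' \<in> hat_nbhd A x. snd (chart A x z') \<in> O'}"
  have "openin M {z' \<in> hat_nbhd A x. fst (chart A x z') \<in> ball u r}"
    using openin_continuous_map_preimage[OF chart_continuous(1)[OF x(1)], of "ball u r"] hat_open[OF x(1)]
    unfolding topspace_hat[OF x(1)] by (auto intro: openin_trans_full)
  moreover have "openin M {z' \<in> hat_nbhd A x. snd (chart A x z') \<in> O'}"
    using openin_continuous_map_preimage[OF chart_continuous(2)[OF x(1)] r(3)] hat_open[OF x(1)]
    unfolding topspace_hat[OF x(1)] by (auto intro: openin_trans_full)
  ultimately have "openin M Z" unfolding Z_def by (rule openin_Int)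
  moreover have "z \<in> Z" using zh r(1,4) by (simp add: Z_def u_def w_def)
  moreover have ZUV: "z' \<in> U \<inter> V" if "z' \<in> Z" for z'
  proof -
    have "z' = chart_point A x (fst (chart A x z'), snd (chart A x z'))"
      using that chart_point_chart[OF x(1)] by (simp add: Z_def)
    then show ?thesis using r(6) that by (metis (no_types, lifting) Int_Collect Z_def IntD1 IntD2 mem_Collect_eq)
  qed
  moreover have "snd (\<psi> z1) = snd (\<psi> z2)" if z12: "z1 \<in> Z" "z2 \<in> Z" and eq: "snd (\<phi> z1) = snd (\<phi> z2)" for z1 z2
  proof -
    define v where "v = snd (\<phi> z1)"
    have v: "v \<in> O'" "v \<in> transv A x" using z12 r(5) by (auto simp: v_def Z_def x)
    let ?\<gamma> = "\<lambda>u'. chart_point A x (u', v)"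
    have "connected_space (top_of_set (ball u r))"
      by (simp add: connected_space_subtopology connectedin_iff_connected)
    moreover have "continuous_map (top_of_set (ball u r)) M ?\<gamma>"
      using plaque_continuous[OF x(1) v(2) r(2)] .
    moreover have "?\<gamma> s \<in> hat_nbhd A y" if "s \<in> topspace (top_of_set (ball u r))" for s
      using r(6)[of s v] that v chart_nbhd_subset[OF y(1)] y by auto
    moreover have "fst (chart A x z1) \<in> topspace (top_of_set (ball u r))"
      "fst (chart A x z2) \<in> topspace (top_of_set (ball u r))"
      using z12 by (auto simp: Z_def)
    ultimately have "snd (chart A y (?\<gamma> (fst (chart A x z1)))) = snd (chart A y (?\<gamma> (fst (chart A x z2))))"
      by (intro transv_constant[OF y(1)])
    moreover have "?\<gamma> (fst (chart A x z1)) = z1" "?\<gamma> (fst (chart A x z2)) = z2"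
    proof -
      have "z1 \<in> hat_nbhd A x" "z2 \<in> hat_nbhd A x" "v = snd (chart A x z1)" "v = snd (chart A x z2)"
        using z12 eq by (auto simp: v_def Z_def x)
      then show "?\<gamma> (fst (chart A x z1)) = z1" "?\<gamma> (fst (chart A x z2)) = z2"
        using chart_point_chart[OF x(1)] by (metis prod.collapse)+
    qed
    ultimately show ?thesis by (simp add: y)
  qed
  ultimately show "\<exists>Z. openin M Z \<and> z \<in> Z \<and> Z \<subseteq> U \<inter> V \<and>
        (\<forall>z1\<in>Z. \<forall>z2\<in>Z. snd (\<phi> z1) = snd (\<phi> z2) \<longrightarrow> snd (\<psi> z1) = snd (\<psi> z2))"
    by blast
qed

section \<open>The full transversal and density of leaves\<close>

lemma topspace_full_transversal:
  "topspace (full_transversal M X A) = (SIGMA x:topspace M. transv A x)"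
  using transv_subset unfolding full_transversal_def by (force simp: topspace_sum_topology)

lemma openin_full_transversal:
  "openin (full_transversal M X A) U \<longleftrightarrow>
     U \<subseteq> (SIGMA x:topspace M. transv A x) \<and> (\<forall>x\<in>topspace M. openin X {w. (x, w) \<in> U})"
proof -
  have "openin (full_transversal M X A) U \<longleftrightarrow> U \<subseteq> topspace (full_transversal M X A) \<and>
      (\<forall>x\<in>topspace M. openin (subtopology X (transv A x)) {w. (x, w) \<in> U})"
    unfolding full_transversal_def openin_sum_topology topspace_sum_topology by (simp add: o_def)
  moreover have "openin (subtopology X (transv A x)) {w. (x, w) \<in> U} \<longleftrightarrow> openin X {w. (x, w) \<in> U}"
    if "x \<in> topspace M" "U \<subseteq> (SIGMA x:topspace M. transv A x)" for x
    using that transv_open[OF that(1)] by (auto simp: openin_open_subtopology)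
  ultimately show ?thesis unfolding topspace_full_transversal by blast
qed

lemma openin_full_transversal_slice:
  assumes "x \<in> topspace M" "openin X G" "G \<subseteq> transv A x"
  shows "openin (full_transversal M X A) ({x} \<times> G)"
proof -
  have "openin X {w. (x', w) \<in> {x} \<times> G}" for x'
    by (cases "x' = x") (use assms(2) in simp_all)
  then show ?thesis
    unfolding openin_full_transversal using assms(1,3) by auto
qed

text \<open>Each transversal point is represented by the centre \<open>c p\<close> of its plaque. A
  transverse change joins plaques through a common point, so it preserves the leaf of the centre,
  and so does all holonomy. A dense orbit thus yields centres of one leaf in every open set.\<close>

lemma minimal_matchbox_if_minimal_pseudogroup:
  assumes "minimal_pseudogroup Y P"
    and "pseudogroup_equivalent Y P (full_transversal M X A) (holonomy_pseudogroup M X A)"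
  shows "minimal_matchbox M A"
proof -
  let ?T = "full_transversal M X A" and ?F = "foliation_charts M A"
  define c where "c p = chart_point A (fst p) (0, snd p)" for p
  define R where "R = {(p, q). p \<in> topspace ?T \<and> q \<in> topspace ?T \<and> (\<forall>L\<in>leaves ?F. c p \<in> L \<longleftrightarrow> c q \<in> L)}"
  have "equiv (topspace ?T) R"
    by (auto simp: equiv_def R_def refl_on_def sym_def trans_def)
  then have "pseudogroup ?T {g \<in> local_homeos ?T ?T. g \<subseteq> R}"
    by (rule pseudogroup_within_equivalence)
  moreover have "transverse_changes M X A \<subseteq> {g \<in> local_homeos ?T ?T. g \<subseteq> R}"
  proof
    fix g assume "g \<in> transverse_changes M X A"
    then obtain x y Z where g: "g \<in> local_homeos ?T ?T" and xy: "x \<in> topspace M" "y \<in> topspace M"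
      and Z: "Z \<subseteq> chart_nbhd A x \<inter> chart_nbhd A y"
      and geq: "g = (\<lambda>z. ((x, snd (chart A x z)), (y, snd (chart A y z)))) ` Z"
      unfolding transverse_changes_def by blast
    have center: "(c (x, snd (chart A x z)) \<in> L \<longleftrightarrow> z \<in> L) \<and> snd (chart A x z) \<in> transv A x"
      if "x \<in> topspace M" "z \<in> chart_nbhd A x" "L \<in> leaves ?F" for x z L
    proof -
      have F: "(chart_nbhd A x, chart A x) \<in> ?F" using that(1) by (auto simp: foliation_charts_def)
      have w: "snd (chart A x z) \<in> transv A x"
        using chart_mem[OF that(1)] chart_nbhd_subset[OF that(1)] that(2) by blast
      have "c (x, snd (chart A x z)) \<in> chart_nbhd A x"
        using chart_point_nbhd[OF that(1) zero_in_unit_box w] by (simp add: c_def)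
      moreover have "snd (chart A x (c (x, snd (chart A x z)))) = snd (chart A x z)"
        using chart_point_mem(2)[OF that(1) _ w, of 0] zero_in_unit_box unit_box_subset by (auto simp: c_def)
      ultimately show ?thesis
        using leaf_plaque[OF that(3) F] that(2) w by metis
    qed
    have "g \<subseteq> R"
    proof
      fix p assume "p \<in> g"
      then obtain z where z: "z \<in> Z" "p = ((x, snd (chart A x z)), (y, snd (chart A y z)))"
        unfolding geq by blast
      then have zc: "z \<in> chart_nbhd A x" "z \<in> chart_nbhd A y" using Z by auto
      have "snd (chart A x z) \<in> transv A x" "snd (chart A y z) \<in> transv A y"
        using chart_mem chart_nbhd_subset xy zc by blast+
      then show "p \<in> R"
        unfolding R_def z(2) topspace_full_transversal
        using center[OF xy(1) zc(1)] center[OF xy(2) zc(2)] xy by auto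
    qed
    then show "g \<in> {g \<in> local_homeos ?T ?T. g \<subseteq> R}" using g by blast
  qed
  ultimately have hol: "holonomy_pseudogroup M X A \<subseteq> {g \<in> local_homeos ?T ?T. g \<subseteq> R}"
    unfolding holonomy_pseudogroup_def by (intro hull_minimal)
  have "topspace M \<subseteq> M closure_of L" if L: "L \<in> leaves ?F" for L
  proof
    fix x0 assume x0: "x0 \<in> topspace M"
    have "\<exists>y. y \<in> L \<and> y \<in> W" if W: "x0 \<in> W" "openin M W" for W
    proof -
      have "L \<noteq> {}" "L \<subseteq> topspace M"
        using L nonempty_connected_components_of connected_components_of_subset
        unfolding leaves_def topspace_fine[symmetric] by blast+
      then obtain z where z: "z \<in> L" "z \<in> topspace M" by blast
      define w0 where "w0 = snd (chart A x0 x0)"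
      have w0: "w0 \<in> transv A x0" "chart_point A x0 (0, w0) = x0"
        using chart_mem[OF x0 hat_mem[OF x0]] center_eq[OF x0] by (auto simp: w0_def)
      obtain r O' where r: "r > 0" "openin X O'" "w0 \<in> O'" "O' \<subseteq> transv A x0"
        "\<And>u' w'. u' \<in> ball 0 r \<Longrightarrow> w' \<in> O' \<Longrightarrow> chart_point A x0 (u', w') \<in> W"
      proof -
        have "0 \<in> big_box" using zero_in_unit_box unit_box_subset by blast
        moreover have "chart_point A x0 (0, w0) \<in> W" using w0(2) W(1) by simp
        ultimately show thesis
          using chart_point_local[OF x0 _ w0(1) W(2)] that by metis
      qed
      have zz: "(z, snd (chart A z z)) \<in> topspace ?T"
        using z(2) chart_mem(2)[OF z(2) hat_mem[OF z(2)]] by (simp add: topspace_full_transversal)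
      have "openin ?T ({x0} \<times> O')"
        using openin_full_transversal_slice[OF x0 r(2,4)] .
      then obtain g q where gq: "g \<in> holonomy_pseudogroup M X A" "q \<in> {x0} \<times> O'" "((z, snd (chart A z z)), q) \<in> g"
        using minimal_pseudogroup_equivalent[OF assms(2,1) zz] r(3) by blast
      then have "((z, snd (chart A z z)), q) \<in> R" using hol by blast
      moreover have "c (z, snd (chart A z z)) = z" using center_eq[OF z(2)] by (simp add: c_def)
      ultimately have "c q \<in> L" using L z(1) by (auto simp: R_def)
      moreover have "c q \<in> W" using gq(2) r(1,5) by (auto simp: c_def)
      ultimately show ?thesis by blast
    qed
    then show "x0 \<in> M closure_of L" using x0 unfolding in_closure_of by blast
  qed
  then show ?thesis
    unfolding minimal_matchbox_def by (intro ballI equalityI closure_of_subset_topspace)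
qed

end


section \<open>Foliations of class C1\<close>

text \<open>In particular \<open>\<beta>\<close> is near \<open>w\<close> a function of
  \<open>\<alpha>\<close>. Comparing increments of both on a common domain avoids naming that
  function, which would be defined only on the possibly Cantor-like image of
  \<open>\<alpha>\<close>.\<close>

definition germ_lipschitz ::
    "'w topology \<Rightarrow> 'w \<Rightarrow> ('w \<Rightarrow> 'b::real_normed_vector) \<Rightarrow> ('w \<Rightarrow> 'c::real_normed_vector) \<Rightarrow> bool" where
  "germ_lipschitz T w \<alpha> \<beta> \<longleftrightarrow> (\<exists>G C. openin T G \<and> w \<in> G \<and> 0 \<le> C \<and>
     (\<forall>a\<in>G. \<forall>b\<in>G. norm (\<beta> a - \<beta> b) \<le> C * norm (\<alpha> a - \<alpha> b)))"

locale c1_foliation =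
  fixes N :: "'m topology" and F :: "('m set \<times> ('m \<Rightarrow> 'g::euclidean_space \<times> 'f::euclidean_space)) set"
  assumes foliation: "C1_foliation N F"
begin

abbreviation leaf_box :: "'g set" where "leaf_box \<equiv> box (- One) One"
abbreviation transverse_box :: "'f set" where "transverse_box \<equiv> box (- One) One"

context
  fixes U \<psi> assumes U: "(U, \<psi>) \<in> F"
begin

lemma fol_open: "openin N U"
  and fol_homeo: "homeomorphic_map (subtopology N U) (top_of_set (leaf_box \<times> transverse_box)) \<psi>"
  using foliation U unfolding C1_foliation_def by auto

lemma topspace_fol: "topspace (subtopology N U) = U"
  using openin_subset[OF fol_open] by auto

lemma fol_inv_mem:
  assumes "p \<in> leaf_box \<times> transverse_box"
  shows "inv_into U \<psi> p \<in> U" "\<psi> (inv_into U \<psi> p) = p"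
proof -
  have "\<psi> ` U = leaf_box \<times> transverse_box"
    using homeomorphic_imp_surjective_map[OF fol_homeo] unfolding topspace_fol by simp
  then show "inv_into U \<psi> p \<in> U" "\<psi> (inv_into U \<psi> p) = p"
    using assms by (auto intro: inv_into_into f_inv_into_f)
qed

lemma fol_mem: "z \<in> U \<Longrightarrow> \<psi> z \<in> leaf_box \<times> transverse_box"
  using homeomorphic_imp_surjective_map[OF fol_homeo] unfolding topspace_fol by auto

lemma fol_inv: "z \<in> U \<Longrightarrow> inv_into U \<psi> (\<psi> z) = z"
  using homeomorphic_imp_injective_map[OF fol_homeo] unfolding topspace_fol by (rule inv_into_f_f)

lemma fol_continuous: "continuous_map (subtopology N U) euclidean \<psi>"
  using homeomorphic_imp_continuous_map[OF fol_homeo] by (simp add: continuous_map_in_subtopology)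

lemma fol_fst_continuous: "continuous_map (subtopology N U) euclidean (\<lambda>z. fst (\<psi> z))"
  and fol_snd_continuous: "continuous_map (subtopology N U) euclidean (\<lambda>z. snd (\<psi> z))"
proof -
  have "continuous_map euclidean euclidean (fst :: 'g \<times> 'f \<Rightarrow> 'g)"
    "continuous_map euclidean euclidean (snd :: 'g \<times> 'f \<Rightarrow> 'f)"
    by (auto intro: continuous_intros)
  then show "continuous_map (subtopology N U) euclidean (\<lambda>z. fst (\<psi> z))"
    "continuous_map (subtopology N U) euclidean (\<lambda>z. snd (\<psi> z))"
    using continuous_map_compose[OF fol_continuous, unfolded o_def] by blast+
qed

lemma fol_inv_continuous:
  "continuous_map (top_of_set (leaf_box \<times> transverse_box)) N (inv_into U \<psi>)"
  using homeomorphic_map_inv_into[OF fol_homeo] unfolding topspace_fol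
  by (simp add: continuous_map_in_subtopology)

lemma fol_plaque_continuous:
  assumes "v \<in> transverse_box" "B \<subseteq> leaf_box"
  shows "continuous_map (top_of_set B) N (\<lambda>u. inv_into U \<psi> (u, v))"
proof -
  have "continuous_map (top_of_set B) (top_of_set (leaf_box \<times> transverse_box)) (\<lambda>u. (u, v))"
    using assms by (auto simp: continuous_map_in_subtopology intro!: continuous_intros)
  then show ?thesis
    using continuous_map_compose[OF _ fol_inv_continuous, unfolded o_def] by blast
qed

lemma fol_product_open:
  assumes "open P" "open Q"
  shows "openin N {z \<in> U. fst (\<psi> z) \<in> P \<and> snd (\<psi> z) \<in> Q}"
proof -
  have "openin (subtopology N U) {z \<in> topspace (subtopology N U). \<psi> z \<in> P \<times> Q}"
    using fol_continuous by (rule openin_continuous_map_preimage) (use assms in \<open>simp add: open_Times\<close>)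
  then have "openin N {z \<in> U. \<psi> z \<in> P \<times> Q}"
    unfolding topspace_fol using fol_open openin_trans_full by blast
  moreover have "{z \<in> U. \<psi> z \<in> P \<times> Q} = {z \<in> U. fst (\<psi> z) \<in> P \<and> snd (\<psi> z) \<in> Q}"
    by (auto simp: mem_Times_iff)
  ultimately show ?thesis by simp
qed

lemma fol_local:
  assumes "z \<in> U" "openin N W" "z \<in> W"
  obtains r where "r > 0" "ball (fst (\<psi> z)) r \<subseteq> leaf_box" "ball (snd (\<psi> z)) r \<subseteq> transverse_box"
    "\<And>u v. u \<in> ball (fst (\<psi> z)) r \<Longrightarrow> v \<in> ball (snd (\<psi> z)) r \<Longrightarrow> inv_into U \<psi> (u, v) \<in> W"
proof -
  let ?B = "leaf_box \<times> transverse_box"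
  have "openin (top_of_set ?B) {p \<in> topspace (top_of_set ?B). inv_into U \<psi> p \<in> W}"
    using fol_inv_continuous assms(2) by (rule openin_continuous_map_preimage)
  moreover have "open ?B" by (intro open_Times open_box)
  ultimately have "open {p \<in> ?B. inv_into U \<psi> p \<in> W}"
    using openin_open_trans by fastforce
  moreover have "(fst (\<psi> z), snd (\<psi> z)) \<in> {p \<in> ?B. inv_into U \<psi> p \<in> W}"
    using fol_mem[OF assms(1)] fol_inv[OF assms(1)] assms(3) by simp
  ultimately obtain P Q where PQ: "open P" "open Q" "(fst (\<psi> z), snd (\<psi> z)) \<in> P \<times> Q"
    "P \<times> Q \<subseteq> {p \<in> ?B. inv_into U \<psi> p \<in> W}"
    by (rule open_prod_elim)
  obtain r1 r2 where r: "r1 > 0" "ball (fst (\<psi> z)) r1 \<subseteq> P" "r2 > 0" "ball (snd (\<psi> z)) r2 \<subseteq> Q"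
    using PQ(1-3) open_contains_ball by (metis mem_Sigma_iff)
  define r where "r = min r1 r2"
  have sub: "ball (fst (\<psi> z)) r \<subseteq> P" "ball (snd (\<psi> z)) r \<subseteq> Q"
    using r unfolding r_def by auto
  show thesis
  proof (rule that[of r])
    show "r > 0" using r by (simp add: r_def)
    show "ball (fst (\<psi> z)) r \<subseteq> leaf_box" "ball (snd (\<psi> z)) r \<subseteq> transverse_box"
      using sub PQ(3,4) by blast+
    show "inv_into U \<psi> (u, v) \<in> W" if "u \<in> ball (fst (\<psi> z)) r" "v \<in> ball (snd (\<psi> z)) r" for u v
      using sub PQ(4) that by blast
  qed
qed

end

lemma fol_compat:
  assumes "(U, \<phi>) \<in> F" "(V, \<psi>) \<in> F"
  shows "C1_on (\<phi> ` (U \<inter> V)) (\<psi> \<circ> inv_into U \<phi>) \<and>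
    (\<forall>z\<in>U \<inter> V. \<exists>Z. openin N Z \<and> z \<in> Z \<and> Z \<subseteq> U \<inter> V \<and>
      (\<forall>z1\<in>Z. \<forall>z2\<in>Z. snd (\<phi> z1) = snd (\<phi> z2) \<longrightarrow> snd (\<psi> z1) = snd (\<psi> z2)))"
  using foliation[unfolded C1_foliation_def, THEN conjunct2, THEN conjunct2, THEN conjunct2, THEN conjunct2,
      THEN bspec, OF assms(1), unfolded prod.case, THEN bspec, OF assms(2), unfolded prod.case] .

sublocale foliated_atlas N F
proof
  fix U \<psi> assume U: "(U, \<psi>) \<in> F"
  show "openin N U" using fol_open[OF U] .
  show "continuous_map (subtopology N U) euclidean (\<lambda>z. fst (\<psi> z))" using fol_fst_continuous[OF U] .
  fix z assume z: "z \<in> U"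
  define v where "v = snd (\<psi> z)"
  have v: "v \<in> transverse_box" using fol_mem[OF U z] by (auto simp: v_def)
  show "\<exists>B \<gamma>. open (B::'g set) \<and> connected B \<and> continuous_map (top_of_set B) N \<gamma> \<and>
        \<gamma> ` B = {z' \<in> U. snd (\<psi> z') = snd (\<psi> z)}"
  proof (intro exI conjI)
    show "continuous_map (top_of_set leaf_box) N (\<lambda>u. inv_into U \<psi> (u, v))"
      using fol_plaque_continuous[OF U v] by simp
    show "(\<lambda>u. inv_into U \<psi> (u, v)) ` leaf_box = {z' \<in> U. snd (\<psi> z') = snd (\<psi> z)}"
    proof safe
      fix u assume "u \<in> leaf_box"
      then have "(u, v) \<in> leaf_box \<times> transverse_box" using v by simp
      then show "inv_into U \<psi> (u, v) \<in> U" "snd (\<psi> (inv_into U \<psi> (u, v))) = snd (\<psi> z)"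
        using fol_inv_mem[OF U] by (auto simp: v_def)
    next
      fix z' assume z': "z' \<in> U" "snd (\<psi> z') = snd (\<psi> z)"
      then have "z' = inv_into U \<psi> (fst (\<psi> z'), v)"
        using fol_inv[OF U z'(1)] by (metis prod.collapse v_def)
      moreover have "fst (\<psi> z') \<in> leaf_box" using fol_mem[OF U z'(1)] by auto
      ultimately show "z' \<in> (\<lambda>u. inv_into U \<psi> (u, v)) ` leaf_box" by blast
    qed
  qed (auto intro: convex_connected convex_box)
next
  fix z assume "z \<in> topspace N"
  moreover have "(\<Union>(U, \<phi>)\<in>F. U) = topspace N" using foliation by (simp add: C1_foliation_def)
  ultimately show "\<exists>U \<phi>. (U, \<phi>) \<in> F \<and> z \<in> U" by blast
qed (use fol_compat in simp)

text \<open>Locally the new transverse coordinate depends on the old one alone, so it can be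
  computed with the leaf coordinate frozen at \<open>u0\<close>. On that convex transverse slice the
  mean value inequality applies.\<close>

lemma chart_change_lipschitz:
  assumes U: "(U, \<psi>) \<in> F" and V: "(V, \<theta>) \<in> F" and z: "z \<in> U" "z \<in> V"
  shows "germ_lipschitz N z (\<lambda>z. snd (\<psi> z)) (\<lambda>z. snd (\<theta> z))"
proof -
  define G where "G = \<theta> \<circ> inv_into U \<psi>"
  define D where "D = \<psi> ` (U \<inter> V)"
  obtain f' where f': "\<And>p. p \<in> D \<Longrightarrow> (G has_derivative blinfun_apply (f' p)) (at p)" "continuous_on D f'"
    using fol_compat[OF U V] unfolding C1_on_def G_def D_def by blast
  obtain Z0 where Z0: "openin N Z0" "z \<in> Z0" "Z0 \<subseteq> U \<inter> V"
    "\<And>z1 z2. z1 \<in> Z0 \<Longrightarrow> z2 \<in> Z0 \<Longrightarrow> snd (\<psi> z1) = snd (\<psi> z2) \<Longrightarrow> snd (\<theta> z1) = snd (\<theta> z2)"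
    using fol_compat[OF U V] z by (metis IntI)
  define u0 v0 where "u0 = fst (\<psi> z)" and "v0 = snd (\<psi> z)"
  obtain r where r: "r > 0" "ball u0 r \<subseteq> leaf_box" "ball v0 r \<subseteq> transverse_box"
    "\<And>u v. u \<in> ball u0 r \<Longrightarrow> v \<in> ball v0 r \<Longrightarrow> inv_into U \<psi> (u, v) \<in> Z0"
    using fol_local[OF U z(1) Z0(1,2)] unfolding u0_def v0_def by metis
  have p0: "(u0, v0) \<in> D" using z by (auto simp: D_def u0_def v0_def)
  obtain d where d: "d > 0" "\<And>p. p \<in> D \<Longrightarrow> dist p (u0, v0) < d \<Longrightarrow> dist (f' p) (f' (u0, v0)) < 1"
    using f'(2) p0 unfolding continuous_on_iff by (metis zero_less_one)
  define s where "s = min r d"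
  have s: "s > 0" using r d by (simp add: s_def)
  \<comment> \<open>Within distance \<open>d\<close> of the base point the derivative changes by
    less than 1 in norm.\<close>
  define C where "C = norm (f' (u0, v0)) + 1"
  have inZ0: "inv_into U \<psi> (u, v) \<in> Z0" "(u, v) \<in> leaf_box \<times> transverse_box"
    if "u \<in> ball u0 r" "v \<in> ball v0 s" for u v
    using r that by (auto simp: s_def)
  have seg: "(u0, v) \<in> D \<and> norm (f' (u0, v)) \<le> C" if "v \<in> ball v0 s" for v
  proof -
    have u0: "u0 \<in> ball u0 r" using r by simp
    have "(u0, v) \<in> D"
      unfolding D_def using inZ0[OF u0 that] Z0(3) fol_inv_mem(2)[OF U inZ0(2)[OF u0 that]]
      by (metis image_eqI subsetD)
    moreover have "dist (u0, v) (u0, v0) < d"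
      using that by (simp add: dist_Pair_Pair dist_commute s_def)
    ultimately show ?thesis
      using d(2)[of "(u0, v)"] norm_triangle_sub[of "f' (u0, v)" "f' (u0, v0)"]
      by (force simp: C_def dist_norm)
  qed
  have G: "norm (snd (G (u0, v1)) - snd (G (u0, v2))) \<le> C * norm (v1 - v2)"
    if v: "v1 \<in> ball v0 s" "v2 \<in> ball v0 s" for v1 v2
  proof -
    let ?S = "{u0} \<times> ball v0 s"
    have "norm (G (u0, v1) - G (u0, v2)) \<le> C * norm ((u0, v1) - (u0, v2))"
    proof (rule differentiable_bound)
      show "convex ?S" by (intro convex_Times convex_singleton convex_ball)
      show "(G has_derivative blinfun_apply (f' p)) (at p within ?S)" if "p \<in> ?S" for p
        using that seg f'(1) has_derivative_at_withinI by blast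
      show "onorm (blinfun_apply (f' p)) \<le> C" if "p \<in> ?S" for p
        using that seg by (auto simp: norm_blinfun.rep_eq[symmetric])
    qed (use v in auto)
    moreover have "norm (snd (G (u0, v1)) - snd (G (u0, v2))) \<le> norm (G (u0, v1) - G (u0, v2))"
      using dist_snd_le[of "G (u0, v1)" "G (u0, v2)"] by (simp add: dist_norm)
    ultimately show ?thesis by (simp add: norm_Pair)
  qed
  define Z where "Z = {z' \<in> U. fst (\<psi> z') \<in> ball u0 r \<and> snd (\<psi> z') \<in> ball v0 s}"
  \<comment> \<open>Both points lie in \<open>Z0\<close> on the same plaque of
    \<open>\<psi>\<close>, so replacing the leaf coordinate by \<open>u0\<close> leaves the value of
    \<open>snd \<circ> \<theta>\<close> unchanged.\<close>
  have coord: "snd (\<theta> z') = snd (G (u0, snd (\<psi> z')))" if "z' \<in> Z" for z'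
  proof -
    have z': "z' \<in> U" "fst (\<psi> z') \<in> ball u0 r" "snd (\<psi> z') \<in> ball v0 s"
      using that by (auto simp: Z_def)
    have u0: "u0 \<in> ball u0 r" using r by simp
    have "z' \<in> Z0" using inZ0(1)[OF z'(2,3)] fol_inv[OF U z'(1)] by simp
    moreover have "snd (\<psi> (inv_into U \<psi> (u0, snd (\<psi> z')))) = snd (\<psi> z')"
      using fol_inv_mem(2)[OF U inZ0(2)[OF u0 z'(3)]] by simp
    ultimately show ?thesis
      using Z0(4) inZ0(1)[OF u0 z'(3)] unfolding G_def by (metis comp_apply)
  qed
  have "openin N Z" unfolding Z_def by (rule fol_product_open[OF U]) auto
  moreover have "z \<in> Z" using z r(1) s by (simp add: Z_def u0_def v0_def)
  moreover have "norm (snd (\<theta> z1) - snd (\<theta> z2)) \<le> C * norm (snd (\<psi> z1) - snd (\<psi> z2))"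
    if "z1 \<in> Z" "z2 \<in> Z" for z1 z2
    unfolding coord[OF that(1)] coord[OF that(2)] using that by (intro G) (auto simp: Z_def)
  moreover have "0 \<le> C" by (simp add: C_def)
  ultimately show ?thesis unfolding germ_lipschitz_def by blast
qed

end


section \<open>Embedded matchbox manifolds\<close>

locale embedded_matchbox = matchbox M X A + fol: c1_foliation N F
  for M :: "'a topology" and X :: "'t topology" and A :: "('a, 'e::euclidean_space, 't) chart_family"
    and N :: "'m topology" and F :: "('m set \<times> ('m \<Rightarrow> 'g::euclidean_space \<times> 'f::euclidean_space)) set" +
  fixes S :: "'m set" and f :: "'a \<Rightarrow> 'm"
  assumes invariant: "invariant_subset F S"
    and homeo: "homeomorphic_map M (subtopology N S) f"
begin

abbreviation img :: "'a \<Rightarrow> 'e \<Rightarrow> 't \<Rightarrow> 'm" where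
  "img x u w \<equiv> f (chart_point A x (u, w))"

abbreviation coord :: "('m \<Rightarrow> 'g \<times> 'f) \<Rightarrow> 'a \<Rightarrow> 'e \<Rightarrow> 't \<Rightarrow> 'f" where
  "coord \<psi> x u w \<equiv> snd (\<psi> (img x u w))"

lemma topspace_S: "topspace (subtopology N S) = S"
proof -
  have "\<Union>(leaves F) \<subseteq> topspace (fine_topology F)"
    unfolding leaves_def by (simp add: Union_connected_components_of)
  then show ?thesis
    using invariant unfolding invariant_subset_def fol.topspace_fine by auto
qed

lemma f_continuous: "continuous_map M N f"
  using homeomorphic_imp_continuous_map[OF homeo] by (simp add: continuous_map_in_subtopology)

lemma f_mem: "z \<in> topspace M \<Longrightarrow> f z \<in> S"
  using homeomorphic_imp_surjective_map[OF homeo] unfolding topspace_S by blast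

definition f_inv :: "'m \<Rightarrow> 'a" where "f_inv = inv_into (topspace M) f"

lemma f_inv_continuous: "continuous_map (subtopology N S) M f_inv"
  unfolding f_inv_def by (rule homeomorphic_map_inv_into[OF homeo])

lemma f_inv_f: "z \<in> topspace M \<Longrightarrow> f_inv (f z) = z"
  unfolding f_inv_def using homeomorphic_imp_injective_map[OF homeo] by (rule inv_into_f_f)

lemma f_f_inv: "s \<in> S \<Longrightarrow> f (f_inv s) = s"
  unfolding f_inv_def using homeomorphic_imp_surjective_map[OF homeo] unfolding topspace_S
  by (intro f_inv_into_f) simp

lemma preimage_open: "openin N W \<Longrightarrow> openin M {z \<in> topspace M. f z \<in> W}"
  using f_continuous by (rule openin_continuous_map_preimage)

text \<open>An open set of \<open>M\<close> corresponds to a set that is open only relative to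
  \<open>S\<close>, so the product neighbourhood in \<open>N\<close> controls \<open>f_inv\<close>
  only at its points in \<open>S\<close>.\<close>

lemma f_inv_local:
  assumes "openin M W" "z \<in> W" "(U, \<psi>) \<in> F" "f z \<in> U"
  obtains r where "r > 0" "ball (fst (\<psi> (f z))) r \<subseteq> fol.leaf_box" "ball (snd (\<psi> (f z))) r \<subseteq> fol.transverse_box"
    "\<And>u v. u \<in> ball (fst (\<psi> (f z))) r \<Longrightarrow> v \<in> ball (snd (\<psi> (f z))) r \<Longrightarrow> inv_into U \<psi> (u, v) \<in> S \<Longrightarrow>
      f_inv (inv_into U \<psi> (u, v)) \<in> W"
proof -
  have zM: "z \<in> topspace M" using assms(1,2) openin_subset by blast
  have "openin (subtopology N S) {s \<in> topspace (subtopology N S). f_inv s \<in> W}"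
    using f_inv_continuous assms(1) by (rule openin_continuous_map_preimage)
  then obtain G where G: "openin N G" "{s \<in> S. f_inv s \<in> W} = G \<inter> S"
    unfolding topspace_S openin_subtopology by blast
  have "f z \<in> {s \<in> S. f_inv s \<in> W}" using f_mem[OF zM] f_inv_f[OF zM] assms(2) by simp
  then have "f z \<in> G" using G(2) by blast
  obtain r where r: "r > 0" "ball (fst (\<psi> (f z))) r \<subseteq> fol.leaf_box" "ball (snd (\<psi> (f z))) r \<subseteq> fol.transverse_box"
    "\<And>u v. u \<in> ball (fst (\<psi> (f z))) r \<Longrightarrow> v \<in> ball (snd (\<psi> (f z))) r \<Longrightarrow> inv_into U \<psi> (u, v) \<in> G"
    using fol.fol_local[OF assms(3,4) G(1) \<open>f z \<in> G\<close>] by metis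
  have "f_inv (inv_into U \<psi> (u, v)) \<in> W"
    if "u \<in> ball (fst (\<psi> (f z))) r" "v \<in> ball (snd (\<psi> (f z))) r" "inv_into U \<psi> (u, v) \<in> S" for u v
  proof -
    have "inv_into U \<psi> (u, v) \<in> G \<inter> S" using r(4)[OF that(1,2)] that(3) by simp
    then show ?thesis unfolding G(2)[symmetric] by simp
  qed
  then show thesis using that[OF r(1-3)] by blast
qed

text \<open>A plaque lies in a single leaf and \<open>S\<close> is a union of leaves. Whole plaques
  through image points can therefore be pulled back to \<open>M\<close>.\<close>

lemma plaque_in_S:
  assumes "(U, \<psi>) \<in> F" "z \<in> topspace M" "f z \<in> U" "u \<in> fol.leaf_box"
  shows "inv_into U \<psi> (u, snd (\<psi> (f z))) \<in> S"
proof -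
  have "snd (\<psi> (f z)) \<in> fol.transverse_box" using fol.fol_mem[OF assms(1,3)] by auto
  then have p: "(u, snd (\<psi> (f z))) \<in> fol.leaf_box \<times> fol.transverse_box" using assms(4) by simp
  show ?thesis
    by (rule fol.invariant_subset_plaque[OF invariant assms(1) f_mem[OF assms(2)] assms(3)])
      (simp_all add: fol.fol_inv_mem[OF assms(1) p])
qed

lemma f_inv_plaque_continuous:
  assumes U: "(U, \<psi>) \<in> F" and z: "z \<in> topspace M" "f z \<in> U" and B: "B \<subseteq> fol.leaf_box"
  shows "continuous_map (top_of_set B) M (\<lambda>u. f_inv (inv_into U \<psi> (u, snd (\<psi> (f z)))))"
proof -
  have v: "snd (\<psi> (f z)) \<in> fol.transverse_box" using fol.fol_mem[OF U z(2)] by auto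
  have "continuous_map (top_of_set B) (subtopology N S) (\<lambda>u. inv_into U \<psi> (u, snd (\<psi> (f z))))"
    unfolding continuous_map_in_subtopology
    using fol.fol_plaque_continuous[OF U v B] plaque_in_S[OF U z] B by auto
  then show ?thesis
    using continuous_map_compose[OF _ f_inv_continuous, unfolded o_def] by blast
qed

lemma f_inv_plaque_transv:
  assumes x: "x \<in> topspace M" and U: "(U, \<psi>) \<in> F" and B: "connected B" "B \<subseteq> fol.leaf_box"
    and z: "z \<in> topspace M" "f z \<in> U"
    and W: "\<And>u. u \<in> B \<Longrightarrow> f_inv (inv_into U \<psi> (u, snd (\<psi> (f z)))) \<in> hat_nbhd A x"
    and "a \<in> B" "b \<in> B"
  shows "snd (chart A x (f_inv (inv_into U \<psi> (a, snd (\<psi> (f z)))))) =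
    snd (chart A x (f_inv (inv_into U \<psi> (b, snd (\<psi> (f z))))))"
proof (rule transv_constant[OF x, of "top_of_set B" "\<lambda>u. f_inv (inv_into U \<psi> (u, snd (\<psi> (f z))))"])
  show "connected_space (top_of_set B)"
    using B(1) by (simp add: connected_space_subtopology)
  show "continuous_map (top_of_set B) M (\<lambda>u. f_inv (inv_into U \<psi> (u, snd (\<psi> (f z)))))"
    by (rule f_inv_plaque_continuous[OF U z B(2)])
qed (use assms in auto)

text \<open>Two nearby centres with equal coordinate lie on one small plaque of \<open>F\<close>.
  Its pullback is connected and stays in one chart domain, hence in one plaque of the matchbox
  manifold, so the two transversal points coincide. The argument works for any leaf dimension of
  \<open>F\<close>.\<close>

lemma transverse_coordinate_injective:
  assumes x: "x \<in> topspace M" and w0: "w0 \<in> transv A x" and U: "(U, \<psi>) \<in> F"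
    and fU: "img x 0 w0 \<in> U"
  obtains G where "openin X G" "w0 \<in> G" "G \<subseteq> transv A x"
    "\<And>w. w \<in> G \<Longrightarrow> img x 0 w \<in> U"
    "\<And>w w'. w \<in> G \<Longrightarrow> w' \<in> G \<Longrightarrow> coord \<psi> x 0 w = coord \<psi> x 0 w' \<Longrightarrow> w = w'"
proof -
  define p where "p w = chart_point A x (0, w)" for w
  have zero: "0 \<in> big_box" using zero_in_unit_box unit_box_subset by blast
  have p: "p w \<in> hat_nbhd A x" "chart A x (p w) = (0, w)" "p w \<in> topspace M" if "w \<in> transv A x" for w
    using chart_point_mem[OF x zero that] openin_subset[OF hat_open[OF x]] by (auto simp: p_def)
  have fU': "f (p w0) \<in> U" using fU by (simp add: p_def)
  define u0 v0 where "u0 = fst (\<psi> (f (p w0)))" and "v0 = snd (\<psi> (f (p w0)))"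
  obtain r where r: "r > 0" "ball u0 r \<subseteq> fol.leaf_box" "ball v0 r \<subseteq> fol.transverse_box"
    "\<And>u v. u \<in> ball u0 r \<Longrightarrow> v \<in> ball v0 r \<Longrightarrow> inv_into U \<psi> (u, v) \<in> S \<Longrightarrow>
      f_inv (inv_into U \<psi> (u, v)) \<in> hat_nbhd A x"
    using f_inv_local[OF hat_open[OF x] p(1)[OF w0] U fU'] unfolding u0_def v0_def by metis
  define Q where "Q = {z' \<in> U. fst (\<psi> z') \<in> ball u0 r \<and> snd (\<psi> z') \<in> ball v0 r}"
  have "openin N Q" unfolding Q_def by (rule fol.fol_product_open[OF U]) auto
  then have 1: "openin M {z \<in> topspace M. f z \<in> Q}" by (rule preimage_open)
  have 2: "chart_point A x (0, w0) \<in> {z \<in> topspace M. f z \<in> Q}"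
    using fU' p[OF w0] r(1) by (simp add: Q_def u0_def v0_def p_def)
  obtain r' G where G: "r' > 0" "ball 0 r' \<subseteq> big_box" "openin X G" "w0 \<in> G" "G \<subseteq> transv A x"
    "\<And>u' w'. u' \<in> ball 0 r' \<Longrightarrow> w' \<in> G \<Longrightarrow> chart_point A x (u', w') \<in> {z \<in> topspace M. f z \<in> Q}"
    by (rule chart_point_local[OF x zero w0 1 2], rule that)
  have Q: "f (p w) \<in> Q" if "w \<in> G" for w
    using G(6)[of 0 w] G(1) that by (simp add: p_def)
  show thesis
  proof (rule that[OF G(3-5)])
    fix w assume "w \<in> G"
    then show "img x 0 w \<in> U" using Q by (auto simp: Q_def p_def)
  next
    fix w w' assume w: "w \<in> G" "w' \<in> G"
      and "coord \<psi> x 0 w = coord \<psi> x 0 w'"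
    then have eq: "snd (\<psi> (f (p w))) = snd (\<psi> (f (p w')))" by (simp add: p_def)
    have wt: "w \<in> transv A x" "w' \<in> transv A x" using w G(5) by auto
    have qU: "f (p w) \<in> U" "fst (\<psi> (f (p w))) \<in> ball u0 r" "snd (\<psi> (f (p w))) \<in> ball v0 r"
      "f (p w') \<in> U" "fst (\<psi> (f (p w'))) \<in> ball u0 r"
      using Q[OF w(1)] Q[OF w(2)] by (auto simp: Q_def)
    have "snd (chart A x (f_inv (inv_into U \<psi> (fst (\<psi> (f (p w))), snd (\<psi> (f (p w))))))) =
      snd (chart A x (f_inv (inv_into U \<psi> (fst (\<psi> (f (p w'))), snd (\<psi> (f (p w)))))))"
    proof (rule f_inv_plaque_transv[OF x U _ r(2) p(3)[OF wt(1)] qU(1)])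
      fix u assume u: "u \<in> ball u0 r"
      then show "f_inv (inv_into U \<psi> (u, snd (\<psi> (f (p w))))) \<in> hat_nbhd A x"
        using r(2) by (intro r(4) plaque_in_S[OF U p(3)[OF wt(1)] qU(1)] qU) auto
    qed (use qU in auto)
    moreover have "f_inv (inv_into U \<psi> (fst (\<psi> (f (p w))), snd (\<psi> (f (p w))))) = p w"
      using fol.fol_inv[OF U qU(1)] f_inv_f[OF p(3)[OF wt(1)]] by simp
    moreover have "f_inv (inv_into U \<psi> (fst (\<psi> (f (p w'))), snd (\<psi> (f (p w))))) = p w'"
      unfolding eq using fol.fol_inv[OF U qU(4)] f_inv_f[OF p(3)[OF wt(2)]] by simp
    ultimately show "w = w'" using p(2)[OF wt(1)] p(2)[OF wt(2)] by simp
  qed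
qed

section \<open>Plaques of the matchbox manifold go to plaques of the foliation\<close>

text \<open>The opposite direction is \<open>f_inv_plaque_transv\<close>. This one can fail when
  leaves of \<open>F\<close> have smaller dimension, as for a surface foliated by curves, so it is
  derived below from two alternative assumptions.\<close>

definition plaques_to_plaques :: bool where
  "plaques_to_plaques \<longleftrightarrow> (\<forall>x\<in>topspace M. \<forall>w\<in>transv A x. \<forall>B. \<forall>(U, \<psi>)\<in>F.
     open B \<longrightarrow> connected B \<longrightarrow> B \<subseteq> unit_box \<longrightarrow> (\<forall>u\<in>B. img x u w \<in> U) \<longrightarrow>
     (\<forall>u\<in>B. \<forall>u'\<in>B. coord \<psi> x u w = coord \<psi> x u' w))"

text \<open>A plaque of the foliation lying in the image is carried back into a plaque of the matchbox
  manifold, because the transversal of the latter is totally disconnected. By invariance of domain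
  its image is open there, so that the transverse coordinate is locally constant on plaques.\<close>

lemma plaques_to_plaques_if_same_dimension:
  assumes "DIM('g) = DIM('e)"
  shows plaques_to_plaques
  unfolding plaques_to_plaques_def
proof (intro ballI allI, clarify)
  fix x w B U \<psi> a b
  assume x: "x \<in> topspace M" and w: "w \<in> transv A x" and U: "(U, \<psi>) \<in> F"
    and B: "open B" "connected B" "B \<subseteq> unit_box" "\<forall>u\<in>B. img x u w \<in> U"
    and ab: "a \<in> B" "b \<in> B"
  define k where "k u = coord \<psi> x u w" for u
  have Bb: "u \<in> big_box" if "u \<in> B" for u using that B(3) unit_box_subset by blast
  have "k constant_on B"
  proof (rule locally_constant_imp_constant[OF B(2)])
    fix u assume u: "u \<in> B"
    define z where "z = chart_point A x (u, w)"
    have z: "z \<in> hat_nbhd A x" "chart A x z = (u, w)" "f z \<in> U"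
      using chart_point_mem[OF x Bb[OF u] w] B(4) u by (auto simp: z_def)
    then have zM: "z \<in> topspace M" using openin_subset[OF hat_open[OF x]] by blast
    define u0 v where "u0 = fst (\<psi> (f z))" and "v = snd (\<psi> (f z))"
    obtain r where r: "r > 0" "ball u0 r \<subseteq> fol.leaf_box" "ball v r \<subseteq> fol.transverse_box"
      "\<And>a v'. a \<in> ball u0 r \<Longrightarrow> v' \<in> ball v r \<Longrightarrow> inv_into U \<psi> (a, v') \<in> S \<Longrightarrow>
        f_inv (inv_into U \<psi> (a, v')) \<in> hat_nbhd A x"
      using f_inv_local[OF hat_open[OF x] z(1) U z(3)] unfolding u0_def v_def by metis
    define \<gamma> where "\<gamma> a = f_inv (inv_into U \<psi> (a, v))" for a
    have inS: "inv_into U \<psi> (a, v) \<in> S" if "a \<in> ball u0 r" for a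
      using plaque_in_S[OF U zM z(3)] r(2) that by (auto simp: v_def)
    have \<gamma>hat: "\<gamma> a \<in> hat_nbhd A x" if "a \<in> ball u0 r" for a
      using r(4)[OF that _ inS[OF that]] r(1) by (simp add: \<gamma>_def)
    have \<gamma>0: "\<gamma> u0 = z"
      using fol.fol_inv[OF U z(3)] f_inv_f[OF zM] by (simp add: \<gamma>_def u0_def v_def)
    have \<gamma>w: "snd (chart A x (\<gamma> a)) = w" if "a \<in> ball u0 r" for a
    proof -
      have "snd (chart A x (\<gamma> a)) = snd (chart A x (\<gamma> u0))"
        using f_inv_plaque_transv[OF x U _ r(2) zM z(3), of a u0] \<gamma>hat that r(1)
        unfolding \<gamma>_def v_def by simp
      then show ?thesis using \<gamma>0 z(2) by simp
    qed
    \<comment> \<open>The passage from leaf coordinates of \<open>F\<close> at height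
      \<open>v\<close> to leaf coordinates of \<open>M\<close> at \<open>w\<close>: a continuous
      injection between Euclidean spaces of equal dimension.\<close>
    define h where "h a = fst (chart A x (\<gamma> a))" for a
    have f\<gamma>: "f (\<gamma> a) = inv_into U \<psi> (a, v)" if "a \<in> ball u0 r" for a
      using f_f_inv[OF inS[OF that]] by (simp add: \<gamma>_def)
    have \<psi>\<gamma>: "\<psi> (f (\<gamma> a)) = (a, v)" if "a \<in> ball u0 r" for a
      unfolding f\<gamma>[OF that] by (rule fol.fol_inv_mem(2)[OF U]) (use that r in auto)
    have cp: "chart_point A x (h a, w) = \<gamma> a" if "a \<in> ball u0 r" for a
      using chart_point_chart[OF x \<gamma>hat[OF that]] \<gamma>w[OF that] by (metis h_def prod.collapse)
    have "continuous_map (top_of_set (ball u0 r)) (subtopology M (hat_nbhd A x)) \<gamma>"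
      using f_inv_plaque_continuous[OF U zM z(3) r(2)] \<gamma>hat
      unfolding continuous_map_in_subtopology \<gamma>_def v_def by auto
    then have "continuous_map (top_of_set (ball u0 r)) euclidean h"
      using continuous_map_compose[OF _ chart_continuous(1)[OF x], unfolded o_def] unfolding h_def by blast
    then have "continuous_on (ball u0 r) h" by simp
    moreover have "inj_on h (ball u0 r)"
    proof (rule inj_onI)
      fix a a' assume "a \<in> ball u0 r" "a' \<in> ball u0 r" "h a = h a'"
      then have "(a, v) = (a', v)" using cp \<psi>\<gamma> by metis
      then show "a = a'" by simp
    qed
    ultimately have "open (h ` ball u0 r)"
      using assms by (intro invariance_of_domain_gen) auto
    then have "openin (top_of_set B) (B \<inter> h ` ball u0 r)" by (rule openin_open_Int)
    moreover have "u \<in> h ` ball u0 r"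
      using \<gamma>0 z(2) r(1) by (intro image_eqI[of _ _ u0]) (auto simp: h_def)
    moreover have "k u' = k u" if "u' \<in> B \<inter> h ` ball u0 r" for u'
    proof -
      obtain a where "a \<in> ball u0 r" "u' = h a" using \<open>u' \<in> B \<inter> h ` ball u0 r\<close> by blast
      then have "k u' = v" using cp \<psi>\<gamma> by (simp add: k_def)
      then show ?thesis by (simp add: k_def v_def z_def)
    qed
    ultimately show "\<exists>T. openin (top_of_set B) T \<and> u \<in> T \<and> (\<forall>u'\<in>T. k u' = k u)"
      using u by blast
  qed
  then have "k a = k b" using ab unfolding constant_on_def by metis
  then show "coord \<psi> x a w = coord \<psi> x b w"
    by (simp add: k_def)
qed

text \<open>A connected piece of a plaque is sent into one leaf of \<open>F\<close>, where the
  transverse coordinate takes only countably many values. A countable connected image in a Euclidean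
  space is a single point, so no comparison of dimensions enters.\<close>

lemma plaques_to_plaques_if_leaves_to_leaves:
  assumes "\<And>L. L \<in> leaves (foliation_charts M A) \<Longrightarrow> f ` L \<in> leaves F"
  shows plaques_to_plaques
  unfolding plaques_to_plaques_def
proof (intro ballI allI, clarify)
  fix x w B U \<psi> a b
  assume x: "x \<in> topspace M" and w: "w \<in> transv A x" and U: "(U, \<psi>) \<in> F"
    and B: "open B" "connected B" "B \<subseteq> unit_box" "\<forall>u\<in>B. img x u w \<in> U"
    and ab: "a \<in> B" "b \<in> B"
  define p where "p u = chart_point A x (u, w)" for u
  have Fx: "(chart_nbhd A x, chart A x) \<in> foliation_charts M A"
    using x by (auto simp: foliation_charts_def)
  have p: "p u \<in> chart_nbhd A x" "snd (chart A x (p u)) = w" if "u \<in> unit_box" for u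
    using chart_point_nbhd[OF x that w] chart_point_mem(2)[OF x _ w] that unit_box_subset
    by (auto simp: p_def)
  have pM: "p a \<in> topspace M"
    using p(1)[of a] ab B(3) openin_subset[OF chart_nbhd_open[OF x]] by blast
  define L where "L = connected_component_of_set (fine_topology (foliation_charts M A)) (p a)"
  have L: "L \<in> leaves (foliation_charts M A)" "p a \<in> L"
    using pM unfolding L_def leaves_def connected_components_of_def topspace_fine[symmetric]
    by (auto simp: connected_component_of_refl)
  have pL: "p u \<in> L" if "u \<in> B" for u
    using leaf_plaque[OF L(1) Fx L(2)] p[of a] p[of u] that ab(1) B(3) by (metis subsetD)
  have "second_countable N" using fol.foliation by (simp add: C1_foliation_def)
  then have cnt: "countable ((\<lambda>z. snd (\<psi> z)) ` (f ` L \<inter> U))"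
    using fol.countable_plaques_in_leaf[OF _ assms[OF L(1)] U] by blast
  define k where "k u = snd (\<psi> (f (p u)))" for u
  have "k ` B \<subseteq> (\<lambda>z. snd (\<psi> z)) ` (f ` L \<inter> U)"
    using pL B(4) by (auto simp: k_def p_def)
  then have "countable (k ` B)" using cnt countable_subset by blast
  have "continuous_map (top_of_set B) M p"
    unfolding p_def using plaque_continuous[OF x w] B(3) unit_box_subset by blast
  then have "continuous_map (top_of_set B) N (\<lambda>u. f (p u))"
    using continuous_map_compose[OF _ f_continuous, unfolded o_def] by blast
  then have "continuous_map (top_of_set B) (subtopology N U) (\<lambda>u. f (p u))"
    using B(4) by (auto simp: continuous_map_in_subtopology p_def)
  then have "continuous_map (top_of_set B) euclidean k"
    using continuous_map_compose[OF _ fol.fol_snd_continuous[OF U], unfolded o_def] unfolding k_def by blast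
  then have "continuous_on B k" by simp
  then have "connected (k ` B)" using B(2) by (rule connected_continuous_image)
  then have "k a = k b"
    using connected_uncountable[of "k ` B" "k a" "k b"] ab \<open>countable (k ` B)\<close> by auto
  then show "coord \<psi> x a w = coord \<psi> x b w"
    by (simp add: k_def p_def)
qed

end


section \<open>Lipschitz holonomy\<close>

lemma germ_lipschitz_trans:
  assumes "germ_lipschitz T w \<alpha> \<beta>" "germ_lipschitz T w \<beta> \<gamma>"
  shows "germ_lipschitz T w \<alpha> \<gamma>"
proof -
  obtain G C where G: "openin T G" "w \<in> G" "0 \<le> C"
    "\<And>a b. a \<in> G \<Longrightarrow> b \<in> G \<Longrightarrow> norm (\<beta> a - \<beta> b) \<le> C * norm (\<alpha> a - \<alpha> b)"
    using assms(1) unfolding germ_lipschitz_def by blast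
  obtain H D where H: "openin T H" "w \<in> H" "0 \<le> D"
    "\<And>a b. a \<in> H \<Longrightarrow> b \<in> H \<Longrightarrow> norm (\<gamma> a - \<gamma> b) \<le> D * norm (\<beta> a - \<beta> b)"
    using assms(2) unfolding germ_lipschitz_def by blast
  have "norm (\<gamma> a - \<gamma> b) \<le> (D * C) * norm (\<alpha> a - \<alpha> b)" if "a \<in> G \<inter> H" "b \<in> G \<inter> H" for a b
  proof -
    have "norm (\<gamma> a - \<gamma> b) \<le> D * norm (\<beta> a - \<beta> b)" using H that by blast
    also have "\<dots> \<le> D * (C * norm (\<alpha> a - \<alpha> b))" using G that H(3) by (intro mult_left_mono) blast+
    finally show ?thesis by (simp add: mult.assoc)
  qed
  moreover have "openin T (G \<inter> H)" "w \<in> G \<inter> H" "0 \<le> D * C" using G H by auto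
  ultimately show ?thesis unfolding germ_lipschitz_def by blast
qed

lemma germ_lipschitz_local_eq:
  assumes "openin T G" "w \<in> G" "\<And>a. a \<in> G \<Longrightarrow> \<alpha> a = \<beta> a"
  shows "germ_lipschitz T w \<alpha> \<beta>"
  unfolding germ_lipschitz_def using assms by (intro exI[of _ G] exI[of _ 1]) auto

lemma germ_lipschitz_pullback:
  assumes "germ_lipschitz T' (q w) \<alpha> \<beta>" "openin T D" "w \<in> D" "continuous_map (subtopology T D) T' q"
  shows "germ_lipschitz T w (\<lambda>a. \<alpha> (q a)) (\<lambda>a. \<beta> (q a))"
proof -
  obtain G C where G: "openin T' G" "q w \<in> G" "0 \<le> C"
    "\<And>a b. a \<in> G \<Longrightarrow> b \<in> G \<Longrightarrow> norm (\<beta> a - \<beta> b) \<le> C * norm (\<alpha> a - \<alpha> b)"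
    using assms(1) unfolding germ_lipschitz_def by blast
  have "openin (subtopology T D) {a \<in> topspace (subtopology T D). q a \<in> G}"
    using assms(4) G(1) by (rule openin_continuous_map_preimage)
  moreover have "topspace (subtopology T D) = D" using openin_subset[OF assms(2)] by auto
  ultimately have "openin T {a \<in> D. q a \<in> G}" using assms(2) openin_trans_full by metis
  then show ?thesis
    unfolding germ_lipschitz_def using G assms(3)
    by (intro exI[of _ "{a \<in> D. q a \<in> G}"] exI[of _ C]) auto
qed

context embedded_matchbox
begin

abbreviation transv_top :: "'a \<Rightarrow> 't topology" where
  "transv_top x \<equiv> subtopology X (transv A x)"

lemma f_chart: "z \<in> topspace M \<Longrightarrow> \<exists>U \<psi>. (U, \<psi>) \<in> F \<and> f z \<in> U"
  using fol.chart_cover continuous_map_image_subset_topspace[OF f_continuous] by blast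

lemma chart_point_topspace:
  "x \<in> topspace M \<Longrightarrow> u \<in> unit_box \<Longrightarrow> w \<in> transv A x \<Longrightarrow> chart_point A x (u, w) \<in> topspace M"
  using chart_point_nbhd openin_subset[OF chart_nbhd_open] by blast

lemma transversal_continuous:
  assumes x: "x \<in> topspace M" and u: "u \<in> unit_box"
  shows "continuous_map (transv_top x) M (\<lambda>w. chart_point A x (u, w))"
proof -
  have "continuous_map (transv_top x) (prod_topology (top_of_set big_box) (transv_top x)) (\<lambda>w. (u, w))"
    using u unit_box_subset by (auto simp: continuous_map_pairwise o_def continuous_map_in_subtopology)
  then show ?thesis
    using continuous_map_compose[OF _ chart_point_continuous[OF x], unfolded o_def] by blast
qed

lemma coord_chart_change:
  assumes x: "x \<in> topspace M" and w: "w \<in> transv A x" and u: "u \<in> unit_box"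
    and U: "(U, \<psi>) \<in> F" "img x u w \<in> U"
    and V: "(V, \<theta>) \<in> F" "img x u w \<in> V"
  shows "germ_lipschitz (transv_top x) w (coord \<psi> x u) (coord \<theta> x u)"
proof (rule germ_lipschitz_pullback[where D = "topspace (transv_top x)"])
  show "germ_lipschitz N (img x u w) (\<lambda>z. snd (\<psi> z)) (\<lambda>z. snd (\<theta> z))"
    by (rule fol.chart_change_lipschitz[OF U(1) V(1) U(2) V(2)])
  show "w \<in> topspace (transv_top x)" using w transv_subset[OF x] by auto
  show "continuous_map (subtopology (transv_top x) (topspace (transv_top x))) N
      (\<lambda>w. img x u w)"
    using continuous_map_compose[OF transversal_continuous[OF x u] f_continuous, unfolded o_def]
    by (simp only: subtopology_topspace)
qed (rule openin_topspace)

abbreviation FT :: "('a \<times> 't) topology" where "FT \<equiv> full_transversal M X A"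

section \<open>Lipschitz germs on the full transversal\<close>

definition center :: "'a \<times> 't \<Rightarrow> 'm" where "center p = f (chart_point A (fst p) (0, snd p))"

lemma center_topspace: "p \<in> topspace FT \<Longrightarrow> chart_point A (fst p) (0, snd p) \<in> topspace M"
  using chart_point_topspace zero_in_unit_box by (auto simp: topspace_full_transversal)

lemma center_open:
  assumes "openin N W"
  shows "openin FT {p \<in> topspace FT. center p \<in> W}"
  unfolding openin_full_transversal
proof (intro conjI ballI)
  fix x assume x: "x \<in> topspace M"
  have "openin (transv_top x) {w \<in> topspace (transv_top x). img x 0 w \<in> W}"
    using continuous_map_compose[OF transversal_continuous[OF x zero_in_unit_box] f_continuous, unfolded o_def]
      assms by (rule openin_continuous_map_preimage)
  moreover have "topspace (transv_top x) = transv A x" using transv_subset[OF x] by auto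
  ultimately have "openin X {w \<in> transv A x. img x 0 w \<in> W}"
    using transv_open[OF x] openin_trans_full by metis
  then show "openin X {w. (x, w) \<in> {p \<in> topspace FT. center p \<in> W}}"
    using x by (simp add: topspace_full_transversal center_def)
qed (auto simp: topspace_full_transversal)

definition lipschitz_germ_at ::
    "(('a \<times> 't) \<times> ('a \<times> 't)) set \<Rightarrow> 'a \<times> 't \<Rightarrow> ('m \<Rightarrow> 'g \<times> 'f) \<Rightarrow> ('m \<Rightarrow> 'g \<times> 'f) \<Rightarrow> bool" where
  "lipschitz_germ_at q a \<psi> \<theta> \<longleftrightarrow> (\<exists>G C. openin FT G \<and> a \<in> G \<and> 0 \<le> C \<and>
     (\<forall>a1 a2 b1 b2. a1 \<in> G \<longrightarrow> a2 \<in> G \<longrightarrow> (a1, b1) \<in> q \<longrightarrow> (a2, b2) \<in> q \<longrightarrow>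
       norm (snd (\<theta> (center b1)) - snd (\<theta> (center b2))) \<le>
       C * norm (snd (\<psi> (center a1)) - snd (\<psi> (center a2)))))"

text \<open>Asking for every pair of charts around the two centres lets a composition use any chart
  at the intermediate point, and lets coordinates be chosen freely later.\<close>

definition transversally_lipschitz :: "(('a \<times> 't) \<times> ('a \<times> 't)) set \<Rightarrow> bool" where
  "transversally_lipschitz q \<longleftrightarrow> (\<forall>a b U \<psi> V \<theta>. (a, b) \<in> q \<longrightarrow> (U, \<psi>) \<in> F \<longrightarrow> (V, \<theta>) \<in> F \<longrightarrow>
     center a \<in> U \<longrightarrow> center b \<in> V \<longrightarrow> lipschitz_germ_at q a \<psi> \<theta>)"

lemma transversally_lipschitzD:
  assumes "transversally_lipschitz q" "(a, b) \<in> q" "(U, \<psi>) \<in> F" "(V, \<theta>) \<in> F" "center a \<in> U" "center b \<in> V"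
  obtains G C where "openin FT G" "a \<in> G" "0 \<le> C"
    "\<And>a1 a2 b1 b2. a1 \<in> G \<Longrightarrow> a2 \<in> G \<Longrightarrow> (a1, b1) \<in> q \<Longrightarrow> (a2, b2) \<in> q \<Longrightarrow>
       norm (snd (\<theta> (center b1)) - snd (\<theta> (center b2))) \<le>
       C * norm (snd (\<psi> (center a1)) - snd (\<psi> (center a2)))"
proof -
  have "lipschitz_germ_at q a \<psi> \<theta>"
    using assms(1)[unfolded transversally_lipschitz_def, rule_format, OF assms(2-6)] .
  then show thesis using that unfolding lipschitz_germ_at_def by (elim exE conjE) blast
qed

lemma transversally_lipschitz_Id_on: "transversally_lipschitz (Id_on G)" if "openin FT G"
  unfolding transversally_lipschitz_def
proof (intro allI impI)
  fix a b U \<psi> V \<theta>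
  assume *: "(a, b) \<in> Id_on G" "(U, \<psi>) \<in> F" "(V, \<theta>) \<in> F" "center a \<in> U" "center b \<in> V"
  then have ab: "a = b" "a \<in> topspace FT" using openin_subset[OF \<open>openin FT G\<close>] by auto
  then obtain H C where H: "openin N H" "center a \<in> H" "0 \<le> C"
    "\<And>y z. y \<in> H \<Longrightarrow> z \<in> H \<Longrightarrow> norm (snd (\<theta> y) - snd (\<theta> z)) \<le> C * norm (snd (\<psi> y) - snd (\<psi> z))"
    using fol.chart_change_lipschitz[OF *(2,3,4)] *(5) unfolding germ_lipschitz_def by blast
  show "lipschitz_germ_at (Id_on G) a \<psi> \<theta>"
    unfolding lipschitz_germ_at_def using center_open[OF H(1)] H ab by (intro exI[of _ "{p \<in> topspace FT. center p \<in> H}"] exI[of _ C]) auto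
qed

lemma transversally_lipschitz_comp:
  assumes q: "transversally_lipschitz q" "q \<in> local_homeos FT FT"
    and s: "transversally_lipschitz s" "s \<in> local_homeos FT FT"
  shows "transversally_lipschitz (q O s)"
  unfolding transversally_lipschitz_def
proof (intro allI impI)
  fix a c U \<psi> V \<theta>
  assume *: "(a, c) \<in> q O s" "(U, \<psi>) \<in> F" "(V, \<theta>) \<in> F" "center a \<in> U" "center c \<in> V"
  then obtain b where b: "(a, b) \<in> q" "(b, c) \<in> s" by blast
  have "b \<in> topspace FT" using local_homeos_topspace[OF q(2) b(1)] by simp
  then obtain W \<zeta> where W: "(W, \<zeta>) \<in> F" "center b \<in> W"
    using f_chart[OF center_topspace] unfolding center_def by blast
  obtain G C where G: "openin FT G" "a \<in> G" "0 \<le> C"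
    "\<And>a1 a2 b1 b2. a1 \<in> G \<Longrightarrow> a2 \<in> G \<Longrightarrow> (a1, b1) \<in> q \<Longrightarrow> (a2, b2) \<in> q \<Longrightarrow>
       norm (snd (\<zeta> (center b1)) - snd (\<zeta> (center b2))) \<le>
       C * norm (snd (\<psi> (center a1)) - snd (\<psi> (center a2)))"
    by (rule transversally_lipschitzD[OF q(1) b(1) *(2) W(1) *(4) W(2)], rule that)
  obtain H D where H: "openin FT H" "b \<in> H" "0 \<le> D"
    "\<And>a1 a2 b1 b2. a1 \<in> H \<Longrightarrow> a2 \<in> H \<Longrightarrow> (a1, b1) \<in> s \<Longrightarrow> (a2, b2) \<in> s \<Longrightarrow>
       norm (snd (\<theta> (center b1)) - snd (\<theta> (center b2))) \<le>
       D * norm (snd (\<zeta> (center a1)) - snd (\<zeta> (center a2)))"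
    by (rule transversally_lipschitzD[OF s(1) b(2) W(1) *(3) W(2) *(5)], rule that)
  \<comment> \<open>On this smaller neighbourhood the intermediate points lie in \<open>H\<close>,
    because \<open>q\<close> is single-valued.\<close>
  define G' where "G' = G \<inter> {a. \<exists>b\<in>H. (a, b) \<in> q}"
  have "openin FT G'" unfolding G'_def using G(1) local_homeos_preimage[OF q(2) H(1)] by (rule openin_Int)
  moreover have "a \<in> G'" using G(2) b(1) H(2) by (auto simp: G'_def)
  moreover have "norm (snd (\<theta> (center c1)) - snd (\<theta> (center c2))) \<le>
       (D * C) * norm (snd (\<psi> (center a1)) - snd (\<psi> (center a2)))"
    if a12: "a1 \<in> G'" "a2 \<in> G'" and c12: "(a1, c1) \<in> q O s" "(a2, c2) \<in> q O s" for a1 a2 c1 c2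
  proof -
    obtain b1 where b1: "(a1, b1) \<in> q" "(b1, c1) \<in> s" using c12(1) by blast
    obtain b2 where b2: "(a2, b2) \<in> q" "(b2, c2) \<in> s" using c12(2) by blast
    have inH: "b \<in> H" if "a \<in> G'" "(a, b) \<in> q" for a b
    proof -
      obtain b' where "b' \<in> H" "(a, b') \<in> q" using \<open>a \<in> G'\<close> unfolding G'_def by blast
      then show ?thesis using local_homeos_functional[OF q(2) \<open>(a, b) \<in> q\<close>] by blast
    qed
    have "b1 \<in> H" "b2 \<in> H" using inH a12 b1(1) b2(1) by blast+
    then have "norm (snd (\<theta> (center c1)) - snd (\<theta> (center c2))) \<le>
       D * norm (snd (\<zeta> (center b1)) - snd (\<zeta> (center b2)))"
      using H(4) b1(2) b2(2) by blast
    also have "\<dots> \<le> D * (C * norm (snd (\<psi> (center a1)) - snd (\<psi> (center a2))))"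
      using a12 b1(1) b2(1) H(3) by (intro mult_left_mono G(4)) (auto simp: G'_def)
    finally show ?thesis by (simp add: mult.assoc)
  qed
  moreover have "0 \<le> D * C" using G(3) H(3) by simp
  ultimately show "lipschitz_germ_at (q O s) a \<psi> \<theta>"
    unfolding lipschitz_germ_at_def by blast
qed

text \<open>Near a point of the domain of one member \<open>q\<close> the union coincides with
  \<open>q\<close>, because the union is single-valued and the domain of \<open>q\<close> is
  open.\<close>

lemma transversally_lipschitz_Union:
  assumes S: "\<And>q. q \<in> \<Q> \<Longrightarrow> transversally_lipschitz q \<and> q \<in> local_homeos FT FT"
    and U: "\<Union>\<Q> \<in> local_homeos FT FT"
  shows "transversally_lipschitz (\<Union>\<Q>)"
  unfolding transversally_lipschitz_def
proof (intro allI impI)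
  fix a b U \<psi> V \<theta>
  assume *: "(a, b) \<in> \<Union>\<Q>" "(U, \<psi>) \<in> F" "(V, \<theta>) \<in> F" "center a \<in> U" "center b \<in> V"
  then obtain q where q: "q \<in> \<Q>" "(a, b) \<in> q" by blast
  note Sq = S[OF q(1)]
  obtain G C where G: "openin FT G" "a \<in> G" "0 \<le> C"
    "\<And>a1 a2 b1 b2. a1 \<in> G \<Longrightarrow> a2 \<in> G \<Longrightarrow> (a1, b1) \<in> q \<Longrightarrow> (a2, b2) \<in> q \<Longrightarrow>
       norm (snd (\<theta> (center b1)) - snd (\<theta> (center b2))) \<le>
       C * norm (snd (\<psi> (center a1)) - snd (\<psi> (center a2)))"
    by (rule transversally_lipschitzD[OF conjunct1[OF Sq] q(2) *(2-5)], rule that)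
  have "openin FT (G \<inter> Domain q)"
    using G(1) local_homeos_Domain[OF conjunct2[OF Sq]] by (rule openin_Int)
  moreover have "(a1, b1) \<in> q" if "a1 \<in> G \<inter> Domain q" "(a1, b1) \<in> \<Union>\<Q>" for a1 b1
  proof -
    obtain b' where "(a1, b') \<in> q" using \<open>a1 \<in> G \<inter> Domain q\<close> by blast
    moreover from this have "(a1, b') \<in> \<Union>\<Q>" using q(1) by blast
    ultimately show ?thesis using local_homeos_functional[OF U that(2)] by blast
  qed
  ultimately show "lipschitz_germ_at (\<Union>\<Q>) a \<psi> \<theta>"
    unfolding lipschitz_germ_at_def
    using G q(2) by (intro exI[of _ "G \<inter> Domain q"] exI[of _ C] conjI allI impI) (auto intro: G(4))
qed

section \<open>Sliding along plaques and holonomy\<close>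

context
  assumes plaques: plaques_to_plaques
begin

text \<open>A single ball of leaf coordinates serves for all transverse parameters near
  \<open>w\<close>, so functions of the transverse parameter at different leaf positions agree on a
  whole neighbourhood.\<close>

lemma coord_plaque_constant:
  assumes x: "x \<in> topspace M" and w: "w \<in> transv A x" and u: "u \<in> unit_box"
    and U: "(U, \<psi>) \<in> F" "img x u w \<in> U"
  obtains r G where "r > 0" "ball u r \<subseteq> unit_box" "openin X G" "w \<in> G" "G \<subseteq> transv A x"
    "\<And>u' w'. u' \<in> ball u r \<Longrightarrow> w' \<in> G \<Longrightarrow> img x u' w' \<in> U"
    "\<And>u' w'. u' \<in> ball u r \<Longrightarrow> w' \<in> G \<Longrightarrow> coord \<psi> x u' w' = coord \<psi> x u w'"
proof -
  let ?W = "{z \<in> topspace M. f z \<in> U}"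
  have 1: "openin M ?W" using fol.fol_open[OF U(1)] by (rule preimage_open)
  have 2: "u \<in> big_box" using u unit_box_subset by blast
  have 3: "chart_point A x (u, w) \<in> ?W" using U chart_point_topspace[OF x u w] by simp
  obtain r1 G where r1: "r1 > 0" "ball u r1 \<subseteq> big_box" "openin X G" "w \<in> G" "G \<subseteq> transv A x"
    "\<And>u' w'. u' \<in> ball u r1 \<Longrightarrow> w' \<in> G \<Longrightarrow> chart_point A x (u', w') \<in> ?W"
    by (rule chart_point_local[OF x 2 w 1 3], rule that)
  obtain r2 where r2: "r2 > 0" "ball u r2 \<subseteq> unit_box"
    using u open_box open_contains_ball by metis
  define r where "r = min r1 r2"
  have r: "r > 0" "ball u r \<subseteq> unit_box" "ball u r \<subseteq> ball u r1" using r1 r2 by (auto simp: r_def)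
  have inU: "img x u' w' \<in> U" if "u' \<in> ball u r" "w' \<in> G" for u' w'
    using r1(6)[of u' w'] r(3) that by blast
  have "coord \<psi> x u' w' = coord \<psi> x u w'" if "u' \<in> ball u r" "w' \<in> G" for u' w'
  proof -
    have "w' \<in> transv A x" using that r1(5) by blast
    then have "\<forall>B. \<forall>(U, \<psi>)\<in>F. open B \<longrightarrow> connected B \<longrightarrow> B \<subseteq> unit_box \<longrightarrow>
        (\<forall>u\<in>B. img x u w' \<in> U) \<longrightarrow> (\<forall>u\<in>B. \<forall>u'\<in>B. coord \<psi> x u w' = coord \<psi> x u' w')"
      using plaques x unfolding plaques_to_plaques_def by blast
    note plaque = bspec[OF spec[OF this, of "ball u r"] U(1), unfolded prod.case]
    have "\<forall>u1\<in>ball u r. \<forall>u2\<in>ball u r. coord \<psi> x u1 w' = coord \<psi> x u2 w'"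
      by (rule mp[OF mp[OF mp[OF mp[OF plaque open_ball] connected_ball] r(2)]])
        (use inU \<open>w' \<in> G\<close> in blast)
    then show ?thesis using that(1) r(1) centre_in_ball by metis
  qed
  then show thesis using that[OF r(1,2) r1(3-5)] inU by blast
qed

text \<open>Comparability of coordinates at two leaf positions is transitive and holds on small
  balls, so it spreads over the connected unit box. The transverse neighbourhood may shrink each
  time, which germs allow.\<close>

lemma coord_plaque_transport:
  assumes x: "x \<in> topspace M" and w: "w \<in> transv A x" and u: "u \<in> unit_box" "u' \<in> unit_box"
    and U: "(U, \<psi>) \<in> F" "img x u w \<in> U"
    and V: "(V, \<theta>) \<in> F" "img x u' w \<in> V"
  shows "germ_lipschitz (transv_top x) w (coord \<psi> x u) (coord \<theta> x u')"
proof -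
  define R where "R a b \<longleftrightarrow> (\<forall>U \<psi> V \<theta>. (U, \<psi>) \<in> F \<longrightarrow> (V, \<theta>) \<in> F \<longrightarrow>
      img x a w \<in> U \<longrightarrow> img x b w \<in> V \<longrightarrow>
      germ_lipschitz (transv_top x) w (coord \<psi> x a) (coord \<theta> x b))" for a b
  \<comment> \<open>Symmetry is built in, since a Lipschitz bound in one direction gives none in the
    other.\<close>
  have "R u u' \<and> R u' u"
  proof (rule connected_equivalence_relation[OF connected_unit_box u, of "\<lambda>a b. R a b \<and> R b a"])
    have "R a c" if "R a b" "R b c" "b \<in> unit_box" for a b c
      unfolding R_def
    proof (intro allI impI)
      fix U \<psi> V \<theta>
      assume *: "(U, \<psi>) \<in> F" "(V, \<theta>) \<in> F" "img x a w \<in> U" "img x c w \<in> V"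
      obtain W \<zeta> where W: "(W, \<zeta>) \<in> F" "img x b w \<in> W"
        using f_chart[OF chart_point_topspace[OF x \<open>b \<in> unit_box\<close> w]] by blast
      have "germ_lipschitz (transv_top x) w (coord \<psi> x a) (coord \<zeta> x b)"
        using \<open>R a b\<close> * W unfolding R_def by blast
      moreover have "germ_lipschitz (transv_top x) w (coord \<zeta> x b) (coord \<theta> x c)"
        using \<open>R b c\<close> * W unfolding R_def by blast
      ultimately show "germ_lipschitz (transv_top x) w (coord \<psi> x a) (coord \<theta> x c)"
        by (rule germ_lipschitz_trans)
    qed
    then show "R a c \<and> R c a" if "R a b \<and> R b a" "R b c \<and> R c b" "b \<in> unit_box" for a b c
      using that by blast
    fix a assume a: "a \<in> unit_box"
    obtain W \<zeta> where W: "(W, \<zeta>) \<in> F" "img x a w \<in> W"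
      using f_chart[OF chart_point_topspace[OF x a w]] by blast
    obtain r G where r: "r > 0" "ball a r \<subseteq> unit_box" "openin X G" "w \<in> G" "G \<subseteq> transv A x"
      "\<And>u' w'. u' \<in> ball a r \<Longrightarrow> w' \<in> G \<Longrightarrow> img x u' w' \<in> W"
      "\<And>u' w'. u' \<in> ball a r \<Longrightarrow> w' \<in> G \<Longrightarrow> coord \<zeta> x u' w' = coord \<zeta> x a w'"
      using coord_plaque_constant[OF x w a W] by metis
    have oG: "openin (transv_top x) G"
      using r(3,5) openin_open_subtopology[OF transv_open[OF x]] by blast
    have near: "R a b \<and> R b a" if b: "b \<in> ball a r" for b
    proof -
      have bu: "b \<in> unit_box" using b r(2) by blast
      have Wb: "img x b w \<in> W" using r(6)[OF b r(4)] .
      have eq: "germ_lipschitz (transv_top x) w (coord \<zeta> x a) (coord \<zeta> x b)"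
        "germ_lipschitz (transv_top x) w (coord \<zeta> x b) (coord \<zeta> x a)"
        using oG r(4) r(7)[OF b] by (auto intro: germ_lipschitz_local_eq)
      show ?thesis
        unfolding R_def
        using germ_lipschitz_trans[OF germ_lipschitz_trans[OF coord_chart_change[OF x w a _ _ W] eq(1)]
            coord_chart_change[OF x w bu W(1) Wb]]
          germ_lipschitz_trans[OF germ_lipschitz_trans[OF coord_chart_change[OF x w bu _ _ W(1) Wb] eq(2)]
            coord_chart_change[OF x w a W]]
        by metis
    qed
    have "openin (top_of_set unit_box) (ball a r)"
      using r(2) by (simp add: open_subset)
    then show "\<exists>T. openin (top_of_set unit_box) T \<and> a \<in> T \<and> (\<forall>b\<in>T. R a b \<and> R b a)"
      using near r(1) by (intro exI[of _ "ball a r"]) auto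
  qed blast
  then show ?thesis using U V unfolding R_def by blast
qed

text \<open>Three comparisons are composed: slide from the centre of the plaque at \<open>x\<close>
  to \<open>z\<close>, pass there from the chart at \<open>x\<close> to the chart at
  \<open>y\<close>, and slide on to the centre of the plaque at \<open>y\<close>.\<close>

lemma transverse_change_lipschitz:
  assumes x: "x \<in> topspace M" and y: "y \<in> topspace M" and Z: "openin M Z" "Z \<subseteq> chart_nbhd A x \<inter> chart_nbhd A y"
    and g: "g = (\<lambda>z. ((x, snd (chart A x z)), (y, snd (chart A y z)))) ` Z" "g \<in> local_homeos FT FT"
  shows "transversally_lipschitz g"
  unfolding transversally_lipschitz_def
proof (intro allI impI)
  fix a b U \<psi> V \<theta>
  assume *: "(a, b) \<in> g" "(U, \<psi>) \<in> F" "(V, \<theta>) \<in> F" "center a \<in> U" "center b \<in> V"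
  then obtain z where z: "z \<in> Z" "a = (x, snd (chart A x z))" "b = (y, snd (chart A y z))"
    unfolding g(1) by blast
  define u w u' w' where "u = fst (chart A x z)" and "w = snd (chart A x z)"
    and "u' = fst (chart A y z)" and "w' = snd (chart A y z)"
  have zc: "z \<in> chart_nbhd A x" "z \<in> chart_nbhd A y" using z Z by auto
  have zh: "z \<in> hat_nbhd A x" "z \<in> hat_nbhd A y" using zc chart_nbhd_subset x y by blast+
  have u: "u \<in> unit_box" "u' \<in> unit_box" using zc by (auto simp: chart_nbhd_def u_def u'_def)
  have w: "w \<in> transv A x" "w' \<in> transv A y"
    using chart_mem(2)[OF x zh(1)] chart_mem(2)[OF y zh(2)] by (auto simp: w_def w'_def)
  have zx: "chart_point A x (u, w) = z" and zy: "chart_point A y (u', w') = z"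
    using chart_point_chart[OF x zh(1)] chart_point_chart[OF y zh(2)]
    by (auto simp: u_def w_def u'_def w'_def)
  have ab: "img x 0 w \<in> U" "img y 0 w' \<in> V"
    using *(4,5) by (auto simp: center_def z w_def w'_def)
  have zM: "z \<in> topspace M" using z(1) openin_subset[OF Z(1)] by blast
  obtain W \<zeta> where W: "(W, \<zeta>) \<in> F" "f z \<in> W" using f_chart[OF zM] by blast
  define \<gamma> where "\<gamma> w1 = chart_point A x (u, w1)" for w1
  \<comment> \<open>The holonomy map itself, read on the local transversal through \<open>z\<close>
    with constant leaf coordinate \<open>u\<close>.\<close>
  define \<tau> where "\<tau> w1 = snd (chart A y (\<gamma> w1))" for w1
  have \<gamma>c: "continuous_map (transv_top x) M \<gamma>"
    unfolding \<gamma>_def by (rule transversal_continuous[OF x u(1)])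
  have tx: "topspace (transv_top x) = transv A x" using transv_subset[OF x] by auto
  define D where "D = {w1 \<in> transv A x. \<gamma> w1 \<in> Z}"
  have D: "openin (transv_top x) D" "w \<in> D" "D \<subseteq> transv A x"
    using openin_continuous_map_preimage[OF \<gamma>c Z(1)] w zx z(1) unfolding tx by (auto simp: D_def \<gamma>_def)
  have \<gamma>Z: "\<gamma> w1 \<in> chart_nbhd A x" "\<gamma> w1 \<in> chart_nbhd A y" "\<gamma> w1 \<in> hat_nbhd A y" "\<gamma> w1 \<in> Z" if "w1 \<in> D" for w1
    using that Z(2) chart_nbhd_subset[OF y] by (auto simp: D_def)
  have "continuous_map (subtopology (transv_top x) D) (subtopology M (hat_nbhd A y)) \<gamma>"
    using \<gamma>c \<gamma>Z(3) by (auto simp: continuous_map_in_subtopology intro: continuous_map_from_subtopology)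
  then have fc: "continuous_map (subtopology (transv_top x) D) euclidean (\<lambda>w1. fst (chart A y (\<gamma> w1)))"
    and sc: "continuous_map (subtopology (transv_top x) D) X \<tau>"
    unfolding \<tau>_def using continuous_map_compose[OF _ chart_continuous(1)[OF y], unfolded o_def]
      continuous_map_compose[OF _ chart_continuous(2)[OF y], unfolded o_def] by blast+
  have \<tau>c: "continuous_map (subtopology (transv_top x) D) (transv_top y) \<tau>"
    using sc chart_mem(2)[OF y \<gamma>Z(3)] D(3) by (auto simp: continuous_map_in_subtopology \<tau>_def)
  have \<tau>w: "\<tau> w = w'" by (simp add: \<tau>_def \<gamma>_def zx w'_def)
  have 1: "germ_lipschitz (transv_top x) w (coord \<psi> x 0) (coord \<zeta> x u)"
    using coord_plaque_transport[OF x w(1) zero_in_unit_box u(1) *(2) ab(1) W(1)] W(2) zx by simp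
  have 3: "germ_lipschitz (transv_top x) w (\<lambda>w1. coord \<zeta> y u' (\<tau> w1)) (\<lambda>w1. coord \<theta> y 0 (\<tau> w1))"
  proof (rule germ_lipschitz_pullback[OF _ D(1,2) \<tau>c])
    show "germ_lipschitz (transv_top y) (\<tau> w) (coord \<zeta> y u') (coord \<theta> y 0)"
      unfolding \<tau>w using coord_plaque_transport[OF y w(2) u(2) zero_in_unit_box W(1) _ *(3) ab(2)] W(2) zy by simp
  qed
  obtain r G where r: "r > 0" "ball u' r \<subseteq> unit_box" "openin X G" "w' \<in> G" "G \<subseteq> transv A y"
    "\<And>u1 w1. u1 \<in> ball u' r \<Longrightarrow> w1 \<in> G \<Longrightarrow> img y u1 w1 \<in> W"
    "\<And>u1 w1. u1 \<in> ball u' r \<Longrightarrow> w1 \<in> G \<Longrightarrow> coord \<zeta> y u1 w1 = coord \<zeta> y u' w1"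
    by (rule coord_plaque_constant[OF y w(2) u(2) W(1)], simp add: zy W(2), rule that)
  have td: "topspace (subtopology (transv_top x) D) = D" using openin_subset[OF D(1)] by auto
  define E where "E = {w1 \<in> D. fst (chart A y (\<gamma> w1)) \<in> ball u' r} \<inter> {w1 \<in> D. \<tau> w1 \<in> G}"
  have "openin (subtopology (transv_top x) D) E"
    unfolding E_def
    using openin_continuous_map_preimage[OF fc, of "ball u' r", unfolded td] openin_continuous_map_preimage[OF sc r(3), unfolded td]
    by (intro openin_Int) auto
  then have E: "openin (transv_top x) E" using D(1) openin_trans_full by blast
  have wE: "w \<in> E" using D(2) r(1,4) \<tau>w by (simp add: E_def \<gamma>_def zx u'_def)
  \<comment> \<open>The leaf coordinate of \<open>\<gamma> w1\<close> in the chart at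
    \<open>y\<close> moves with \<open>w1\<close>. While it stays in the ball around
    \<open>u'\<close>, the coordinate in \<open>F\<close> does not notice, so both functions
    coincide near \<open>w\<close>.\<close>
  have 2: "germ_lipschitz (transv_top x) w (coord \<zeta> x u) (\<lambda>w1. coord \<zeta> y u' (\<tau> w1))"
  proof (rule germ_lipschitz_local_eq[OF E wE])
    fix w1 assume w1: "w1 \<in> E"
    then have "coord \<zeta> y (fst (chart A y (\<gamma> w1))) (\<tau> w1) = coord \<zeta> y u' (\<tau> w1)"
      by (intro r(7)) (auto simp: E_def)
    moreover have "chart_point A y (fst (chart A y (\<gamma> w1)), \<tau> w1) = \<gamma> w1"
      using chart_point_chart[OF y \<gamma>Z(3)] w1 by (simp add: E_def \<tau>_def)
    ultimately show "coord \<zeta> x u w1 = coord \<zeta> y u' (\<tau> w1)" by (simp add: \<gamma>_def)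
  qed
  obtain H C where H: "openin (transv_top x) H" "w \<in> H" "0 \<le> C"
    "\<And>w1 w2. w1 \<in> H \<Longrightarrow> w2 \<in> H \<Longrightarrow>
      norm (coord \<theta> y 0 (\<tau> w1) - coord \<theta> y 0 (\<tau> w2)) \<le> C * norm (coord \<psi> x 0 w1 - coord \<psi> x 0 w2)"
    using germ_lipschitz_trans[OF germ_lipschitz_trans[OF 1 2] 3] unfolding germ_lipschitz_def by blast
  define H' where "H' = {x} \<times> (H \<inter> D)"
  have "openin (transv_top x) (H \<inter> D)" using H(1) D(1) by (rule openin_Int)
  then have HD: "openin X (H \<inter> D)" "H \<inter> D \<subseteq> transv A x"
    using transv_open[OF x] openin_trans_full D(3) by blast+
  have "openin FT H'"
    unfolding H'_def by (rule openin_full_transversal_slice[OF x HD])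
  moreover have "a \<in> H'" using H(2) D(2) z(2) by (simp add: H'_def w_def)
  moreover have "norm (snd (\<theta> (center b1)) - snd (\<theta> (center b2))) \<le>
       C * norm (snd (\<psi> (center a1)) - snd (\<psi> (center a2)))"
    if "a1 \<in> H'" "a2 \<in> H'" "(a1, b1) \<in> g" "(a2, b2) \<in> g" for a1 a2 b1 b2
  proof -
    have val: "b1 = (y, \<tau> w1)" if "w1 \<in> D" "((x, w1), b1) \<in> g" for w1 b1
    proof -
      have "w1 \<in> transv A x" using that(1) D(3) by blast
      then have "snd (chart A x (\<gamma> w1)) = w1"
        using chart_point_mem(2)[OF x, of u w1] u(1) unit_box_subset by (auto simp: \<gamma>_def)
      then have "((x, w1), (y, \<tau> w1)) \<in> g"
        unfolding g(1) \<tau>_def using \<gamma>Z(4)[OF that(1)] by (intro image_eqI[of _ _ "\<gamma> w1"]) auto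
      then show ?thesis using local_homeos_functional[OF g(2) that(2)] by blast
    qed
    obtain w1 where w1: "a1 = (x, w1)" "w1 \<in> H" "w1 \<in> D" using \<open>a1 \<in> H'\<close> by (auto simp: H'_def)
    obtain w2 where w2: "a2 = (x, w2)" "w2 \<in> H" "w2 \<in> D" using \<open>a2 \<in> H'\<close> by (auto simp: H'_def)
    have "b1 = (y, \<tau> w1)" "b2 = (y, \<tau> w2)" using val w1 w2 that(3,4) by blast+
    then show ?thesis using H(4)[OF w1(2) w2(2)] by (simp add: center_def w1(1) w2(1))
  qed
  ultimately show "lipschitz_germ_at g a \<psi> \<theta>"
    using H(3) unfolding lipschitz_germ_at_def by blast
qed

text \<open>The property is not visibly closed under converses, so the pseudogroup
  \<open>\<P>\<close> requires it of a map and of its inverse; inverses of transverse changes are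
  again of the same form.\<close>

lemma holonomy_lipschitz:
  assumes "q \<in> holonomy_pseudogroup M X A"
  shows "transversally_lipschitz q"
proof -
  define \<P> where "\<P> = {q \<in> local_homeos FT FT. transversally_lipschitz q \<and> transversally_lipschitz (q\<inverse>)}"
  have "pseudogroup FT \<P>"
    unfolding pseudogroup_def
  proof (intro conjI ballI allI impI)
    show "\<P> \<subseteq> local_homeos FT FT" by (auto simp: \<P>_def)
    show "Id_on G \<in> \<P>" if "openin FT G" for G
      using local_homeos_Id_on[OF that] transversally_lipschitz_Id_on[OF that] by (simp add: \<P>_def)
    show "g\<inverse> \<in> \<P>" if "g \<in> \<P>" for g
      using that local_homeos_converse by (auto simp: \<P>_def)
    show "g O h \<in> \<P>" if "g \<in> \<P>" "h \<in> \<P>" for g h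
    proof -
      have gh: "g \<in> local_homeos FT FT" "h \<in> local_homeos FT FT"
        "g\<inverse> \<in> local_homeos FT FT" "h\<inverse> \<in> local_homeos FT FT"
        using that local_homeos_converse[of g FT FT] local_homeos_converse[of h FT FT]
        by (simp_all add: \<P>_def)
      have "transversally_lipschitz (g O h)" "transversally_lipschitz (h\<inverse> O g\<inverse>)"
        by (rule transversally_lipschitz_comp; use that gh in \<open>simp add: \<P>_def\<close>)+
      then show ?thesis
        using local_homeos_comp[OF gh(1,2)] by (simp add: \<P>_def converse_relcomp)
    qed
    show "\<Union>\<S> \<in> \<P>" if "\<S> \<subseteq> \<P>" "\<Union>\<S> \<in> local_homeos FT FT" for \<S>
    proof -
      have "transversally_lipschitz (\<Union>\<S>)"
        by (rule transversally_lipschitz_Union) (use that in \<open>auto simp: \<P>_def\<close>)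
      moreover have "(\<Union>\<S>)\<inverse> = \<Union>(converse ` \<S>)" by auto
      moreover have "transversally_lipschitz (\<Union>(converse ` \<S>))"
      proof (rule transversally_lipschitz_Union)
        show "\<Union>(converse ` \<S>) \<in> local_homeos FT FT"
          using local_homeos_converse[OF that(2)] \<open>(\<Union>\<S>)\<inverse> = \<Union>(converse ` \<S>)\<close> by simp
        show "transversally_lipschitz q \<and> q \<in> local_homeos FT FT" if "q \<in> converse ` \<S>" for q
        proof -
          obtain s where "s \<in> \<P>" "q = s\<inverse>" using \<open>q \<in> converse ` \<S>\<close> \<open>\<S> \<subseteq> \<P>\<close> by blast
          then show ?thesis using local_homeos_converse by (auto simp: \<P>_def)
        qed
      qed
      ultimately show ?thesis using that(2) by (simp add: \<P>_def)
    qed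
  qed
  moreover have "transverse_changes M X A \<subseteq> \<P>"
  proof
    fix g assume "g \<in> transverse_changes M X A"
    then obtain x y Z where g: "g \<in> local_homeos FT FT" and xy: "x \<in> topspace M" "y \<in> topspace M"
      and Z: "openin M Z" "Z \<subseteq> chart_nbhd A x \<inter> chart_nbhd A y"
      and geq: "g = (\<lambda>z. ((x, snd (chart A x z)), (y, snd (chart A y z)))) ` Z"
      unfolding transverse_changes_def by blast
    have "g\<inverse> = (\<lambda>z. ((y, snd (chart A y z)), (x, snd (chart A x z)))) ` Z"
      unfolding geq by auto
    then have "transversally_lipschitz (g\<inverse>)"
      using Z by (intro transverse_change_lipschitz[OF xy(2,1) Z(1)] local_homeos_converse[OF g]) auto
    then show "g \<in> \<P>"
      using transverse_change_lipschitz[OF xy Z geq g] g by (simp add: \<P>_def)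
  qed
  ultimately have "holonomy_pseudogroup M X A \<subseteq> \<P>"
    unfolding holonomy_pseudogroup_def by (intro hull_minimal)
  then show ?thesis using assms by (auto simp: \<P>_def)
qed

end

end


section \<open>Non-embedding\<close>

text \<open>Orbits of the conjugate of \<open>\<phi>\<close> lie in orbits of the fusion, whose
  orbit relation is symmetric and hence covers backward iterates too. Density is transported from
  \<open>Y\<close> by \<open>h\<close>.\<close>

lemma fusion_minimal:
  assumes "minimal_cantor_action Y \<phi>" and h: "homeomorphic_map (tree_space n) Y h"
  shows "minimal_pseudogroup (tree_space n) (fusion_pseudogroup n h \<phi>)"
proof -
  let ?K = "topspace (tree_space n)" and ?P = "fusion_pseudogroup n h \<phi>"
  define k where "k y = inv_into ?K h y" for y
  have \<phi>: "homeomorphic_map Y Y \<phi>"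
    and dense: "\<And>y. y \<in> topspace Y \<Longrightarrow>
      Y closure_of {z \<in> topspace Y. \<exists>k. (\<phi> ^^ k) y = z \<or> (\<phi> ^^ k) z = y} = topspace Y"
    using assms(1) by (auto simp: minimal_cantor_action_def)
  have hK: "h ` ?K = topspace Y" and inj: "inj_on h ?K"
    using h by (simp_all add: homeomorphic_imp_surjective_map homeomorphic_imp_injective_map)
  have kh: "k (h T) = T" if "T \<in> ?K" for T
    unfolding k_def using inj that by (rule inv_into_f_f)
  have hk: "h (k y) = y" "k y \<in> ?K" if "y \<in> topspace Y" for y
    using that unfolding k_def hK[symmetric] by (auto intro: f_inv_into_f inv_into_into)
  have \<phi>Y: "(\<phi> ^^ j) y \<in> topspace Y" if "y \<in> topspace Y" for y j
    using that homeomorphic_imp_surjective_map[OF \<phi>] by (induction j) auto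
  have gen: "{(T, k (\<phi> (h T))) | T. T \<in> ?K} \<in> ?P"
    unfolding fusion_pseudogroup_def k_def by (rule hull_inc) simp
  define R where "R S T \<longleftrightarrow> (\<exists>g\<in>?P. (S, T) \<in> g)" for S T
  have R_refl: "R T T" if "T \<in> ?K" for T
    using pseudogroup_hull_Id_on[OF openin_topspace[of "tree_space n"]] that
    unfolding R_def fusion_pseudogroup_def by blast
  have R_trans: "R S U" if "R S T" "R T U" for S T U
  proof -
    obtain g g' where g: "g \<in> ?P" "g' \<in> ?P" "(S, T) \<in> g" "(T, U) \<in> g'"
      using \<open>R S T\<close> \<open>R T U\<close> unfolding R_def by blast
    have "g O g' \<in> ?P"
      using g(1,2) unfolding fusion_pseudogroup_def by (rule pseudogroup_hull_comp)
    then show ?thesis using g(3,4) unfolding R_def by blast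
  qed
  have R_sym: "R T S" if "R S T" for S T
  proof -
    obtain g where g: "g \<in> ?P" "(S, T) \<in> g" using \<open>R S T\<close> unfolding R_def by blast
    have "g\<inverse> \<in> ?P"
      using g(1) unfolding fusion_pseudogroup_def by (rule pseudogroup_hull_converse)
    then show ?thesis using g(2) unfolding R_def by blast
  qed
  have R_iter: "R T (k ((\<phi> ^^ j) (h T)))" if T: "T \<in> ?K" for T j
  proof (induction j)
    case 0
    then show ?case using R_refl[OF T] kh[OF T] by simp
  next
    case (Suc j)
    have y: "(\<phi> ^^ j) (h T) \<in> topspace Y" using \<phi>Y T hK by blast
    have "R (k ((\<phi> ^^ j) (h T))) (k (\<phi> (h (k ((\<phi> ^^ j) (h T))))))"
      unfolding R_def by (rule bexI[OF _ gen]) (use hk(2)[OF y] in blast)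
    then show ?case using R_trans[OF Suc.IH] hk(1)[OF y] by simp
  qed
  have "?K \<subseteq> tree_space n closure_of {S. R T S}" if T: "T \<in> ?K" for T
  proof
    fix S0 assume S0: "S0 \<in> ?K"
    have "\<exists>S. S \<in> {S. R T S} \<and> S \<in> W" if W: "S0 \<in> W" "openin (tree_space n) W" for W
    proof -
      have WK: "W \<subseteq> ?K" using W(2) by (rule openin_subset)
      have "openin Y (h ` W)" using homeomorphic_map_openness_eq[OF h] W(2) by blast
      moreover have "h S0 \<in> Y closure_of {z \<in> topspace Y. \<exists>k. (\<phi> ^^ k) (h T) = z \<or> (\<phi> ^^ k) z = h T}"
        using dense[of "h T"] T S0 hK by blast
      ultimately obtain z where z: "z \<in> h ` W" "\<exists>j. (\<phi> ^^ j) (h T) = z \<or> (\<phi> ^^ j) z = h T"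
        using closure_of_meets[of "h S0" Y _ "h ` W"] W(1) by blast
      obtain S where S: "S \<in> W" "z = h S" using z(1) by blast
      then have SK: "S \<in> ?K" using WK by blast
      obtain j where "(\<phi> ^^ j) (h T) = h S \<or> (\<phi> ^^ j) (h S) = h T" using z(2) S(2) by blast
      then have "R T S"
        using R_iter[OF T, of j] R_iter[OF SK, of j] kh[OF T] kh[OF SK] R_sym by auto
      then show ?thesis using S(1) by blast
    qed
    then show "S0 \<in> tree_space n closure_of {S. R T S}" using S0 unfolding in_closure_of by blast
  qed
  then show ?thesis
    unfolding minimal_pseudogroup_def R_def[symmetric]
    by (intro ballI equalityI closure_of_subset_topspace)
qed

lemma tree_translation_in_fusion:
  assumes "fst a < n"
  shows "tree_translation n [a] \<in> fusion_pseudogroup n h \<phi>"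
proof -
  have "[a] \<in> carrier (free_group n)" using assms by (simp add: carrier_free_group)
  then have "tree_translation n [a] \<in> tree_pseudogroup n"
    unfolding tree_pseudogroup_def by (intro hull_inc imageI)
  then show ?thesis unfolding fusion_pseudogroup_def by (intro hull_inc insertI2)
qed

context embedded_matchbox
begin

text \<open>Builds the coordinate demanded by \<open>no_lipschitz_coordinate\<close>. Each tree
  receives a local identification with the transversal and a chart of \<open>F\<close>, constant on
  cylinders of one level; the coordinate is the transverse value at the centre obtained this
  way.\<close>

lemma tree_pseudogroup_not_transverse:
  assumes plaques: plaques_to_plaques and n: "n \<ge> 2" and compact: "compact_space (tree_space n)"
    and equiv: "pseudogroup_equivalent (tree_space n) P FT (holonomy_pseudogroup M X A)"
    and P: "\<And>a. fst a < n \<Longrightarrow> tree_translation n [a] \<in> P"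
  shows False
proof -
  let ?K = "trees n"
  obtain \<Phi> where \<Phi>: "\<Phi> \<subseteq> local_homeos (tree_space n) FT"
    and domain: "\<And>T. T \<in> topspace (tree_space n) \<Longrightarrow> \<exists>\<eta>\<in>\<Phi>. \<exists>a. (T, a) \<in> \<eta>"
    and range: "\<And>a. a \<in> topspace FT \<Longrightarrow> \<exists>\<eta>\<in>\<Phi>. \<exists>T. (T, a) \<in> \<eta>"
    and PQ: "\<And>\<eta> \<zeta> p. \<eta> \<in> \<Phi> \<Longrightarrow> \<zeta> \<in> \<Phi> \<Longrightarrow> p \<in> P \<Longrightarrow> \<eta>\<inverse> O p O \<zeta> \<in> holonomy_pseudogroup M X A"
    by (rule pseudogroup_equivalentE[OF equiv], rule that)
  have \<Phi>lh: "\<eta> \<in> local_homeos (tree_space n) FT" if "\<eta> \<in> \<Phi>" for \<eta> using \<Phi> that by blast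
  have level: "\<exists>k. \<forall>T'\<in>?K. tree_agree n k T T' \<longrightarrow> (\<exists>a\<in>G. (T', a) \<in> \<eta>)"
    if "\<eta> \<in> \<Phi>" "openin FT G" "(T, a) \<in> \<eta>" "a \<in> G" for \<eta> G T a
  proof -
    have "openin (tree_space n) {T. \<exists>a\<in>G. (T, a) \<in> \<eta>}"
      by (rule local_homeos_preimage[OF \<Phi>lh[OF that(1)] that(2)])
    then show ?thesis using that(3,4) unfolding openin_tree_space by blast
  qed
  \<comment> \<open>Here \<open>d\<close> is a pair of an identification and a chart. Both must
    serve the entire cylinder of level \<open>k\<close> at \<open>T\<close>, and the resulting
    coordinate must be injective there.\<close>
  define Good where "Good k d T \<longleftrightarrow> fst d \<in> \<Phi> \<and> snd d \<in> F \<and>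
      (\<forall>T'\<in>?K. tree_agree n k T T' \<longrightarrow> (\<exists>a. (T', a) \<in> fst d \<and> center a \<in> fst (snd d))) \<and>
      (\<forall>R\<in>?K. \<forall>S\<in>?K. \<forall>a b. tree_agree n k T R \<longrightarrow> tree_agree n k T S \<longrightarrow> (R, a) \<in> fst d \<longrightarrow> (S, b) \<in> fst d \<longrightarrow>
        snd (snd (snd d) (center a)) = snd (snd (snd d) (center b)) \<longrightarrow> R = S)" for k d T
  have "\<exists>k d. Good k d T" if T: "T \<in> ?K" for T
  proof -
    obtain \<eta> a where \<eta>: "\<eta> \<in> \<Phi>" "(T, a) \<in> \<eta>" using domain T unfolding topspace_tree_space by blast
    have a: "a \<in> topspace FT" using local_homeos_topspace[OF \<Phi>lh[OF \<eta>(1)] \<eta>(2)] by simp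
    obtain x w where xw: "a = (x, w)" "x \<in> topspace M" "w \<in> transv A x"
      using a unfolding topspace_full_transversal by blast
    obtain U \<psi> where U: "(U, \<psi>) \<in> F" "center a \<in> U"
      using f_chart[OF center_topspace[OF a]] unfolding center_def by blast
    then have fU: "img x 0 w \<in> U" by (simp add: center_def xw(1))
    obtain G where G: "openin X G" "w \<in> G" "G \<subseteq> transv A x"
      "\<And>w. w \<in> G \<Longrightarrow> img x 0 w \<in> U"
      "\<And>w w'. w \<in> G \<Longrightarrow> w' \<in> G \<Longrightarrow> coord \<psi> x 0 w = coord \<psi> x 0 w' \<Longrightarrow> w = w'"
      by (rule transverse_coordinate_injective[OF xw(2,3) U(1) fU], rule that)
    have "openin FT ({x} \<times> G)"
      by (rule openin_full_transversal_slice[OF xw(2) G(1,3)])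
    then obtain k where k: "\<And>T'. T' \<in> ?K \<Longrightarrow> tree_agree n k T T' \<Longrightarrow> \<exists>b\<in>{x} \<times> G. (T', b) \<in> \<eta>"
      using level[OF \<eta>(1) _ \<eta>(2), of "{x} \<times> G"] G(2) xw(1) by blast
    have "Good k (\<eta>, U, \<psi>) T"
      unfolding Good_def fst_conv snd_conv
    proof (intro conjI ballI allI impI)
      fix T' assume "T' \<in> ?K" "tree_agree n k T T'"
      then obtain w' where "w' \<in> G" "(T', (x, w')) \<in> \<eta>" using k by blast
      then show "\<exists>a. (T', a) \<in> \<eta> \<and> center a \<in> U"
        using G(4) by (intro exI[of _ "(x, w')"]) (simp add: center_def)
    next
      fix R S b c
      assume *: "R \<in> ?K" "S \<in> ?K" "tree_agree n k T R" "tree_agree n k T S" "(R, b) \<in> \<eta>" "(S, c) \<in> \<eta>"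
        "snd (\<psi> (center b)) = snd (\<psi> (center c))"
      have inG: "b \<in> {x} \<times> G" if "R \<in> ?K" "tree_agree n k T R" "(R, b) \<in> \<eta>" for R b
        using k[OF that(1,2)] local_homeos_functional[OF \<Phi>lh[OF \<eta>(1)] that(3)] by blast
      obtain w1 where w1: "b = (x, w1)" "w1 \<in> G" using inG[OF *(1,3,5)] by blast
      obtain w2 where w2: "c = (x, w2)" "w2 \<in> G" using inG[OF *(2,4,6)] by blast
      have "b = c" using G(5)[OF w1(2) w2(2)] *(7) by (simp add: center_def w1(1) w2(1))
      then show "R = S" using local_homeos_injective[OF \<Phi>lh[OF \<eta>(1)]] *(5,6) by blast
    qed (use \<eta> U in auto)
    then show ?thesis by blast
  qed
  then obtain m where m: "\<And>T. T \<in> ?K \<Longrightarrow> \<exists>T0\<in>?K. \<exists>k\<le>m. (\<exists>d. Good k d T0) \<and> tree_agree n k T0 T"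
    using tree_space_uniform_level[OF compact, of "\<lambda>T k. \<exists>d. Good k d T"] by metis
  have Good_ex: "\<exists>d. Good m d T" if "T \<in> ?K" for T
  proof -
    obtain T0 k d where kd: "k \<le> m" "Good k d T0" "tree_agree n k T0 T" using m[OF \<open>T \<in> ?K\<close>] by blast
    have "tree_agree n k T0 T'" if "tree_agree n m T T'" for T'
      using tree_agree_trans[OF kd(3) tree_agree_mono[OF that kd(1)]] .
    then have "Good m d T" using kd(2) unfolding Good_def by blast
    then show ?thesis ..
  qed
  have Good_cong: "Good m d T = Good m d T'" if "tree_agree n m T T'" for d T T'
  proof -
    have "tree_agree n m T = tree_agree n m T'"
      using that by (auto simp: tree_agree_def)
    then show ?thesis unfolding Good_def by simp
  qed
  \<comment> \<open>By \<open>Good_cong\<close> the predicate depends only on the ball of radius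
    \<open>m\<close>, so the choice operator returns the same data throughout a cylinder. This makes
    \<open>\<kappa>\<close> continuous.\<close>
  define D where "D T = (SOME d. Good m d T)" for T
  have D: "Good m (D T) T" if "T \<in> ?K" for T
    unfolding D_def using Good_ex[OF that] by (rule someI_ex)
  have D_cong: "D T = D T'" if "tree_agree n m T T'" for T T'
    unfolding D_def Good_cong[OF that] by (rule refl)
  \<comment> \<open>The inner choice is forced for every tree in the space, because the
    identification is single-valued.\<close>
  define \<kappa> where "\<kappa> T = snd (snd (snd (D T)) (center (SOME a. (T, a) \<in> fst (D T))))" for T
  have D\<Phi>: "fst (D T) \<in> \<Phi>" "snd (D T) \<in> F" if "T \<in> ?K" for T
    using D[OF that] by (simp_all add: Good_def)
  have D_ex: "\<exists>a. (T', a) \<in> fst (D T) \<and> center a \<in> fst (snd (D T))"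
    if "T \<in> ?K" "T' \<in> ?K" "tree_agree n m T T'" for T T'
    using D[OF that(1)] that(2,3) unfolding Good_def by blast
  have \<kappa>: "\<kappa> T' = snd (snd (snd (D T)) (center a))"
    if "T \<in> ?K" "tree_agree n m T T'" "(T', a) \<in> fst (D T)" for T T' a
  proof -
    have "(SOME a. (T', a) \<in> fst (D T)) = a"
      using that(3) local_homeos_functional[OF \<Phi>lh[OF D\<Phi>(1)[OF that(1)]]] by (intro some_equality) auto
    then show ?thesis unfolding \<kappa>_def D_cong[OF that(2), symmetric] by simp
  qed
  show False
  proof (rule no_lipschitz_coordinate[OF n compact, of \<kappa>])
    show "continuous_map (tree_space n) euclidean \<kappa>"
      unfolding continuous_map_def topspace_tree_space
    proof (intro conjI allI impI)
      fix V :: "'f set" assume "openin euclidean V"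
      then have V: "open V" by simp
      show "openin (tree_space n) {T \<in> ?K. \<kappa> T \<in> V}"
        unfolding openin_tree_space
      proof (intro conjI ballI)
        fix T assume "T \<in> {T \<in> ?K. \<kappa> T \<in> V}"
        then have T: "T \<in> ?K" "\<kappa> T \<in> V" by auto
        define U \<psi> where "U = fst (snd (D T))" and "\<psi> = snd (snd (D T))"
        have U: "(U, \<psi>) \<in> F" using D\<Phi>(2)[OF T(1)] by (simp add: U_def \<psi>_def)
        obtain a where a: "(T, a) \<in> fst (D T)" "center a \<in> U"
          using D_ex[OF T(1) T(1) tree_agree_refl] by (auto simp: U_def)
        define W where "W = {p \<in> topspace FT. center p \<in> {z \<in> U. fst (\<psi> z) \<in> UNIV \<and> snd (\<psi> z) \<in> V}}"
        have "openin FT W"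
          unfolding W_def using fol.fol_product_open[OF U open_UNIV V] by (rule center_open)
        moreover have "a \<in> W"
          using a T(2) \<kappa>[OF T(1) tree_agree_refl a(1)] local_homeos_topspace[OF \<Phi>lh[OF D\<Phi>(1)[OF T(1)]] a(1)]
          by (simp add: W_def \<psi>_def)
        ultimately obtain k where k: "\<forall>T'\<in>?K. tree_agree n k T T' \<longrightarrow> (\<exists>a\<in>W. (T', a) \<in> fst (D T))"
          using level[OF D\<Phi>(1)[OF T(1)] _ a(1)] by blast
        have "T' \<in> {T \<in> ?K. \<kappa> T \<in> V}" if T': "T' \<in> ?K" "tree_agree n (max k m) T T'" for T'
        proof -
          have agree: "tree_agree n k T T'" "tree_agree n m T T'" using tree_agree_mono[OF T'(2)] by auto
          then obtain a' where "a' \<in> W" "(T', a') \<in> fst (D T)" using k T'(1) by blast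
          then show ?thesis using \<kappa>[OF T(1) agree(2)] T'(1) by (auto simp: W_def \<psi>_def)
        qed
        then show "\<exists>k. \<forall>T'\<in>?K. tree_agree n k T T' \<longrightarrow> T' \<in> {T \<in> ?K. \<kappa> T \<in> V}" by blast
      qed blast
    qed simp
    show "\<exists>k. \<forall>S\<in>?K. \<forall>T\<in>?K. tree_agree n k T0 S \<longrightarrow> tree_agree n k T0 T \<longrightarrow> \<kappa> S = \<kappa> T \<longrightarrow> S = T"
      if T0: "T0 \<in> ?K" for T0
    proof (intro exI[of _ m] ballI impI)
      fix S T assume *: "S \<in> ?K" "T \<in> ?K" "tree_agree n m T0 S" "tree_agree n m T0 T" "\<kappa> S = \<kappa> T"
      obtain a where a: "(S, a) \<in> fst (D T0)" using D_ex[OF T0 *(1,3)] by blast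
      obtain b where b: "(T, b) \<in> fst (D T0)" using D_ex[OF T0 *(2,4)] by blast
      have "snd (snd (snd (D T0)) (center a)) = snd (snd (snd (D T0)) (center b))"
        using \<kappa>[OF T0 *(3) a] \<kappa>[OF T0 *(4) b] *(5) by simp
      then show "S = T" using D[OF T0] * a b unfolding Good_def by blast
    qed
    show "\<exists>k C. \<forall>S\<in>?K. \<forall>T\<in>?K. tree_agree n k T0 S \<longrightarrow> tree_agree n k T0 T \<longrightarrow>
        norm (\<kappa> (tree_shift a S) - \<kappa> (tree_shift a T)) \<le> C * norm (\<kappa> S - \<kappa> T)"
      if T0: "T0 \<in> ?K" and a: "[a] \<in> T0" for T0 a
    proof -
      define T1 where "T1 = tree_shift a T0"
      have T1: "T1 \<in> ?K" unfolding T1_def using T0 a by (rule tree_shift_closed)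
      have an: "fst a < n" using subtree_letter(2)[OF trees_pointed[OF T0] a] .
      \<comment> \<open>The translation by \<open>a\<close>, read in the transversal through the
        data at \<open>T0\<close> and at its shift. Equivalence of pseudogroups makes it a holonomy
        element.\<close>
      define q where "q = (fst (D T0))\<inverse> O tree_translation n [a] O fst (D T1)"
      have q: "transversally_lipschitz q"
        unfolding q_def by (intro holonomy_lipschitz[OF plaques] PQ D\<Phi> T0 T1 P an)
      obtain b0 where b0: "(T0, b0) \<in> fst (D T0)" "center b0 \<in> fst (snd (D T0))"
        using D_ex[OF T0 T0 tree_agree_refl] by blast
      obtain b1 where b1: "(T1, b1) \<in> fst (D T1)" "center b1 \<in> fst (snd (D T1))"
        using D_ex[OF T1 T1 tree_agree_refl] by blast
      have step: "(b, c) \<in> q" if "S \<in> ?K" "[a] \<in> S" "(S, b) \<in> fst (D T0)" "(tree_shift a S, c) \<in> fst (D T1)" for S b c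
      proof -
        have "(S, tree_shift a S) \<in> tree_translation n [a]"
          unfolding tree_translation_letter[OF an] using that(1,2) by blast
        then show ?thesis unfolding q_def using that(3,4) by blast
      qed
      have "(b0, b1) \<in> q" using step[OF T0 a b0(1)] b1(1) unfolding T1_def by blast
      then obtain G C where G: "openin FT G" "b0 \<in> G" "0 \<le> C"
        "\<And>a1 a2 c1 c2. a1 \<in> G \<Longrightarrow> a2 \<in> G \<Longrightarrow> (a1, c1) \<in> q \<Longrightarrow> (a2, c2) \<in> q \<Longrightarrow>
           norm (snd (snd (snd (D T1)) (center c1)) - snd (snd (snd (D T1)) (center c2))) \<le>
           C * norm (snd (snd (snd (D T0)) (center a1)) - snd (snd (snd (D T0)) (center a2)))"
        by (rule transversally_lipschitzD[OF q, of b0 b1 "fst (snd (D T0))" "snd (snd (D T0))"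
              "fst (snd (D T1))" "snd (snd (D T1))"])
          (use D\<Phi>(2)[OF T0] D\<Phi>(2)[OF T1] b0(2) b1(2) that in auto)
      obtain k where k: "\<forall>T'\<in>?K. tree_agree n k T0 T' \<longrightarrow> (\<exists>a\<in>G. (T', a) \<in> fst (D T0))"
        using level[OF D\<Phi>(1)[OF T0] G(1) b0(1) G(2)] by blast
      \<comment> \<open>The level \<open>Suc m\<close> leaves agreement at level \<open>m\<close>
        after the shift, so the data chosen at \<open>T1\<close> still apply.\<close>
      define l where "l = max k (Suc m)"
      have near: "\<exists>b c. b \<in> G \<and> (b, c) \<in> q \<and> \<kappa> S = snd (snd (snd (D T0)) (center b)) \<and>
          \<kappa> (tree_shift a S) = snd (snd (snd (D T1)) (center c))"
        if S: "S \<in> ?K" "tree_agree n l T0 S" for S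
      proof -
        have agree: "tree_agree n k T0 S" "tree_agree n (Suc m) T0 S" "tree_agree n m T0 S"
          using tree_agree_mono[OF S(2)] by (auto simp: l_def)
        have aS: "[a] \<in> S" using tree_agreeD[OF agree(2) a trees_pointed[OF T0]] by simp
        have shK: "tree_shift a S \<in> ?K" using S(1) aS by (rule tree_shift_closed)
        have sh: "tree_agree n m T1 (tree_shift a S)"
          unfolding T1_def by (rule tree_shift_agree[OF agree(2) T0 S(1) a])
        obtain b where b: "b \<in> G" "(S, b) \<in> fst (D T0)" using k S(1) agree(1) by blast
        obtain c where c: "(tree_shift a S, c) \<in> fst (D T1)" using D_ex[OF T1 shK sh] by blast
        show ?thesis
          using b(1) step[OF S(1) aS b(2) c] \<kappa>[OF T0 agree(3) b(2)] \<kappa>[OF T1 sh c] by blast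
      qed
      show ?thesis
      proof (intro exI[of _ l] exI[of _ C] ballI impI)
        fix S T assume *: "S \<in> ?K" "T \<in> ?K" "tree_agree n l T0 S" "tree_agree n l T0 T"
        show "norm (\<kappa> (tree_shift a S) - \<kappa> (tree_shift a T)) \<le> C * norm (\<kappa> S - \<kappa> T)"
          using near[OF *(1,3)] near[OF *(2,4)] G(4) by metis
      qed
    qed
  qed
qed

end

text \<open>Non-embedding is shown for arbitrary homeomorphisms when the leaves of \<open>F\<close>
  are 2-dimensional, and for leaf-preserving ones in every leaf dimension. Each case ensures that
  plaques go to plaques.\<close>

theorem theorem8p4:
  fixes n :: nat
    and Y :: "'y topology" and \<phi> :: "'y \<Rightarrow> 'y" and h :: "letter list set \<Rightarrow> 'y"
    and M :: "'a topology" and X :: "'t topology" and A :: "('a, real^2, 't) chart_family"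
  assumes "n \<ge> 2"
    and "minimal_cantor_action Y \<phi>"
    and "homeomorphic_map (tree_space n) Y h"
    and "suspension_matchbox (tree_space n) (fusion_pseudogroup n h \<phi>) M X A"
  shows "minimal_pseudogroup (tree_space n) (fusion_pseudogroup n h \<phi>) \<and>
    minimal_matchbox M A \<and>
    (\<forall>(N :: 'm topology) (F :: ('m set \<times> ('m \<Rightarrow> 'e::euclidean_space \<times> 'f::euclidean_space)) set) S.
       C1_foliation N F \<and> invariant_subset F S \<longrightarrow>
         (DIM('e) = 2 \<longrightarrow> \<not> M homeomorphic_space subtopology N S) \<and>
         \<not> (\<exists>f. homeomorphic_map M (subtopology N S) f \<and>
                (\<forall>L\<in>leaves (foliation_charts M A). f ` L \<in> leaves F)))"
proof (intro conjI allI impI)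
  have mat: "matchbox_manifold M X A"
    and equiv: "pseudogroup_equivalent (tree_space n) (fusion_pseudogroup n h \<phi>)
      (full_transversal M X A) (holonomy_pseudogroup M X A)"
    using assms(4) by (simp_all add: suspension_matchbox_def)
  show min: "minimal_pseudogroup (tree_space n) (fusion_pseudogroup n h \<phi>)"
    using assms(2,3) by (rule fusion_minimal)
  show "minimal_matchbox M A"
    using matchbox.minimal_matchbox_if_minimal_pseudogroup[OF matchbox.intro[OF mat] min equiv] .
  \<comment> \<open>Compactness of the tree space is inherited through \<open>h\<close> from the
    Cantor set \<open>Y\<close>.\<close>
  have "compact_space Y" using assms(2) by (simp add: minimal_cantor_action_def cantor_space_def)
  then have compact: "compact_space (tree_space n)"
    using homeomorphic_compact_space homeomorphic_map_imp_homeomorphic_space[OF assms(3)] by blast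
  fix N :: "'m topology" and F :: "('m set \<times> ('m \<Rightarrow> 'e \<times> 'f)) set" and S
  assume NF: "C1_foliation N F \<and> invariant_subset F S"
  have emb: "embedded_matchbox M X A N F S f" if "homeomorphic_map M (subtopology N S) f" for f
    using mat NF that
    by (intro embedded_matchbox.intro matchbox.intro c1_foliation.intro embedded_matchbox_axioms.intro) auto
  have no: False if f: "homeomorphic_map M (subtopology N S) f" and "embedded_matchbox.plaques_to_plaques M A F f" for f
    using embedded_matchbox.tree_pseudogroup_not_transverse[OF emb[OF f] that(2) assms(1) compact equiv]
      tree_translation_in_fusion by blast
  show "\<not> M homeomorphic_space subtopology N S" if dim: "DIM('e) = 2"
  proof
    assume "M homeomorphic_space subtopology N S"
    then obtain f where f: "homeomorphic_map M (subtopology N S) f"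
      unfolding homeomorphic_space by blast
    show False
      using no[OF f embedded_matchbox.plaques_to_plaques_if_same_dimension[OF emb[OF f]]] dim by simp
  qed
  show "\<not> (\<exists>f. homeomorphic_map M (subtopology N S) f \<and>
                (\<forall>L\<in>leaves (foliation_charts M A). f ` L \<in> leaves F))"
    using no embedded_matchbox.plaques_to_plaques_if_leaves_to_leaves[OF emb] by blast
qed

end
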